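(* Let $C$ be an EKR-set of maximal flags in a finite classical polar space of rank $n\ge 3$ over $\mathbb{F}_q$ with parameter $e\in\{0,\frac12,1,\frac32,2\}$. If $e\ge 1$ or $n$ is even, then $$|C|\le\frac{\prod_{i=1}^{n}(q^{n+e-i}+1)\left[{n\atop 1}\right]_q\cdots\left[{1\atop 1}\right]_q}{1+q^{n+e-1}}=\prod_{i=2}^{n}(q^{n+e-i}+1)\left[{n\atop 1}\right]_q\cdots\left[{1\atop 1}\right]_q.$$ If $e=\frac12$ and $n$ is odd, then $$|C|\le\frac{\prod_{i=1}^{n}(q^{n+1/2-i}+1)\left[{n\atop 1}\right]_q\cdots\left[{1\atop 1}\right]_q}{1+q^{n/2}}=\prod_{\substack{i=1\\ i\ne(n+1)/2}}^{n}(q^{n+1/2-i}+1)\left[{n\atop 1}\right]_q\cdots\left[{1\atop 1}\right]_q.$$ If $e=0$ and $n$ is odd, then $$|C|\le\frac{\prod_{i=1}^{n}(q^{n-i}+1)\left[{n\atop 1}\right]_q\cdots\left[{1\atop 1}\right]_q}{2}=\prod_{i=1}^{n-1}(q^{n-i}+1)\left[{n\atop 1}\right]_q\cdots\left[{1\atop 1}\right]_q.$$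
   Context: $\left[{k\atop 1}\right]_q=(q^k-1)/(q-1)$. The finite classical polar spaces of rank $n$ over $\mathbb{F}_q$, with their group $G$ and parameter $e$, are: hyperbolic quadric, $G=\mathrm{PGO}^+(2n,q)$ (full group), $e=0$; hermitian polar space, $G=\mathrm{PGU}(2n,q)$, $q$ a square, $e=\frac12$; symplectic polar space, $G=\mathrm{PSp}(2n,q)$, or parabolic quadric, $G=\mathrm{PGO}(2n+1,q)$, $e=1$; hermitian polar space, $G=\mathrm{PGU}(2n+1,q)$, $q$ a square, $e=\frac32$; elliptic quadric, $G=\mathrm{PGO}^-(2n+2,q)$, $e=2$. The field of definition is $\mathbb{F}_q$ in all cases, including the hermitian ones. The subspaces of the polar space are the nonzero totally isotropic (totally singular) subspaces; the type of a subspace is its vector space dimension, in $\{1,\dots,n\}$. Every subspace of type $n-1$ lies in exactly $q^e+1$ subspaces of type $n$ (generators). A maximal flag is a chain $U_1\subset\dots\subset U_n$ with $U_i$ of type $i$. Two points are collinear if they span a totally isotropic (singular) subspace. A polar frame is a set of $2n$ points $\{e_{-n},\dots,e_{-1},e_1,\dots,e_n\}$ such that each $e_i$ is collinear with all points of the set except $e_{-i}$. Fix a polar frame and let $F=\{\langle e_1\rangle,\langle e_1,e_2\rangle,\dots,\langle e_1,\dots,e_n\rangle\}$ with stabilizer $B$ in $G$; $G$ is transitive on maximal flags. The Weyl group $W$ of type $B_n$ is the group of permutations of $\{\pm1,\dots,\pm n\}$ generated by $s_i=(i,i+1)(-i,-i-1)$ for $1\le i\le n-1$ and $t=(-n,n)$;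 it acts on the frame by permuting indices, and this action is induced by elements of $G$. Its longest element is $w_0=(-n,n)\cdots(-1,1)$. Two maximal flags $gF$ and $hF$ ($g,h\in G$) are opposite if $Bh^{-1}gB=Bw_0B$. An EKR-set of maximal flags is a set of maximal flags no two of which are opposite. *)

theory Defs
  imports "HOL-Analysis.Analysis"
begin

text \<open>The ambient space is the vector space \<open>'a ^ 'm\<close> of dimension \<open>CARD('m)\<close> over a finite
  field \<open>'a\<close> with \<open>q = CARD('a)\<close>.  A polar space is given by the form that defines it.\<close>

datatype ('a, 'v) form =
    Alternating "'v \<Rightarrow> 'v \<Rightarrow> 'a"
  | Hermitian "'v \<Rightarrow> 'v \<Rightarrow> 'a"
  | Quadratic "'v \<Rightarrow> 'a"

definition nondegenerate :: "('a::field ^ 'm::finite \<Rightarrow> 'a ^ 'm \<Rightarrow> 'a) \<Rightarrow> bool" where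
  "nondegenerate f \<longleftrightarrow> (\<forall>x. (\<forall>y. f x y = 0) \<longrightarrow> x = 0)"

definition bilinear_form :: "('a::field ^ 'm::finite \<Rightarrow> 'a ^ 'm \<Rightarrow> 'a) \<Rightarrow> bool" where
  "bilinear_form f \<longleftrightarrow>
     (\<forall>y. Vector_Spaces.linear (*s) (*) (\<lambda>x. f x y)) \<and>
     (\<forall>x. Vector_Spaces.linear (*s) (*) (\<lambda>y. f x y))"

definition alternating_form :: "('a::field ^ 'm::finite \<Rightarrow> 'a ^ 'm \<Rightarrow> 'a) \<Rightarrow> bool" where
  "alternating_form f \<longleftrightarrow> bilinear_form f \<and> (\<forall>x. f x x = 0)"

text \<open>Here \<open>r\<close> is the square root of \<open>q\<close>, so \<open>a \<mapsto> a ^ r\<close> is the involutory field automorphism;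
  in particular such a form exists only if \<open>q\<close> is a square.\<close>

definition hermitian_form :: "('a::{field,finite} ^ 'm::finite \<Rightarrow> 'a ^ 'm \<Rightarrow> 'a) \<Rightarrow> bool" where
  "hermitian_form f \<longleftrightarrow>
     (\<exists>r::nat. r ^ 2 = CARD('a) \<and>
        (\<forall>y. Vector_Spaces.linear (*s) (*) (\<lambda>x. f x y)) \<and>
        (\<forall>x y. f y x = f x y ^ r))"

definition polar_form :: "('a::field ^ 'm::finite \<Rightarrow> 'a) \<Rightarrow> 'a ^ 'm \<Rightarrow> 'a ^ 'm \<Rightarrow> 'a" where
  "polar_form Q x y = Q (x + y) - Q x - Q y"

definition quadratic_form :: "('a::field ^ 'm::finite \<Rightarrow> 'a) \<Rightarrow> bool" where
  "quadratic_form Q \<longleftrightarrow> (\<forall>c x. Q (c *s x) = c ^ 2 * Q x) \<and> bilinear_form (polar_form Q)"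

text \<open>Nonsingularity rather than nondegeneracy of the polar form: in characteristic 2 the polar
  form of a parabolic quadric has a one-dimensional radical.\<close>

definition nonsingular :: "('a::field ^ 'm::finite \<Rightarrow> 'a) \<Rightarrow> bool" where
  "nonsingular Q \<longleftrightarrow> (\<forall>x. Q x = 0 \<and> (\<forall>y. polar_form Q x y = 0) \<longrightarrow> x = 0)"

fun totally_isotropic :: "('a::field, 'a ^ 'm::finite) form \<Rightarrow> ('a ^ 'm) set \<Rightarrow> bool" where
  "totally_isotropic (Alternating f) U \<longleftrightarrow> (\<forall>x\<in>U. \<forall>y\<in>U. f x y = 0)"
| "totally_isotropic (Hermitian f) U \<longleftrightarrow> (\<forall>x\<in>U. \<forall>y\<in>U. f x y = 0)"
| "totally_isotropic (Quadratic Q) U \<longleftrightarrow> (\<forall>x\<in>U. Q x = 0)"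

definition polar_rank :: "('a::field, 'a ^ 'm::finite) form \<Rightarrow> nat" where
  "polar_rank \<Phi> = Max (vec.dim ` {U. vec.subspace U \<and> totally_isotropic \<Phi> U})"

text \<open>\<open>classical_polar_space \<Phi> n e\<close>: the form \<open>\<Phi>\<close> defines a finite classical polar space of rank
  \<open>n\<close> with parameter \<open>e\<close>.  The condition on the rank separates the hyperbolic from the elliptic
  quadrics; in the other cases it follows from the condition on the dimension.\<close>

inductive classical_polar_space ::
  "('a::{field,finite}, 'a ^ 'm::finite) form \<Rightarrow> nat \<Rightarrow> real \<Rightarrow> bool" where
  hyperbolic_quadric:
    "\<lbrakk>quadratic_form Q; nonsingular Q; CARD('m) = 2 * n; polar_rank (Quadratic Q) = n\<rbrakk>
      \<Longrightarrow> classical_polar_space (Quadratic Q :: ('a, 'a ^ 'm) form) n 0"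
| hermitian_even:
    "\<lbrakk>hermitian_form f; nondegenerate f; CARD('m) = 2 * n; polar_rank (Hermitian f) = n\<rbrakk>
      \<Longrightarrow> classical_polar_space (Hermitian f :: ('a, 'a ^ 'm) form) n (1/2)"
| symplectic:
    "\<lbrakk>alternating_form f; nondegenerate f; CARD('m) = 2 * n; polar_rank (Alternating f) = n\<rbrakk>
      \<Longrightarrow> classical_polar_space (Alternating f :: ('a, 'a ^ 'm) form) n 1"
| parabolic_quadric:
    "\<lbrakk>quadratic_form Q; nonsingular Q; CARD('m) = 2 * n + 1; polar_rank (Quadratic Q) = n\<rbrakk>
      \<Longrightarrow> classical_polar_space (Quadratic Q :: ('a, 'a ^ 'm) form) n 1"
| hermitian_odd:
    "\<lbrakk>hermitian_form f; nondegenerate f; CARD('m) = 2 * n + 1; polar_rank (Hermitian f) = n\<rbrakk>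
      \<Longrightarrow> classical_polar_space (Hermitian f :: ('a, 'a ^ 'm) form) n (3/2)"
| elliptic_quadric:
    "\<lbrakk>quadratic_form Q; nonsingular Q; CARD('m) = 2 * n + 2; polar_rank (Quadratic Q) = n\<rbrakk>
      \<Longrightarrow> classical_polar_space (Quadratic Q :: ('a, 'a ^ 'm) form) n 2"

definition polar_subspace :: "('a::field, 'a ^ 'm::finite) form \<Rightarrow> ('a ^ 'm) set \<Rightarrow> bool" where
  "polar_subspace \<Phi> U \<longleftrightarrow> vec.subspace U \<and> U \<noteq> {0} \<and> totally_isotropic \<Phi> U"

definition polar_point :: "('a::field, 'a ^ 'm::finite) form \<Rightarrow> ('a ^ 'm) set \<Rightarrow> bool" where
  "polar_point \<Phi> P \<longleftrightarrow> polar_subspace \<Phi> P \<and> vec.dim P = 1"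

definition collinear_points ::
  "('a::field, 'a ^ 'm::finite) form \<Rightarrow> ('a ^ 'm) set \<Rightarrow> ('a ^ 'm) set \<Rightarrow> bool" where
  "collinear_points \<Phi> P R \<longleftrightarrow> totally_isotropic \<Phi> (vec.span (P \<union> R))"

definition maximal_flag ::
  "('a::field, 'a ^ 'm::finite) form \<Rightarrow> nat \<Rightarrow> ('a ^ 'm) set set \<Rightarrow> bool" where
  "maximal_flag \<Phi> n X \<longleftrightarrow>
     (\<exists>U :: nat \<Rightarrow> ('a ^ 'm) set.
        (\<forall>i\<in>{1..n}. polar_subspace \<Phi> (U i) \<and> vec.dim (U i) = i) \<and>
        (\<forall>i\<in>{1..<n}. U i \<subset> U (Suc i)) \<and>
        X = U ` {1..n})"

fun preserves_form :: "('a::field, 'a ^ 'm::finite) form \<Rightarrow> ('a ^ 'm \<Rightarrow> 'a ^ 'm) \<Rightarrow> bool" where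
  "preserves_form (Alternating f) g \<longleftrightarrow> (\<forall>x y. f (g x) (g y) = f x y)"
| "preserves_form (Hermitian f) g \<longleftrightarrow> (\<forall>x y. f (g x) (g y) = f x y)"
| "preserves_form (Quadratic Q) g \<longleftrightarrow> (\<forall>x. Q (g x) = Q x)"

definition isometry :: "('a::field, 'a ^ 'm::finite) form \<Rightarrow> ('a ^ 'm \<Rightarrow> 'a ^ 'm) \<Rightarrow> bool" where
  "isometry \<Phi> g \<longleftrightarrow> Vector_Spaces.linear (*s) (*s) g \<and> bij g \<and> preserves_form \<Phi> g"

text \<open>The group \<open>G\<close> (one of PGO, PGU, PSp) is the isometry group modulo scalars, realised as a
  group of permutations of the subspaces of the ambient space: two isometries induce the same
  permutation iff they differ by a scalar.  The permutations are extended by the identity to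
  sets that are not subspaces, so that composition and inverse are those of plain functions.\<close>

definition projectivity :: "('a::field ^ 'm::finite \<Rightarrow> 'a ^ 'm) \<Rightarrow> ('a ^ 'm) set \<Rightarrow> ('a ^ 'm) set" where
  "projectivity g U = (if vec.subspace U then g ` U else U)"

definition polar_group ::
  "('a::field, 'a ^ 'm::finite) form \<Rightarrow> (('a ^ 'm) set \<Rightarrow> ('a ^ 'm) set) set" where
  "polar_group \<Phi> = {projectivity g | g. isometry \<Phi> g}"

definition frame_indices :: "nat \<Rightarrow> int set" where
  "frame_indices n = {- int n..int n} - {0}"

text \<open>Frames are indexed, as the standard flag depends on the indexing.\<close>

definition polar_frame ::
  "('a::field, 'a ^ 'm::finite) form \<Rightarrow> nat \<Rightarrow> (int \<Rightarrow> ('a ^ 'm) set) \<Rightarrow> bool" where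
  "polar_frame \<Phi> n p \<longleftrightarrow>
     inj_on p (frame_indices n) \<and>
     (\<forall>i\<in>frame_indices n. polar_point \<Phi> (p i)) \<and>
     (\<forall>i\<in>frame_indices n. \<forall>j\<in>frame_indices n. collinear_points \<Phi> (p i) (p j) \<longleftrightarrow> j \<noteq> - i)"

definition standard_flag :: "nat \<Rightarrow> (int \<Rightarrow> ('a::field ^ 'm::finite) set) \<Rightarrow> ('a ^ 'm) set set" where
  "standard_flag n p = (\<lambda>i. vec.span (\<Union>j\<in>{1..i}. p (int j))) ` {1..n}"

definition flag_stabilizer ::
  "('a::field, 'a ^ 'm::finite) form \<Rightarrow> ('a ^ 'm) set set \<Rightarrow> (('a ^ 'm) set \<Rightarrow> ('a ^ 'm) set) set" where
  "flag_stabilizer \<Phi> X = {b \<in> polar_group \<Phi>. b ` X = X}"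

definition double_coset :: "('b \<Rightarrow> 'b) set \<Rightarrow> ('b \<Rightarrow> 'b) \<Rightarrow> ('b \<Rightarrow> 'b) set" where
  "double_coset B g = {b \<circ> g \<circ> b' | b b'. b \<in> B \<and> b' \<in> B}"

text \<open>The longest element \<open>(-n,n)\<dots>(-1,1)\<close> of the Weyl group is the map \<open>i \<mapsto> -i\<close> on the indices.\<close>

definition induces_w0 ::
  "nat \<Rightarrow> (int \<Rightarrow> ('a::field ^ 'm::finite) set) \<Rightarrow> (('a ^ 'm) set \<Rightarrow> ('a ^ 'm) set) \<Rightarrow> bool" where
  "induces_w0 n p w \<longleftrightarrow> (\<forall>i\<in>frame_indices n. w (p i) = p (- i))"

text \<open>The double coset of \<open>w\<close> does not depend on the choice of the element \<open>w\<close> inducing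
  the longest element, since any two choices differ by an element fixing every point of the frame.\<close>

definition opposite ::
  "('a::field, 'a ^ 'm::finite) form \<Rightarrow> nat \<Rightarrow> (int \<Rightarrow> ('a ^ 'm) set) \<Rightarrow>
    ('a ^ 'm) set set \<Rightarrow> ('a ^ 'm) set set \<Rightarrow> bool" where
  "opposite \<Phi> n p X Y \<longleftrightarrow>
     (let F = standard_flag n p; B = flag_stabilizer \<Phi> F in
      \<exists>g\<in>polar_group \<Phi>. \<exists>h\<in>polar_group \<Phi>. \<exists>w\<in>polar_group \<Phi>.
        X = g ` F \<and> Y = h ` F \<and> induces_w0 n p w \<and>
        double_coset B (inv h \<circ> g) = double_coset B w)"

definition EKR_set ::
  "('a::field, 'a ^ 'm::finite) form \<Rightarrow> nat \<Rightarrow> (int \<Rightarrow> ('a ^ 'm) set) \<Rightarrow>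
    ('a ^ 'm) set set set \<Rightarrow> bool" where
  "EKR_set \<Phi> n p C \<longleftrightarrow>
     (\<forall>X\<in>C. maximal_flag \<Phi> n X) \<and> pairwise (\<lambda>X Y. \<not> opposite \<Phi> n p X Y) C"

definition q_number :: "real \<Rightarrow> nat \<Rightarrow> real" where
  "q_number q k = (q ^ k - 1) / (q - 1)"

end

theory Submission
  imports Defs "HOL-Computational_Algebra.Primes" "HOL-Computational_Algebra.Polynomial"
begin

text \<open>Let \<open>T i\<close> be the adjacency operator of the graph on the maximal flags in which two flags are
  joined when they differ exactly in the subspace of type \<open>i\<close>.  These operators satisfy the
  relations of the Hecke algebra of type \<open>B n\<close> with parameters \<open>q\<close> and \<open>Q = q powr e\<close>.  Let
  \<open>A\<close> be the product of the commuting Jucys--Murphy operators \<open>J 0 = T n\<close>,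
  \<open>J (k + 1) = T (n - k - 1) J k T (n - k - 1)\<close>, \<open>k < n\<close>.  All rows of \<open>A\<close> have the sum \<open>q ^ (n * (n - 1)) * Q ^ n\<close>,
  and the row at a flag is supported on the flags opposite to it.

  The least eigenvalue of \<open>A\<close> has a joint eigenvector of all \<open>J k\<close>; write its eigenvalues as
  \<open>q ^ k * x k\<close>.  Two neighbours \<open>x k\<close>, \<open>x (k + 1)\<close> can be exchanged by an intertwiner when they have
  different signs or when \<open>\<bar>x (k + 1)\<bar> > q * \<bar>x k\<bar>\<close>, and \<open>x 0\<close> is \<open>Q\<close> or \<open>-1\<close>.  Hence the positive entries
  are at most \<open>Q, Q * q, Q * q\<^sup>2, \<dots>\<close> and the negative ones at most \<open>1, q, q\<^sup>2, \<dots>\<close> in absolute value, in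
  order of appearance.  If there are \<open>k\<close> negative entries, the eigenvalue has the sign \<open>(-1) ^ k\<close>
  and its absolute value is smaller than the row sum by a factor of at least \<open>q powr (k * (n - k + e))\<close>.
  Minimising this over odd \<open>k\<close> and using Hoffman's ratio bound gives the theorem.\<close>

section \<open>Spectra of Hecke algebras of type B\<close>

text \<open>The exponent \<open>k * (n - k + e)\<close> is concave in \<open>k\<close>, so only the
  extreme odd values compete: \<open>k = 1\<close> gives \<open>n + e - 1\<close>, and for odd
  \<open>n\<close> the value \<open>k = n\<close> gives \<open>n * e\<close>, which is smaller
  exactly when \<open>e < 1\<close>. This is where the three cases of the theorem come from.
  \<open>A\<close> belongs to the longest Weyl element, written as the product of the commuting sign
  changes \<open>(-n,n)\<close>, ..., \<open>(-1,1)\<close>. With this factorisation one joint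
  eigenvector inside the least eigenspace takes the place of the representation theory of the Hecke
  algebra. Two comparisons are made in one direction each. For the ratio bound, \<open>A\<close> has
  to vanish on pairs of flags that are not opposite, so the support of its rows is bounded from
  above. And opposition is defined by double cosets of a group, whereas \<open>A\<close> is
  described by incidence: geometrically opposite flags are shown to be opposite under the group. The
  latter is a transitivity statement, obtained from explicit isometries that work for all forms in
  all characteristics, including parabolic quadrics whose polar form has a radical.\<close>

lemma rayleigh_minimum:
  fixes A :: "'v::euclidean_space \<Rightarrow> 'v"
  assumes lin: "linear A" and S: "subspace S" "S \<noteq> {0}" and inv: "\<And>v. v \<in> S \<Longrightarrow> A v \<in> S"
    and sym: "\<And>v w. A v \<bullet> w = v \<bullet> A w"
  shows "\<exists>v\<in>S. \<exists>l. v \<noteq> 0 \<and> A v = l *\<^sub>R v \<and> (\<forall>w\<in>S. l * (w \<bullet> w) \<le> w \<bullet> A w)"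
proof -
  let ?K = "S \<inter> sphere 0 1"
  obtain z where z: "z \<in> S" "z \<noteq> 0" using S subspace_0 by auto
  have "z /\<^sub>R norm z \<in> ?K" using z S by (simp add: subspace_scale)
  moreover have "compact ?K" using S by (intro closed_Int_compact closed_subspace) auto
  moreover have "continuous_on ?K (\<lambda>w. w \<bullet> A w)"
    by (intro continuous_intros linear_continuous_on linear_linear[THEN iffD2]) (use lin in \<open>auto simp: linear_linear\<close>)
  ultimately obtain v where v: "v \<in> ?K" and mn: "\<And>w. w \<in> ?K \<Longrightarrow> v \<bullet> A v \<le> w \<bullet> A w"
    using continuous_attains_inf[of ?K "\<lambda>w. w \<bullet> A w"] by blast
  define l where "l = v \<bullet> A v"
  have vv: "v \<bullet> v = 1" using v by (simp add: dot_square_norm)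
  interpret linear A by fact
  have bound: "l * (w \<bullet> w) \<le> w \<bullet> A w" if w: "w \<in> S" for w
  proof (cases "w = 0")
    case True then show ?thesis by simp
  next
    case False
    have "w /\<^sub>R norm w \<in> ?K" using w False S by (simp add: subspace_scale)
    from mn[OF this] have "l \<le> (w \<bullet> A w) / (norm w)\<^sup>2"
      by (simp add: l_def scale field_simps power2_eq_square)
    then show ?thesis using False by (simp add: field_simps dot_square_norm)
  qed
  \<comment> \<open>The residual of \<open>v\<close>. Moving \<open>v\<close> along \<open>u\<close>
    changes the Rayleigh quotient to first order by a multiple of \<open>u \<bullet> u\<close>, so
    at a minimum the residual has to vanish.\<close>
  define u where "u = A v - l *\<^sub>R v"
  have uS: "u \<in> S" using v S inv by (auto simp: u_def intro!: subspace_diff subspace_scale)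
  define c where "c = u \<bullet> A u - l * (u \<bullet> u)"
  have "0 \<le> 2 * t * (u \<bullet> u) + t\<^sup>2 * c" for t
  proof -
    have "v + t *\<^sub>R u \<in> S" using v uS S by (auto intro: subspace_add subspace_scale)
    from bound[OF this]
    have "l * (v \<bullet> v + 2 * t * (u \<bullet> v) + t\<^sup>2 * (u \<bullet> u))
        \<le> v \<bullet> A v + t * (v \<bullet> A u + u \<bullet> A v) + t\<^sup>2 * (u \<bullet> A u)"
      by (simp add: add scale inner_add inner_commute power2_eq_square algebra_simps)
    moreover have Av: "A v = u + l *\<^sub>R v" by (simp add: u_def)
    moreover have "v \<bullet> A u = u \<bullet> u + l * (u \<bullet> v)"
      using sym[of v u] unfolding Av by (simp add: inner_add inner_commute)
    moreover have "u \<bullet> v = 0" using vv by (simp add: u_def l_def inner_diff inner_commute)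
    ultimately show ?thesis using vv by (simp add: c_def inner_add algebra_simps inner_commute)
  qed
  note q = this
  have "u \<bullet> u = 0"
  proof (rule ccontr)
    assume "u \<bullet> u \<noteq> 0"
    then have up: "u \<bullet> u > 0" by (simp add: dual_order.not_eq_order_implies_strict)
    \<comment> \<open>A negative \<open>t\<close> so small that the quadratic term, at most
      \<open>t\<^sup>2 * (\<bar>c\<bar> + 1) = - t * (u \<bullet> u)\<close>, cannot compensate the
      linear term \<open>2 * t * (u \<bullet> u)\<close>.\<close>
    define t where "t = - (u \<bullet> u) / (\<bar>c\<bar> + 1)"
    have "t\<^sup>2 * c \<le> t\<^sup>2 * (\<bar>c\<bar> + 1)" by (intro mult_left_mono) auto
    also have "\<dots> = t * (t * (\<bar>c\<bar> + 1))" by (simp add: power2_eq_square)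
    also have "t * (\<bar>c\<bar> + 1) = - (u \<bullet> u)" unfolding t_def by simp
    finally have "0 \<le> t * (u \<bullet> u)" using q[of t] by simp
    moreover have "t < 0" using up by (simp add: t_def divide_neg_pos)
    ultimately show False using up by (simp add: zero_le_mult_iff)
  qed
  then have "A v = l *\<^sub>R v" by (simp add: u_def)
  with v bound vv show ?thesis by (intro bexI[of _ v] exI[of _ l]) auto
qed

text \<open>The node with parameter \<open>Q\<close> comes first: \<open>J0\<close>, \<open>T 0\<close>, \<open>T 1\<close>, \<dots>, \<open>T (n - 2)\<close> is the order of the
  nodes along the diagram.  The quadratic relations hold on the invariant subspace \<open>S\<close> only.\<close>

locale hecke_algebra =
  fixes S :: "'v::euclidean_space set" and n :: nat and q Q :: real
    and J0 :: "'v \<Rightarrow> 'v" and T :: "nat \<Rightarrow> 'v \<Rightarrow> 'v"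
  assumes S: "subspace S"
    and n: "n \<ge> 1" and q: "q > 1" and Q: "Q > 0"
    and lin_J0: "linear J0" and sym_J0: "J0 v \<bullet> w = v \<bullet> J0 w" and S_J0: "v \<in> S \<Longrightarrow> J0 v \<in> S"
    and quad_J0: "v \<in> S \<Longrightarrow> J0 (J0 v) = (Q - 1) *\<^sub>R J0 v + Q *\<^sub>R v"
    and lin_T: "Suc k < n \<Longrightarrow> linear (T k)"
    and sym_T: "Suc k < n \<Longrightarrow> T k v \<bullet> w = v \<bullet> T k w"
    and S_T: "Suc k < n \<Longrightarrow> v \<in> S \<Longrightarrow> T k v \<in> S"
    and quad_T: "Suc k < n \<Longrightarrow> v \<in> S \<Longrightarrow> T k (T k v) = (q - 1) *\<^sub>R T k v + q *\<^sub>R v"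
    and far_T: "Suc k < n \<Longrightarrow> Suc l < n \<Longrightarrow> Suc k < l \<Longrightarrow> T k (T l v) = T l (T k v)"
    and far_J0: "0 < k \<Longrightarrow> Suc k < n \<Longrightarrow> T k (J0 v) = J0 (T k v)"
    and braid_T: "Suc (Suc k) < n \<Longrightarrow> T k (T (Suc k) (T k v)) = T (Suc k) (T k (T (Suc k) v))"
    and braid_J0: "Suc 0 < n \<Longrightarrow> J0 (T 0 (J0 (T 0 v))) = T 0 (J0 (T 0 (J0 v)))"
begin

section \<open>The commuting Jucys-Murphy operators\<close>

primrec J :: "nat \<Rightarrow> 'v \<Rightarrow> 'v" where
  "J 0 = J0"
| "J (Suc k) = T k \<circ> J k \<circ> T k"

primrec A :: "nat \<Rightarrow> 'v \<Rightarrow> 'v" where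
  "A 0 = id"
| "A (Suc k) = J k \<circ> A k"

lemma lin_J: "k < n \<Longrightarrow> linear (J k)"
proof (induction k)
  case 0 then show ?case using lin_J0 by simp
next
  case (Suc k)
  then show ?case by (simp only: J.simps) (intro linear_compose lin_T; simp)
qed

lemma sym_J: "k < n \<Longrightarrow> J k v \<bullet> w = v \<bullet> J k w"
  by (induction k arbitrary: v w) (auto simp: sym_J0 sym_T)

lemma S_J: "k < n \<Longrightarrow> v \<in> S \<Longrightarrow> J k v \<in> S"
  by (induction k arbitrary: v) (auto simp: S_J0 S_T)

lemma T_J_above: "j < k \<Longrightarrow> Suc k < n \<Longrightarrow> T k (J j v) = J j (T k v)"
proof (induction j arbitrary: v)
  case 0 then show ?case by (simp add: far_J0)
next
  case (Suc j)
  then have "T k (T j v) = T j (T k v)" for v using far_T[of j k v] by simp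
  with Suc show ?case by simp
qed

text \<open>In the first case \<open>j = k + 2\<close> the operator \<open>J k\<close> is conjugated
  by \<open>T (k + 1)\<close> and \<open>T k\<close>; the braid relation passes \<open>T k\<close>
  through these two as \<open>T (k + 1)\<close>, which commutes with \<open>J k\<close>. Larger
  \<open>j\<close> only add conjugations by generators far from \<open>T k\<close>.\<close>

lemma T_J_below: "Suc k < j \<Longrightarrow> j < n \<Longrightarrow> T k (J j v) = J j (T k v)"
proof (induction j arbitrary: v)
  case 0 then show ?case by simp
next
  case (Suc j)
  show ?case
  proof (cases "Suc k < j")
    case True
    then show ?thesis using Suc by (simp add: far_T)
  next
    case False
    then have j: "j = Suc k" using Suc.prems by simp
    have b: "T k (T (Suc k) (T k v)) = T (Suc k) (T k (T (Suc k) v))" for v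
      using Suc.prems j by (intro braid_T) auto
    have c: "J k (T (Suc k) v) = T (Suc k) (J k v)" for v
      using Suc.prems j by (simp add: T_J_above)
    show ?thesis unfolding j by (simp add: b c)
  qed
qed

text \<open>For \<open>j = 1\<close> this is the braid relation of length four between
  \<open>J0\<close> and \<open>T 0\<close>; the generators added for larger \<open>j\<close> commute
  with \<open>J0\<close>.\<close>

lemma J0_J: "j < n \<Longrightarrow> J0 (J j v) = J j (J0 v)"
proof (induction j arbitrary: v)
  case 0 then show ?case by simp
next
  case (Suc j)
  show ?case
  proof (cases j)
    case 0
    then show ?thesis using Suc.prems braid_J0 by simp
  next
    case (Suc i)
    then have "T j (J0 v) = J0 (T j v)" for v using Suc.prems by (intro far_J0) auto
    then show ?thesis using Suc.IH Suc.prems by (simp del: fun_upd_apply) (simp flip: \<open>\<And>v. T j (J0 v) = J0 (T j v)\<close>)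
  qed
qed

lemma J_commute_less: "i < j \<Longrightarrow> j < n \<Longrightarrow> J i (J j v) = J j (J i v)"
proof (induction i arbitrary: v)
  case 0 then show ?case by (simp add: J0_J)
next
  case (Suc i)
  then show ?case by (simp add: T_J_below)
qed

lemma J_commute: "i < n \<Longrightarrow> j < n \<Longrightarrow> J i (J j v) = J j (J i v)"
  using J_commute_less[of i j v] J_commute_less[of j i v] by (cases i j rule: linorder_cases) auto

lemma lin_A: "k \<le> n \<Longrightarrow> linear (A k)"
proof (induction k)
  case 0 then show ?case by (simp only: A.simps linear_id)
next
  case (Suc k)
  then show ?case by (simp only: A.simps) (intro linear_compose lin_J; simp)
qed

lemma S_A: "k \<le> n \<Longrightarrow> v \<in> S \<Longrightarrow> A k v \<in> S"
  by (induction k arbitrary: v) (auto simp: S_J)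

lemma J_A: "k \<le> n \<Longrightarrow> j < n \<Longrightarrow> J j (A k v) = A k (J j v)"
proof (induction k arbitrary: v)
  case 0 then show ?case by simp
next
  case (Suc k)
  then show ?case using J_commute[of j k] by simp
qed

lemma sym_A: "k \<le> n \<Longrightarrow> A k v \<bullet> w = v \<bullet> A k w"
proof (induction k arbitrary: v w)
  case 0 then show ?case by simp
next
  case (Suc k)
  then have "A (Suc k) v \<bullet> w = v \<bullet> A k (J k w)" using sym_J[of k] by simp
  then show ?case using J_A[of k k w] Suc.prems by simp
qed

section \<open>The joint spectrum and the exchange of neighbours\<close>

lemma inj_T: assumes "Suc k < n" "v \<in> S" "T k v = 0" shows "v = 0"
  using quad_T[OF assms(1,2)] assms(3) linear_0[OF lin_T[OF assms(1)]] q by simp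

text \<open>The quadratic relations have nonzero constant terms, so all generators and hence all
  \<open>J k\<close> are injective on \<open>S\<close>. Joint eigenvalues therefore have a
  sign.\<close>

lemma inj_J: "k < n \<Longrightarrow> v \<in> S \<Longrightarrow> J k v = 0 \<Longrightarrow> v = 0"
proof (induction k arbitrary: v)
  case 0
  then show ?case using quad_J0[of v] linear_0[OF lin_J0] Q by simp
next
  case (Suc k)
  have k: "k < n" using Suc.prems by simp
  have *: "T k v \<in> S" by (rule S_T[OF Suc.prems(1,2)])
  have "T k (J k (T k v)) = 0" using Suc.prems(3) by simp
  then have "J k (T k v) = 0" by (rule inj_T[OF Suc.prems(1) S_J[OF k *]])
  then have "T k v = 0" by (rule Suc.IH[OF k *])
  then show ?case by (rule inj_T[OF Suc.prems(1,2)])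
qed

text \<open>The power \<open>q ^ j\<close> is the normalisation under which an intertwiner acts on
  \<open>x\<close> as a plain transposition of neighbouring entries.\<close>

definition joint_eigenvector :: "'v \<Rightarrow> (nat \<Rightarrow> real) \<Rightarrow> bool" where
  "joint_eigenvector v x \<longleftrightarrow> v \<in> S \<and> v \<noteq> 0 \<and> (\<forall>j<n. J j v = (q ^ j * x j) *\<^sub>R v)"

definition spectrum :: "(nat \<Rightarrow> real) set" where
  "spectrum = {x. \<exists>v. joint_eigenvector v x}"

lemma spectrum_nz: assumes "x \<in> spectrum" "i < n" shows "x i \<noteq> 0"
proof
  assume "x i = 0"
  moreover obtain v where "v \<in> S" "v \<noteq> 0" "J i v = (q ^ i * x i) *\<^sub>R v"
    using assms unfolding spectrum_def joint_eigenvector_def by blast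
  ultimately show False using inj_J[OF assms(2), of v] by simp
qed

lemma spectrum_0: assumes "x \<in> spectrum" shows "x 0 = Q \<or> x 0 = -1"
proof -
  from assms obtain v where v: "v \<in> S" "v \<noteq> 0" "J0 v = x 0 *\<^sub>R v"
    unfolding spectrum_def joint_eigenvector_def using n by force
  have "J0 (J0 v) = (x 0)\<^sup>2 *\<^sub>R v" using v(3) linear_scale[OF lin_J0] by (simp add: power2_eq_square)
  then have "((x 0)\<^sup>2 - (Q - 1) * x 0 - Q) *\<^sub>R v = 0"
    using quad_J0[OF v(1)] v(3) by (simp add: algebra_simps)
  then have "(x 0)\<^sup>2 - (Q - 1) * x 0 - Q = 0" using v(2) by simp
  then have "(x 0 - Q) * (x 0 + 1) = 0" by (simp add: algebra_simps power2_eq_square)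
  then show ?thesis by auto
qed

text \<open>The intertwiner \<open>T k + s\<close> exchanges the eigenvalues of \<open>J k\<close> and \<open>J (k + 1)\<close>; it kills the
  eigenvector only if these are \<open>a\<close> and \<open>a\<close> or \<open>a\<close> and \<open>q\<^sup>2 a\<close>.\<close>

lemma spectrum_swap:
  assumes x: "x \<in> spectrum" and k: "Suc k < n"
    and ne: "x (Suc k) \<noteq> x k" "x (Suc k) \<noteq> q * x k" "q * x (Suc k) \<noteq> x k"
  shows "x(k := x (Suc k), Suc k := x k) \<in> spectrum"
proof -
  from x obtain v where v: "v \<in> S" "v \<noteq> 0" "\<And>j. j < n \<Longrightarrow> J j v = (q ^ j * x j) *\<^sub>R v"
    unfolding spectrum_def joint_eigenvector_def by auto
  define a where "a = q ^ k * x k"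
  define b where "b = q ^ k * x (Suc k)"
  \<comment> \<open>Found from \<open>J k w = b w\<close> for \<open>w = T k v + s v\<close>:
    comparing the coefficients of \<open>v\<close> gives
    \<open>s * (b - a) = - b * (q - 1)\<close>.\<close>
  define s where "s = - b * (q - 1) / (b - a)"
  have ab: "a \<noteq> b" "b \<noteq> q * a" "q * b \<noteq> a" using ne q by (auto simp: a_def b_def)
  have Ja: "J k v = a *\<^sub>R v" using v(3)[of k] k by (simp add: a_def)
  have Jb: "J (Suc k) v = (q * b) *\<^sub>R v" using v(3)[of "Suc k"] k by (simp add: b_def del: J.simps)
  interpret T: linear "T k" using lin_T k .
  interpret Jk: linear "J k" using lin_J k by simp
  interpret Jk1: linear "J (Suc k)" using lin_J k by blast
  have TT: "T k (T k u) = (q - 1) *\<^sub>R T k u + q *\<^sub>R u" if "u \<in> S" for u using quad_T k that by blast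
  \<comment> \<open>Applying \<open>T k\<close> once more and using the quadratic relation yields
    \<open>J k (T k v)\<close> without an inverse of \<open>T k\<close>.\<close>
  have "T k (T k (J k (T k v))) = (q * b) *\<^sub>R T k v" using Jb by (simp add: T.scale)
  then have "(q - 1) *\<^sub>R T k (J k (T k v)) + q *\<^sub>R J k (T k v) = (q * b) *\<^sub>R T k v"
    using TT[of "J k (T k v)"] k v(1) by (simp add: S_J S_T)
  then have "q *\<^sub>R J k (T k v) = (q * b) *\<^sub>R T k v - ((q - 1) * (q * b)) *\<^sub>R v"
    using Jb by (simp add: algebra_simps)
  also have "\<dots> = q *\<^sub>R (b *\<^sub>R T k v - (b * (q - 1)) *\<^sub>R v)" by (simp add: algebra_simps)
  finally have JT: "J k (T k v) = b *\<^sub>R T k v - (b * (q - 1)) *\<^sub>R v" using q by simp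
  have J1T: "J (Suc k) (T k v) = ((q - 1) * (q * b)) *\<^sub>R v + (q * a) *\<^sub>R T k v"
  proof -
    have "J (Suc k) (T k v) = T k (J k ((q - 1) *\<^sub>R T k v + q *\<^sub>R v))" using TT[OF v(1)] by simp
    also have "\<dots> = (q - 1) *\<^sub>R J (Suc k) v + q *\<^sub>R T k (J k v)"
      by (simp add: Jk.add Jk.scale T.add T.scale)
    finally show ?thesis unfolding Jb Ja by (simp add: T.scale)
  qed
  define w where "w = T k v + s *\<^sub>R v"
  have sab: "s * (b - a) = - b * (q - 1)" using ab by (simp add: s_def)
  have 1: "J k w = b *\<^sub>R w"
  proof -
    have "J k w = b *\<^sub>R T k v + (s * a - b * (q - 1)) *\<^sub>R v"
      unfolding w_def by (simp add: Jk.add Jk.scale JT Ja algebra_simps)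
    also have "s * a - b * (q - 1) = b * s" using sab by (simp add: algebra_simps)
    finally show ?thesis by (simp add: w_def algebra_simps)
  qed
  have 2: "J (Suc k) w = (q * a) *\<^sub>R w"
  proof -
    have "J (Suc k) w = (q * a) *\<^sub>R T k v + ((q - 1) * (q * b) + s * (q * b)) *\<^sub>R v"
      unfolding w_def by (simp add: Jk1.add Jk1.scale J1T Jb algebra_simps del: J.simps)
    also have "(q - 1) * (q * b) + s * (q * b) = q * (s * (b - a) + b * (q - 1) + s * a)"
      by (simp add: algebra_simps)
    also have "\<dots> = q * a * s" unfolding sab by simp
    finally show ?thesis by (simp add: w_def algebra_simps)
  qed
  \<comment> \<open>If \<open>w\<close> vanishes then \<open>- s\<close> is an eigenvalue of
    \<open>T k\<close>, that is \<open>q\<close> or \<open>-1\<close>; by the choice of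
    \<open>s\<close> this means \<open>b = q * a\<close> or \<open>a = q * b\<close>.\<close>
  have "w \<noteq> 0"
  proof
    assume "w = 0"
    then have Tv: "T k v = (- s) *\<^sub>R v" by (simp add: w_def eq_neg_iff_add_eq_0)
    have "(s\<^sup>2 + (q - 1) * s - q) *\<^sub>R v = 0"
      using TT[OF v(1)] unfolding Tv by (simp add: T.scale T.neg Tv power2_eq_square algebra_simps)
    then have "s\<^sup>2 + (q - 1) * s - q = 0" using v(2) by simp
    then have "(s + q) * (s - 1) = 0" by (simp add: algebra_simps power2_eq_square)
    then have "s = - q \<or> s = 1" by auto
    then show False using sab ab by (auto simp: algebra_simps)
  qed
  moreover have "w \<in> S" using v(1) S k by (auto simp: w_def intro!: subspace_add subspace_scale S_T)
  moreover have "J j w = (q ^ j * (x(k := x (Suc k), Suc k := x k)) j) *\<^sub>R w" if j: "j < n" for j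
  proof -
    consider "j = k" | "j = Suc k" | "j \<noteq> k" "j \<noteq> Suc k" by blast
    then show ?thesis
    proof cases
      case 1 then show ?thesis using \<open>J k w = b *\<^sub>R w\<close> by (simp add: b_def)
    next
      case 2 then show ?thesis using \<open>J (Suc k) w = (q * a) *\<^sub>R w\<close> by (simp add: a_def del: J.simps)
    next
      case 3
      interpret Jj: linear "J j" using lin_J j .
      have "J j (T k v) = T k (J j v)"
        using T_J_above[of j k v] T_J_below[of k j v] 3 j k by (cases "j < k") auto
      then show ?thesis using 3 v(3)[OF j]
        by (simp add: w_def Jj.add Jj.scale T.scale algebra_simps)
    qed
  qed
  ultimately show ?thesis unfolding spectrum_def joint_eigenvector_def by blast
qed

definition weight :: "(nat \<Rightarrow> real) \<Rightarrow> nat \<Rightarrow> real" where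
  "weight x i = (if x i > 0 then Q else 1) * q ^ card {j. j < i \<and> (x j > 0 \<longleftrightarrow> x i > 0)}"

text \<open>Induction on the position, over all joint spectra at once: an entry that violates the bound can
  be exchanged with its left neighbour.\<close>

lemma spectrum_weight: "x \<in> spectrum \<Longrightarrow> i < n \<Longrightarrow> \<bar>x i\<bar> \<le> weight x i"
proof (induction i arbitrary: x)
  case 0
  then show ?case using spectrum_0[OF 0(1)] Q by (auto simp: weight_def)
next
  case (Suc i)
  have i: "i < n" using Suc by simp
  have nz: "x i \<noteq> 0" "x (Suc i) \<noteq> 0" using spectrum_nz Suc i by blast+
  let ?y = "x(i := x (Suc i), Suc i := x i)"
  have y: "weight ?y i = (if x (Suc i) > 0 then Q else 1) * q ^ card {j. j < i \<and> (x j > 0 \<longleftrightarrow> x (Suc i) > 0)}"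
  proof -
    have "{j. j < i \<and> (?y j > 0 \<longleftrightarrow> ?y i > 0)} = {j. j < i \<and> (x j > 0 \<longleftrightarrow> x (Suc i) > 0)}" by auto
    then show ?thesis by (simp add: weight_def)
  qed
  show ?case
  proof (cases "x i > 0 \<longleftrightarrow> x (Suc i) > 0")
    case False
    \<comment> \<open>Entries of opposite sign can always be exchanged, and the weight of the right
      one does not count the entry at \<open>i\<close>, so the bound carries over unchanged.\<close>
    then have "x i * x (Suc i) < 0" using nz by (auto simp: mult_less_0_iff)
    then have "x (Suc i) \<noteq> x i" "x (Suc i) \<noteq> q * x i" "q * x (Suc i) \<noteq> x i"
      using nz q zero_less_mult_iff[of q "x i"] zero_less_mult_iff[of q "x (Suc i)"]
      by (auto simp: mult_less_0_iff)
    then have "?y \<in> spectrum" using Suc by (intro spectrum_swap) auto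
    from Suc.IH[OF this i] have "\<bar>?y i\<bar> \<le> weight ?y i" .
    then have "\<bar>x (Suc i)\<bar> \<le> weight ?y i" by (subst (asm) fun_upd_other) auto
    moreover have "{j. j < Suc i \<and> (x j > 0 \<longleftrightarrow> x (Suc i) > 0)} = {j. j < i \<and> (x j > 0 \<longleftrightarrow> x (Suc i) > 0)}"
      using False by (auto simp: less_Suc_eq)
    ultimately show ?thesis unfolding y by (simp add: weight_def)
  next
    case True
    have "{j. j < Suc i \<and> (x j > 0 \<longleftrightarrow> x (Suc i) > 0)} = insert i {j. j < i \<and> (x j > 0 \<longleftrightarrow> x (Suc i) > 0)}"
      using True by (auto simp: less_Suc_eq)
    \<comment> \<open>With equal signs the admissible size grows by the factor \<open>q\<close> from
      \<open>i\<close> to \<open>i + 1\<close>. Either the entry respects this growth, or the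
      exchange shows that it obeys even the smaller bound at \<open>i\<close>.\<close>
    then have w: "weight x (Suc i) = q * weight ?y i" unfolding y by (simp add: weight_def)
    have wx: "weight ?y i = weight x i" unfolding y using True by (simp add: weight_def)
    show ?thesis
    proof (cases "\<bar>x (Suc i)\<bar> \<le> q * \<bar>x i\<bar>")
      case True
      then have "\<bar>x (Suc i)\<bar> \<le> q * \<bar>x i\<bar>" .
      also have "\<dots> \<le> q * weight x i" using Suc.IH[OF Suc.prems(1) i] q by simp
      finally show ?thesis using w wx by simp
    next
      case False
      have "q * \<bar>x i\<bar> \<ge> \<bar>x i\<bar>" "q * \<bar>x (Suc i)\<bar> \<ge> \<bar>x (Suc i)\<bar>" using q by (auto simp: mult_le_cancel_right1)
      then have "x (Suc i) \<noteq> x i" "x (Suc i) \<noteq> q * x i" "q * x (Suc i) \<noteq> x i"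
        using False q by (auto simp: abs_mult)
      then have "?y \<in> spectrum" using Suc by (intro spectrum_swap) auto
      from Suc.IH[OF this i] have "\<bar>?y i\<bar> \<le> weight ?y i" .
      then have "\<bar>x (Suc i)\<bar> \<le> weight ?y i" by (subst (asm) fun_upd_other) auto
      also have "\<dots> \<le> q * weight ?y i" using q Q by (simp add: y mult_le_cancel_right1 not_less)
      finally show ?thesis using w by simp
    qed
  qed
qed

section \<open>From the weights to the least eigenvalue\<close>

lemma choose2_Suc: "Suc k choose 2 = k + (k choose 2)" by (simp add: numeral_2_eq_2)

text \<open>The entries of one sign carry the powers \<open>q ^ 0, q ^ 1, ...\<close> in order of
  appearance, whence one binomial coefficient for each sign.\<close>

lemma prod_weight:
  "(\<Prod>i<m. weight x i) = (let k = card {i. i < m \<and> \<not> x i > 0}; p = card {i. i < m \<and> x i > 0}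
     in Q ^ p * q ^ ((p choose 2) + (k choose 2)))"
proof (induction m)
  case 0 then show ?case by (simp add: numeral_2_eq_2)
next
  case (Suc m)
  have [simp]: "{i. i < Suc m \<and> x i > 0} = (if x m > 0 then insert m {i. i < m \<and> x i > 0} else {i. i < m \<and> x i > 0})"
    "{i. i < Suc m \<and> \<not> x i > 0} = (if x m > 0 then {i. i < m \<and> \<not> x i > 0} else insert m {i. i < m \<and> \<not> x i > 0})"
    by (auto simp: less_Suc_eq)
  show ?case using Suc by (simp add: weight_def Let_def choose2_Suc power_add mult_ac)
qed

lemma sgn_prod_spectrum:
  assumes "x \<in> spectrum" "m \<le> n"
  shows "(\<Prod>i<m. x i) = (-1) ^ card {i. i < m \<and> \<not> x i > 0} * (\<Prod>i<m. \<bar>x i\<bar>)"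
  using assms(2)
proof (induction m)
  case 0 then show ?case by simp
next
  case (Suc m)
  have [simp]: "{i. i < Suc m \<and> \<not> x i > 0} = (if x m > 0 then {i. i < m \<and> \<not> x i > 0} else insert m {i. i < m \<and> \<not> x i > 0})"
    by (auto simp: less_Suc_eq)
  show ?case using Suc by simp
qed

lemma A_joint_eigenvector:
  assumes "joint_eigenvector v x" "m \<le> n"
  shows "A m v = (q ^ (m choose 2) * (\<Prod>i<m. x i)) *\<^sub>R v"
  using assms(2)
proof (induction m)
  case 0 then show ?case by (simp add: numeral_2_eq_2)
next
  case (Suc m)
  then have "J m v = (q ^ m * x m) *\<^sub>R v" using assms(1) by (simp add: joint_eigenvector_def)
  then show ?case using Suc linear_scale[OF lin_J[of m]]
    by (simp add: choose2_Suc power_add mult_ac)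
qed

text \<open>Each eigenspace is invariant under the remaining operators by commutation, and
  \<open>rayleigh_minimum\<close> supplies an eigenvector of the next operator in it.\<close>

lemma joint_eigenvector_in:
  assumes E: "subspace E" "E \<noteq> {0}" "E \<subseteq> S" and inv: "\<And>j v. j < n \<Longrightarrow> v \<in> E \<Longrightarrow> J j v \<in> E"
  shows "\<exists>v\<in>E. \<exists>x. joint_eigenvector v x"
proof -
  have "\<exists>x. {v \<in> E. \<forall>j<m. J j v = (q ^ j * x j) *\<^sub>R v} \<noteq> {0}" if "m \<le> n" for m
    using that
  proof (induction m)
    case 0 then show ?case using E by simp
  next
    case (Suc m)
    then obtain x where x: "{v \<in> E. \<forall>j<m. J j v = (q ^ j * x j) *\<^sub>R v} \<noteq> {0}" (is "?F \<noteq> _") by auto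
    have sF: "subspace ?F"
      using E(1) Suc.prems linear_0[OF lin_J] linear_add[OF lin_J] linear_scale[OF lin_J]
      by (auto simp: subspace_def algebra_simps)
    have iF: "J m v \<in> ?F" if "v \<in> ?F" for v
    proof -
      have "J j (J m v) = (q ^ j * x j) *\<^sub>R J m v" if "j < m" for j
      proof -
        have "J j (J m v) = J m (J j v)" using that Suc.prems by (intro J_commute) auto
        then show ?thesis using that \<open>v \<in> ?F\<close> linear_scale[OF lin_J[of m]] Suc.prems by simp
      qed
      then show ?thesis using that inv Suc.prems by auto
    qed
    have m: "linear (J m)" "\<And>v w. J m v \<bullet> w = v \<bullet> J m w" using lin_J sym_J Suc.prems by auto
    obtain v l where v: "v \<in> ?F" "v \<noteq> 0" "J m v = l *\<^sub>R v"
      using rayleigh_minimum[OF m(1) sF x iF m(2)] by blast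
    let ?y = "x(m := l / q ^ m)"
    have "v \<in> {v \<in> E. \<forall>j<Suc m. J j v = (q ^ j * ?y j) *\<^sub>R v}"
      using v q by (auto simp: less_Suc_eq)
    with v(2) have "{v \<in> E. \<forall>j<Suc m. J j v = (q ^ j * ?y j) *\<^sub>R v} \<noteq> {0}" by blast
    then show ?case by (rule exI[of _ ?y])
  qed
  from this[of n] obtain x where x: "{v \<in> E. \<forall>j<n. J j v = (q ^ j * x j) *\<^sub>R v} \<noteq> {0}" by auto
  have "0 \<in> {v \<in> E. \<forall>j<n. J j v = (q ^ j * x j) *\<^sub>R v}"
    using E(1) linear_0[OF lin_J] by (simp add: subspace_0)
  with x obtain v where "v \<in> E" "v \<noteq> 0" "\<forall>j<n. J j v = (q ^ j * x j) *\<^sub>R v" by blast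
  then show ?thesis using E(3) unfolding joint_eigenvector_def by blast
qed

text \<open>The eigenspace of the least eigenvalue is invariant under all \<open>J j\<close>, hence
  contains a joint eigenvector, and the weights bound its entries. An even number of negative
  entries makes the eigenvalue nonnegative, so the hypothesis speaks of odd
  \<open>k\<close>.\<close>

theorem least_eigenvalue:
  assumes c: "c \<ge> 0"
    and bd: "\<And>k. k \<le> n \<Longrightarrow> odd k \<Longrightarrow>
      q ^ ((n choose 2) + ((n - k) choose 2) + (k choose 2)) * Q ^ (n - k) \<le> c"
    and w: "w \<in> S"
  shows "- c * (w \<bullet> w) \<le> w \<bullet> A n w"
proof (cases "S = {0}")
  case True then show ?thesis using w linear_0[OF lin_A[of n]] by simp
next
  case False
  obtain v l where v: "v \<in> S" "v \<noteq> 0" "A n v = l *\<^sub>R v"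
      and l: "\<forall>w\<in>S. l * (w \<bullet> w) \<le> w \<bullet> A n w"
    using rayleigh_minimum[OF lin_A[OF le_refl] S False S_A[OF le_refl] sym_A[OF le_refl]] by auto
  let ?E = "{v \<in> S. A n v = l *\<^sub>R v}"
  have "subspace ?E"
    using S linear_0[OF lin_A] linear_add[OF lin_A] linear_scale[OF lin_A]
    by (auto simp: subspace_def algebra_simps)
  moreover have "?E \<noteq> {0}" using v by blast
  moreover have "J j u \<in> ?E" if "j < n" "u \<in> ?E" for j u
    using that J_A[of n j u] linear_scale[OF lin_J[of j]] by (auto simp: S_J)
  ultimately obtain u x where u: "u \<in> ?E" "joint_eigenvector u x"
    using joint_eigenvector_in[of ?E] by blast
  then have xs: "x \<in> spectrum" by (auto simp: spectrum_def)
  have lx: "l = q ^ (n choose 2) * (\<Prod>i<n. x i)"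
    using A_joint_eigenvector[OF u(2), of n] u by (auto simp: joint_eigenvector_def)
  let ?k = "card {i. i < n \<and> \<not> x i > 0}" and ?p = "card {i. i < n \<and> x i > 0}"
  have "card ({i. i < n \<and> \<not> x i > 0} \<union> {i. i < n \<and> x i > 0}) = ?k + ?p"
    by (intro card_Un_disjoint) auto
  moreover have "{i. i < n \<and> \<not> x i > 0} \<union> {i. i < n \<and> x i > 0} = {..<n}" by auto
  ultimately have kp: "?k + ?p = n" by simp
  have "- c \<le> l"
  proof (cases "odd ?k")
    case False
    then have "l \<ge> 0" unfolding lx sgn_prod_spectrum[OF xs le_refl] using q
      by (simp add: prod_nonneg)
    then show ?thesis using c by simp
  next
    case True
    then have "- l = q ^ (n choose 2) * (\<Prod>i<n. \<bar>x i\<bar>)"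
      unfolding lx sgn_prod_spectrum[OF xs le_refl] by simp
    also have "\<dots> \<le> q ^ (n choose 2) * (\<Prod>i<n. weight x i)"
      using q by (intro mult_left_mono prod_mono) (auto intro: spectrum_weight[OF xs])
    also have "\<dots> = q ^ ((n choose 2) + (?p choose 2) + (?k choose 2)) * Q ^ ?p"
      unfolding prod_weight by (simp add: Let_def power_add)
    also have "\<dots> \<le> c"
    proof -
      have "n - ?k = ?p" "?k \<le> n" using kp by simp_all
      then show ?thesis using bd[of ?k] True by simp
    qed
    finally show ?thesis by simp
  qed
  then have "- c * (w \<bullet> w) \<le> l * (w \<bullet> w)" by (intro mult_right_mono) auto
  also have "\<dots> \<le> w \<bullet> A n w" using l w by blast
  finally show ?thesis .
qed

end

section \<open>Polar geometries over finite fields\<close>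

lemma two_le_card_field: "2 \<le> CARD('a::{field,finite})"
proof -
  have "card {0, 1 :: 'a} \<le> CARD('a)" by (intro card_mono) auto
  then show ?thesis by simp
qed

lemma card_span_insert:
  fixes U :: "('a::{field,finite} ^ 'm::finite) set"
  assumes U: "vec.subspace U" and x: "x \<notin> U"
  shows "card (vec.span (insert x U)) = CARD('a) * card U"
proof -
  have sp: "vec.span U = U" using U by (simp add: vec.span_eq_iff)
  have "bij_betw (\<lambda>(k, u). u + k *s x) (UNIV \<times> U) (vec.span (insert x U))"
  proof (rule bij_betwI')
    fix p p' :: "'a \<times> ('a ^ 'm)" assume p: "p \<in> UNIV \<times> U" "p' \<in> UNIV \<times> U"
    obtain k u k' u' where [simp]: "p = (k, u)" "p' = (k', u')" by (metis surj_pair)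
    have "p = p'" if e: "u + k *s x = u' + k' *s x"
    proof (cases "k = k'")
      case True then show ?thesis using e by simp
    next
      case False
      have "(k - k') *s x = u' - u" using e by (simp add: vec.scale_left_diff_distrib algebra_simps)
      moreover have "u' - u \<in> U" using p U by (auto intro: vec.subspace_diff)
      ultimately have "inverse (k - k') *s ((k - k') *s x) \<in> U"
        using U by (metis vec.subspace_scale)
      moreover have "inverse (k - k') *s ((k - k') *s x) = x"
        using False by (simp only: vec.scale_scale) simp
      ultimately show ?thesis using x by simp
    qed
    then show "((case p of (k, u) \<Rightarrow> u + k *s x) = (case p' of (k, u) \<Rightarrow> u + k *s x)) = (p = p')" by auto
  next
    fix p assume "p \<in> (UNIV :: 'a set) \<times> U"
    then show "(case p of (k, u) \<Rightarrow> u + k *s x) \<in> vec.span (insert x U)"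
      by (auto intro: vec.span_add vec.span_scale vec.span_base)
  next
    fix y assume "y \<in> vec.span (insert x U)"
    then obtain k where "y - k *s x \<in> U" using sp by (auto simp: vec.span_insert)
    then show "\<exists>p\<in>UNIV \<times> U. y = (case p of (k, u) \<Rightarrow> u + k *s x)"
      by (intro bexI[of _ "(k, y - k *s x)"]) auto
  qed
  from bij_betw_same_card[OF this] show ?thesis by (simp add: card_cartesian_product)
qed

lemma card_subspace:
  fixes U :: "('a::{field,finite} ^ 'm::finite) set"
  assumes "vec.subspace U"
  shows "card U = CARD('a) ^ vec.dim U"
proof -
  have ind: "vec.independent b \<Longrightarrow> card (vec.span b) = CARD('a) ^ card b" if "finite b" for b :: "('a ^ 'm) set"
    using that
  proof (induction b rule: finite_induct)
    case empty then show ?case by simp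
  next
    case (insert x b)
    then have "x \<notin> vec.span b" "vec.independent b" by (auto simp: vec.independent_insert)
    moreover have "vec.span (insert x b) = vec.span (insert x (vec.span b))"
      by (simp add: vec.span_insert vec.span_span)
    ultimately show ?case using insert card_span_insert[of "vec.span b" x] by (simp add: vec.subspace_span)
  qed
  obtain b where b: "b \<subseteq> U" "vec.independent b" "U \<subseteq> vec.span b" "card b = vec.dim U"
    using vec.basis_exists by blast
  then have "vec.span b = U" using assms by (simp add: vec.span_subspace)
  then show ?thesis using ind[of b] b by simp
qed

text \<open>Several dimensions below are found by counting vectors; this reads off the
  dimension.\<close>

lemma dim_eqI_card:
  fixes U :: "('a::{field,finite} ^ 'm::finite) set"
  assumes "vec.subspace U" "card U = CARD('a) ^ k"
  shows "vec.dim U = k"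
  using assms card_subspace[OF assms(1)] two_le_card_field[where 'a = 'a] by (simp add: power_inject_exp)

lemma dim_insert_subspace:
  fixes U :: "('a::{field,finite} ^ 'm::finite) set"
  assumes U: "vec.subspace U" and x: "x \<notin> U"
  shows "vec.dim (insert x U) = Suc (vec.dim U)"
proof -
  have "vec.dim (vec.span (insert x U)) = Suc (vec.dim U)"
    using card_span_insert[OF assms] card_subspace[OF U] by (intro dim_eqI_card) auto
  then show ?thesis by simp
qed

lemma subspace_eqI_dim:
  fixes U :: "('a::{field,finite} ^ 'm::finite) set"
  assumes "vec.subspace U" "vec.subspace W" "U \<subseteq> W" "vec.dim W \<le> vec.dim U"
  shows "U = W"
  using assms by (intro vec.subspace_dim_equal) auto

lemma span_insert_eqI:
  fixes U :: "('a::{field,finite} ^ 'm::finite) set"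
  assumes "vec.subspace U" "vec.subspace W" "U \<subseteq> W" "x \<in> W" "x \<notin> U" "vec.dim W = Suc (vec.dim U)"
  shows "vec.span (insert x U) = W"
proof (rule subspace_eqI_dim)
  show "vec.span (insert x U) \<subseteq> W" using assms by (intro vec.span_minimal) auto
qed (use assms in \<open>auto simp: dim_insert_subspace\<close>)

text \<open>Fix \<open>x\<close> in \<open>U\<close> with \<open>\<phi> x = 1\<close>: every vector
  of \<open>U\<close> is a unique sum of a vector of the fibre and a multiple of \<open>x\<close>,
  whichever value \<open>c\<close> is prescribed.\<close>

lemma card_fibre_functional:
  fixes U :: "('a::{field,finite} ^ 'm::finite) set" and \<phi> :: "'a ^ 'm \<Rightarrow> 'a"
  assumes U: "vec.subspace U" and add: "\<And>x y. \<phi> (x + y) = \<phi> x + \<phi> y" and sc: "\<And>c x. \<phi> (c *s x) = c * \<phi> x"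
    and x0: "x0 \<in> U" "\<phi> x0 \<noteq> 0"
  shows "CARD('a) * card {x \<in> U. \<phi> x = c} = card U"
proof -
  define x where "x = inverse (\<phi> x0) *s x0"
  have x: "x \<in> U" "\<phi> x = 1" using x0 U by (auto simp: x_def sc vec.subspace_scale)
  have "bij_betw (\<lambda>(k, u). u + k *s x) (UNIV \<times> {x \<in> U. \<phi> x = c}) U"
  proof (rule bij_betwI')
    fix p p' :: "'a \<times> ('a ^ 'm)" assume p: "p \<in> UNIV \<times> {x \<in> U. \<phi> x = c}" "p' \<in> UNIV \<times> {x \<in> U. \<phi> x = c}"
    obtain k u k' u' where [simp]: "p = (k, u)" "p' = (k', u')" by (metis surj_pair)
    have "p = p'" if e: "u + k *s x = u' + k' *s x"
    proof -
      have "\<phi> (u + k *s x) = \<phi> (u' + k' *s x)" using e by simp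
      then have "k = k'" using p x by (simp add: add sc)
      then show ?thesis using e by simp
    qed
    then show "((case p of (k, u) \<Rightarrow> u + k *s x) = (case p' of (k, u) \<Rightarrow> u + k *s x)) = (p = p')" by auto
  next
    fix p assume "p \<in> (UNIV :: 'a set) \<times> {x \<in> U. \<phi> x = c}"
    then show "(case p of (k, u) \<Rightarrow> u + k *s x) \<in> U"
      using U x by (auto intro!: vec.subspace_add vec.subspace_scale)
  next
    fix y assume y: "y \<in> U"
    have "\<phi> (y + (c - \<phi> y) *s x) = c" unfolding add sc x(2) by simp
    moreover have "y + (c - \<phi> y) *s x \<in> U" using y x U by (blast intro: vec.subspace_add vec.subspace_scale)
    moreover have "y = (y + (c - \<phi> y) *s x) + (\<phi> y - c) *s x"
      by (simp add: algebra_simps vec.scale_left_diff_distrib)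
    ultimately show "\<exists>p\<in>UNIV \<times> {x \<in> U. \<phi> x = c}. y = (case p of (k, u) \<Rightarrow> u + k *s x)"
      by (intro bexI[of _ "(\<phi> y - c, y + (c - \<phi> y) *s x)"]) auto
  qed
  from bij_betw_same_card[OF this] show ?thesis by (simp add: card_cartesian_product)
qed

lemma card_eq_sum_fibres:
  assumes "finite X" "finite Y" "f ` X \<subseteq> Y"
  shows "card X = (\<Sum>y\<in>Y. card {x \<in> X. f x = y})"
  using sum.group[OF assms, of "\<lambda>_. 1 :: nat"] by simp

text \<open>These are the points of the projective line \<open>W / U\<close>. Counting the vectors
  of \<open>W - U\<close> by the subspace that they generate together with \<open>U\<close> gives
  their number.\<close>

lemma card_intermediate_subspaces:
  fixes U W :: "('a::{field,finite} ^ 'm::finite) set"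
  assumes U: "vec.subspace U" and W: "vec.subspace W" and UW: "U \<subseteq> W" and d: "vec.dim W = Suc (Suc (vec.dim U))"
  shows "card {Y. vec.subspace Y \<and> U \<subseteq> Y \<and> Y \<subseteq> W \<and> vec.dim Y = Suc (vec.dim U)} = CARD('a) + 1"
proof -
  let ?Y = "{Y. vec.subspace Y \<and> U \<subseteq> Y \<and> Y \<subseteq> W \<and> vec.dim Y = Suc (vec.dim U)}"
  have fib: "{w \<in> W - U. vec.span (insert w U) = Y} = Y - U" if "Y \<in> ?Y" for Y
    using that U span_insert_eqI[OF U, of Y] by (auto intro: vec.span_base)
  have "card (W - U) = (\<Sum>Y\<in>?Y. card {w \<in> W - U. vec.span (insert w U) = Y})"
  proof (rule card_eq_sum_fibres)
    have "vec.span (insert w U) \<subseteq> W" if "w \<in> W" for w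
      using that UW W by (intro vec.span_minimal) auto
    then show "(\<lambda>w. vec.span (insert w U)) ` (W - U) \<subseteq> ?Y"
      using U by (auto simp: dim_insert_subspace intro: vec.span_base)
  qed auto
  also have "\<dots> = (\<Sum>Y\<in>?Y. (CARD('a) - 1) * card U)"
    using fib U by (intro sum.cong) (auto simp: card_Diff_subset card_subspace algebra_simps)
  finally have "(CARD('a) * CARD('a) - 1) * card U = card ?Y * (CARD('a) - 1) * card U"
    using UW d by (simp add: card_Diff_subset card_subspace[OF U] card_subspace[OF W] algebra_simps)
  moreover have "card U \<noteq> 0" using card_subspace[OF U] by simp
  ultimately have "CARD('a) * CARD('a) - 1 = card ?Y * (CARD('a) - 1)" by simp
  moreover have "CARD('a) * CARD('a) - 1 = (CARD('a) + 1) * (CARD('a) - 1)" by (simp add: algebra_simps)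
  ultimately have "card ?Y * (CARD('a) - 1) = (CARD('a) + 1) * (CARD('a) - 1)" by (rule trans[OF sym])
  then show ?thesis using two_le_card_field[where 'a = 'a] by (subst (asm) mult_cancel2) auto
qed

text \<open>A common description of the three kinds of forms, with orthogonality given by \<open>B\<close> and singular
  vectors by \<open>N x = 0\<close>.  For a quadratic form \<open>N\<close> is the form, \<open>B\<close> its polar form, \<open>\<tau> a = a\<close> and
  \<open>\<rho> = 1\<close>; for an alternating form \<open>N = 0\<close>, \<open>\<tau> = 0\<close>, \<open>\<epsilon> = -1\<close> and \<open>\<rho> = q\<close>; for a hermitian form
  \<open>N x = B x x\<close>, \<open>\<sigma>\<close> is the involution, \<open>\<tau>\<close> the trace \<open>a + \<sigma> a\<close> and \<open>\<rho>\<close> the square root of \<open>q\<close>.\<close>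

locale polar_geometry =
  fixes B :: "'a::{field,finite} ^ 'm::finite \<Rightarrow> 'a ^ 'm \<Rightarrow> 'a" and \<sigma> :: "'a \<Rightarrow> 'a" and \<epsilon> :: 'a
    and N :: "'a ^ 'm \<Rightarrow> 'a" and \<tau> :: "'a \<Rightarrow> 'a" and \<rho> :: nat
  assumes B_add_left: "B (x + y) z = B x z + B y z"
    and B_scale_left: "B (c *s x) z = c * B x z"
    and B_swap: "B y x = \<epsilon> * \<sigma> (B x y)"
    and sigma_add: "\<sigma> (a + b) = \<sigma> a + \<sigma> b"
    and sigma_mult: "\<sigma> (a * b) = \<sigma> a * \<sigma> b"
    and sigma_sigma: "\<sigma> (\<sigma> a) = a"
    and eps: "\<epsilon> = 1 \<or> \<epsilon> = -1"
    and N_scale: "N (c *s x) = c * \<sigma> c * N x"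
    and N_add: "N (x + y) = N x + N y + \<tau> (B x y)"
    and B_self: "N x = 0 \<Longrightarrow> B x x = 0"
    and tau_add: "\<tau> (a + b) = \<tau> a + \<tau> b"
    and tau_scale: "\<sigma> c = c \<Longrightarrow> \<tau> (c * a) = c * \<tau> a"
    and tau_sigma: "\<tau> (\<epsilon> * \<sigma> a) = \<tau> a"
    and nondegenerate: "N x = 0 \<Longrightarrow> (\<And>y. B x y = 0) \<Longrightarrow> x = 0"
    and card_tau: "card {a. \<tau> a = N x} = \<rho>"
begin

lemma sigma_0 [simp]: "\<sigma> 0 = 0"
  using sigma_add[of 0 0] by (metis add.right_neutral add_left_cancel)

lemma sigma_1 [simp]: "\<sigma> 1 = 1"
proof -
  have "\<sigma> 1 \<noteq> 0" by (metis sigma_sigma sigma_0 zero_neq_one)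
  then show ?thesis using sigma_mult[of 1 1] by simp
qed

lemma sigma_uminus [simp]: "\<sigma> (- a) = - \<sigma> a"
  using sigma_add[of a "- a"] by (simp add: eq_neg_iff_add_eq_0 add.commute)

lemma sigma_diff: "\<sigma> (a - b) = \<sigma> a - \<sigma> b"
  using sigma_add[of a "- b"] by simp

lemma sigma_eps [simp]: "\<sigma> \<epsilon> = \<epsilon>"
  using eps by auto

lemma eps_eps [simp]: "\<epsilon> * \<epsilon> = 1" "\<epsilon> * (\<epsilon> * a) = a"
  using eps by auto

lemma eps_nz [simp]: "\<epsilon> \<noteq> 0"
  using eps by auto

lemma sigma_eq_0 [simp]: "\<sigma> a = 0 \<longleftrightarrow> a = 0"
  by (metis sigma_0 sigma_sigma)

lemma sigma_inverse: "\<sigma> (inverse a) = inverse (\<sigma> a)"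
proof (cases "a = 0")
  case False
  then have "\<sigma> a * \<sigma> (inverse a) = 1" by (simp flip: sigma_mult)
  then show ?thesis by (simp add: inverse_unique)
qed simp

lemma sigma_divide: "\<sigma> (a / b) = \<sigma> a / \<sigma> b"
  by (simp add: divide_inverse sigma_mult sigma_inverse)

lemma B_sym_0: "B x y = 0 \<longleftrightarrow> B y x = 0"
  using B_swap[of x y] B_swap[of y x] by auto

lemma B_add_right: "B x (y + z) = B x y + B x z"
  using B_swap[of _ x] by (simp add: B_swap[of x] B_add_left sigma_add distrib_left)

lemma B_scale_right: "B x (c *s y) = \<sigma> c * B x y"
  by (simp add: B_swap[of x] B_scale_left sigma_mult mult.left_commute)

lemma B_0_left [simp]: "B 0 x = 0"
  using B_scale_left[of 0 0 x] by simp

lemma B_0_right [simp]: "B x 0 = 0"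
  using B_sym_0 B_0_left by blast

lemma B_minus_left: "B (- x) y = - B x y"
  using B_add_left[of x "- x" y] by (simp add: eq_neg_iff_add_eq_0 add.commute)

lemma B_minus_right: "B x (- y) = - B x y"
  using B_add_right[of x y "- y"] by (simp add: eq_neg_iff_add_eq_0 add.commute)

lemma B_diff_left: "B (x - y) z = B x z - B y z"
  using B_add_left[of x "- y" z] by (simp add: B_minus_left)

lemma B_diff_right: "B z (x - y) = B z x - B z y"
  using B_add_right[of z x "- y"] by (simp add: B_minus_right)

lemmas B_simps = B_add_left B_scale_left B_add_right B_scale_right B_diff_left B_diff_right
  B_minus_left B_minus_right

lemma tau_0 [simp]: "\<tau> 0 = 0"
  using tau_add[of 0 0] by (metis add.right_neutral add_left_cancel)

lemma tau_uminus: "\<tau> (- a) = - \<tau> a"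
  using tau_add[of a "- a"] by (simp add: eq_neg_iff_add_eq_0 add.commute)

lemma N_0 [simp]: "N 0 = 0"
  using N_scale[of 0 0] by simp

definition perp :: "('a ^ 'm) set \<Rightarrow> ('a ^ 'm) set" where
  "perp U = {y. \<forall>x\<in>U. B y x = 0}"

lemma perpI: "(\<And>x. x \<in> U \<Longrightarrow> B y x = 0) \<Longrightarrow> y \<in> perp U"
  by (simp add: perp_def)

lemma perpD: "y \<in> perp U \<Longrightarrow> x \<in> U \<Longrightarrow> B y x = 0" "y \<in> perp U \<Longrightarrow> x \<in> U \<Longrightarrow> B x y = 0"
  using B_sym_0 by (auto simp: perp_def)

lemma subspace_perp: "vec.subspace (perp U)"
  by (auto simp: vec.subspace_def perp_def B_simps)

lemma perp_mono: "U \<subseteq> W \<Longrightarrow> perp W \<subseteq> perp U"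
  by (auto simp: perp_def)

lemma subset_perp_sym: "U \<subseteq> perp W \<longleftrightarrow> W \<subseteq> perp U"
  using B_sym_0 by (auto simp: perp_def)

lemma perp_span: "perp (vec.span U) = perp U"
proof
  show "perp (vec.span U) \<subseteq> perp U" by (intro perp_mono vec.span_superset)
  have "vec.span U \<subseteq> perp (perp U)"
    by (intro vec.span_minimal subspace_perp) (use B_sym_0 in \<open>auto simp: perp_def\<close>)
  then show "perp U \<subseteq> perp (vec.span U)" by (simp add: subset_perp_sym)
qed

text \<open>Both sides determine the number of orthogonal pairs in \<open>U \<times> W\<close>.\<close>

lemma card_pairing:
  assumes U: "vec.subspace U" and W: "vec.subspace W"
  shows "card U * card (perp U \<inter> W) = card W * card (perp W \<inter> U)"
proof -
  \<comment> \<open>Each \<open>x\<close> in \<open>perp Y\<close> is orthogonal to all of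
    \<open>Y\<close>, any other \<open>x\<close> to a \<open>q\<close>-th part of it; the factor
    \<open>CARD('a)\<close> keeps the count in the natural numbers.\<close>
  have count: "CARD('a) * card {(x, y) \<in> X \<times> Y. B x y = 0}
      = card (perp Y \<inter> X) * (CARD('a) - 1) * card Y + card X * card Y"
    if X: "vec.subspace X" and Y: "vec.subspace Y" for X Y :: "('a ^ 'm) set"
  proof -
    have "{(x, y) \<in> X \<times> Y. B x y = 0} = Sigma X (\<lambda>x. {y \<in> Y. B y x = 0})"
      using B_sym_0 by auto
    then have "CARD('a) * card {(x, y) \<in> X \<times> Y. B x y = 0} = (\<Sum>x\<in>X. CARD('a) * card {y \<in> Y. B y x = 0})"
      by (simp add: sum_distrib_left)
    also have "\<dots> = (\<Sum>x\<in>X. (if x \<in> perp Y then (CARD('a) - 1) * card Y else 0) + card Y)"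
    proof (intro sum.cong refl)
      fix x
      show "CARD('a) * card {y \<in> Y. B y x = 0} = (if x \<in> perp Y then (CARD('a) - 1) * card Y else 0) + card Y"
      proof (cases "x \<in> perp Y")
        case True
        then have "{y \<in> Y. B y x = 0} = Y" using B_sym_0 by (auto simp: perp_def)
        then show ?thesis using True by (simp add: algebra_simps)
      next
        case False
        then obtain y where "y \<in> Y" "B y x \<noteq> 0" using B_sym_0 by (auto simp: perp_def)
        then show ?thesis using False card_fibre_functional[OF Y, of "\<lambda>y. B y x" y 0] by (simp add: B_simps)
      qed
    qed
    also have "\<dots> = card (perp Y \<inter> X) * (CARD('a) - 1) * card Y + card X * card Y"
      by (simp add: sum.distrib sum.If_cases Int_commute)
    finally show ?thesis .
  qed
  have "bij_betw prod.swap {(x, y) \<in> U \<times> W. B x y = 0} {(x, y) \<in> W \<times> U. B x y = 0}"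
    by (rule bij_betwI[where g = prod.swap]) (auto simp: B_sym_0)
  then have "card {(x, y) \<in> U \<times> W. B x y = 0} = card {(x, y) \<in> W \<times> U. B x y = 0}"
    by (rule bij_betw_same_card)
  then have "card (perp W \<inter> U) * (CARD('a) - 1) * card W = card (perp U \<inter> W) * (CARD('a) - 1) * card U"
    using count[OF U W] count[OF W U] by simp
  then show ?thesis using two_le_card_field[where 'a = 'a] by (simp add: mult_ac)
qed

text \<open>One definition for all forms: for alternating forms the content lies in
  \<open>U \<subseteq> perp U\<close>, whereas for quadratic forms in characteristic 2 a vector with
  \<open>B x x = 0\<close> may fail to be singular, so \<open>N\<close> is tested as well.\<close>

definition singular_subspace :: "('a ^ 'm) set \<Rightarrow> bool" where
  "singular_subspace U \<longleftrightarrow> vec.subspace U \<and> (\<forall>x\<in>U. N x = 0) \<and> U \<subseteq> perp U"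

lemma singular_subspaceD:
  assumes "singular_subspace U"
  shows "vec.subspace U" "x \<in> U \<Longrightarrow> N x = 0" "x \<in> U \<Longrightarrow> y \<in> U \<Longrightarrow> B x y = 0" "U \<subseteq> perp U"
  using assms by (auto simp: singular_subspace_def perp_def)

lemma singular_subspace_subset:
  "singular_subspace W \<Longrightarrow> vec.subspace U \<Longrightarrow> U \<subseteq> W \<Longrightarrow> singular_subspace U"
  by (auto simp: singular_subspace_def perp_def)

lemma singular_subspace_0: "singular_subspace {0}"
  by (auto simp: singular_subspace_def perp_def)

text \<open>\<open>B\<close> may have a radical (parabolic quadrics in characteristic 2), but the
  radical contains no nonzero singular vector. So it meets \<open>U\<close> trivially, and pairing
  \<open>U\<close> with the whole space gives the expected size.\<close>

lemma card_perp:
  assumes U: "singular_subspace U"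
  shows "card U * card (perp U) = CARD('a) ^ CARD('m)"
proof -
  have "perp UNIV \<inter> U = {0}"
  proof -
    have "x = 0" if "x \<in> perp UNIV \<inter> U" for x
      using that singular_subspaceD(2)[OF U] by (intro nondegenerate) (auto simp: perp_def)
    moreover have "0 \<in> perp UNIV \<inter> U"
      using singular_subspaceD(1)[OF U] subspace_perp by (auto simp: vec.subspace_0)
    ultimately show ?thesis by auto
  qed
  then show ?thesis
    using card_pairing[OF singular_subspaceD(1)[OF U] vec.subspace_UNIV] by simp
qed

lemma singular_subspace_insert:
  assumes U: "singular_subspace U" and x: "x \<in> perp U" "N x = 0"
  shows "singular_subspace (vec.span (insert x U))"
proof -
  have sp: "vec.span U = U" using singular_subspaceD(1)[OF U] by (simp add: vec.span_eq_iff)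
  have "insert x U \<subseteq> perp (insert x U)"
    using x U B_self[of x] perpD[OF x(1)] by (auto simp: perp_def singular_subspace_def)
  then have "vec.span (insert x U) \<subseteq> perp (vec.span (insert x U))"
    by (metis perp_span subspace_perp vec.span_minimal)
  moreover have "N y = 0" if y: "y \<in> vec.span (insert x U)" for y
  proof -
    obtain k where k: "y - k *s x \<in> U" using y sp by (auto simp: vec.span_insert)
    have "N ((y - k *s x) + k *s x) = 0"
      unfolding N_add using k U perpD(2)[OF x(1) k] x(2) by (simp add: singular_subspace_def N_scale B_simps)
    then show ?thesis by simp
  qed
  ultimately show ?thesis by (simp add: singular_subspace_def vec.subspace_span)
qed

text \<open>The points of the polar space \<open>perp U / U\<close>, represented by subspaces of the
  ambient space.\<close>

definition covers :: "('a ^ 'm) set \<Rightarrow> ('a ^ 'm) set set" where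
  "covers U = {W. singular_subspace W \<and> U \<subseteq> W \<and> vec.dim W = Suc (vec.dim U)}"

lemma cover_eq_span:
  assumes "vec.subspace U" "W \<in> covers U" "x \<in> W" "x \<notin> U"
  shows "W = vec.span (insert x U)"
  using assms by (intro span_insert_eqI[symmetric]) (auto simp: covers_def singular_subspace_def)

lemma cover_obtain:
  assumes "vec.subspace U" "W \<in> covers U"
  obtains x where "x \<in> W" "x \<notin> U" "W = vec.span (insert x U)"
proof -
  have "\<not> W \<subseteq> U"
  proof
    assume "W \<subseteq> U"
    then have "vec.dim W \<le> vec.dim U" by (rule vec.dim_subset)
    then show False using assms by (simp add: covers_def)
  qed
  then show thesis using that cover_eq_span[OF assms] by blast
qed

lemma span_insert_in_covers:
  assumes "singular_subspace U" "x \<in> perp U" "N x = 0" "x \<notin> U"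
  shows "vec.span (insert x U) \<in> covers U"
  using assms singular_subspace_insert[of U x] dim_insert_subspace[of U x]
  by (auto simp: covers_def singular_subspace_def intro: vec.span_base)

lemma perp_cover_neq:
  assumes U: "singular_subspace U" and X: "X \<in> covers U"
  shows "\<exists>y\<in>perp U. y \<notin> perp X"
proof (rule ccontr)
  assume "\<not> ?thesis"
  then have "perp U \<subseteq> perp X" by auto
  then have "perp U = perp X" using X perp_mono[of U X] by (auto simp: covers_def)
  moreover have "card X = CARD('a) * card U" using X U by (simp add: covers_def singular_subspace_def card_subspace)
  moreover have "card X * card (perp X) = card U * card (perp U)"
    using U X by (simp add: card_perp covers_def)
  moreover have "card U \<noteq> 0" "card (perp U) \<noteq> 0"
    using card_subspace[OF singular_subspaceD(1)[OF U]] card_subspace[OF subspace_perp] by auto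
  ultimately show False using two_le_card_field[where 'a = 'a] by simp
qed

text \<open>The covers in question are generated over \<open>U\<close> by singular vectors
  \<open>y\<close> of \<open>perp U\<close> with \<open>B y x = 1\<close>, where \<open>x\<close>
  spans \<open>X\<close> over \<open>U\<close>. The number of all such \<open>y\<close> and the
  number belonging to one cover can both be computed.\<close>

lemma card_noncollinear_covers:
  assumes U: "singular_subspace U" and X: "X \<in> covers U"
  shows "CARD('a) ^ (2 * vec.dim U + 2) * card {Y \<in> covers U. \<not> Y \<subseteq> perp X} = \<rho> * CARD('a) ^ CARD('m)"
proof -
  have sU: "vec.subspace U" using U by (simp add: singular_subspace_def)
  obtain x where x: "x \<in> X" "x \<notin> U" "X = vec.span (insert x U)" using cover_obtain[OF sU X] .
  have Nx: "N x = 0" using x X by (auto simp: covers_def singular_subspace_def)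
  have xU: "x \<in> perp U" using x X by (auto simp: covers_def singular_subspace_def perp_def)
  have perpX: "perp X = {y \<in> perp U. B y x = 0}" unfolding x(3) perp_span by (auto simp: perp_def)
  define Z where "Z = {y \<in> perp U. B y x = 1}"
  define S where "S = {y \<in> Z. N y = 0}"
  obtain y0 where y0: "y0 \<in> perp U" "B y0 x \<noteq> 0" using perp_cover_neq[OF U X] perpX by auto
  have cZ: "CARD('a) * card Z = card (perp U)"
    unfolding Z_def using card_fibre_functional[OF subspace_perp, of "\<lambda>y. B y x" y0 U 1] y0 by (simp add: B_simps)
  \<comment> \<open>On the line of all \<open>y + c *s x\<close> being singular means
    \<open>\<tau> a = N y\<close> with \<open>a = - \<sigma> c\<close>, which has
    \<open>\<rho>\<close> solutions. Counting pairs of a vector and a shift from both ends compares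
    \<open>S\<close> with \<open>Z\<close>.\<close>
  have cS: "CARD('a) * card S = \<rho> * card Z"
  proof -
    have cx: "c *s x \<in> perp U" "B (c *s x) x = 0" for c
      using xU B_self[OF Nx] by (auto simp: B_simps intro: vec.subspace_scale[OF subspace_perp])
    have Z: "y + c *s x \<in> Z" "y - c *s x \<in> Z" if "y \<in> Z" for y c
      using that cx[of c] by (auto simp: Z_def B_add_left B_diff_left
        intro: vec.subspace_add[OF subspace_perp] vec.subspace_diff[OF subspace_perp])
    have "bij_betw (\<lambda>(y, c). (y + c *s x, c)) (Sigma Z (\<lambda>y. {c. N (y + c *s x) = 0})) (S \<times> UNIV)"
      by (rule bij_betwI[where g = "\<lambda>(y, c). (y - c *s x, c)"])
        (auto simp: S_def Z)
    then have "card (S \<times> (UNIV :: 'a set)) = card (Sigma Z (\<lambda>y. {c. N (y + c *s x) = 0}))"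
      by (rule bij_betw_same_card[symmetric])
    also have "\<dots> = (\<Sum>y\<in>Z. card {c. N (y + c *s x) = 0})" by simp
    also have "\<dots> = (\<Sum>y\<in>Z. \<rho>)"
    proof (intro sum.cong refl)
      fix y assume y: "y \<in> Z"
      have "bij_betw (\<lambda>c. - \<sigma> c * B y x) {c. N (y + c *s x) = 0} {a. \<tau> a = N y}"
      proof (rule bij_betwI[where g = "\<lambda>a. - \<sigma> a"])
        show "(\<lambda>c. - \<sigma> c * B y x) \<in> {c. N (y + c *s x) = 0} \<rightarrow> {a. \<tau> a = N y}"
          using y Nx by (auto simp: N_add N_scale Z_def B_simps tau_uminus eq_neg_iff_add_eq_0 neg_eq_iff_add_eq_0 add.commute)
        show "(\<lambda>a. - \<sigma> a) \<in> {a. \<tau> a = N y} \<rightarrow> {c. N (y + c *s x) = 0}"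
          using y Nx by (auto simp: N_add N_scale Z_def B_simps tau_uminus sigma_sigma)
      qed (use y in \<open>auto simp: Z_def sigma_sigma\<close>)
      then show "card {c. N (y + c *s x) = 0} = \<rho>" by (simp add: card_tau bij_betw_same_card)
    qed
    finally show ?thesis by (simp add: card_cartesian_product mult.commute)
  qed
  \<comment> \<open>The normalisation \<open>B y x = 1\<close> cuts out of each such cover a fibre
    of a nonzero functional, which has \<open>card U\<close> elements.\<close>
  have cY: "card S = card {Y \<in> covers U. \<not> Y \<subseteq> perp X} * card U"
  proof -
    let ?Y = "{Y \<in> covers U. \<not> Y \<subseteq> perp X}"
    have SU: "y \<notin> U" if "y \<in> S" for y
      using that perpD(2)[OF xU, of y] by (auto simp: S_def Z_def)
    have fib: "card {y \<in> S. vec.span (insert y U) = Y} = card U" if Y: "Y \<in> ?Y" for Y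
    proof -
      have sY: "singular_subspace Y" "U \<subseteq> Y" "Y \<in> covers U" using Y by (auto simp: covers_def)
      have YU: "Y \<subseteq> perp U" using sY by (meson perp_mono singular_subspaceD(4) subset_trans)
      have "{y \<in> S. vec.span (insert y U) = Y} = {y \<in> Y. B y x = 1}"
      proof (intro equalityI subsetI)
        fix y assume "y \<in> {y \<in> S. vec.span (insert y U) = Y}"
        then show "y \<in> {y \<in> Y. B y x = 1}" by (auto simp: S_def Z_def intro: vec.span_base)
      next
        fix y assume y: "y \<in> {y \<in> Y. B y x = 1}"
        then have "y \<notin> U" using perpD(2)[OF xU, of y] by auto
        then have "vec.span (insert y U) = Y" using cover_eq_span[OF sU sY(3)] y by auto
        then show "y \<in> {y \<in> S. vec.span (insert y U) = Y}"
          using y YU singular_subspaceD(2)[OF sY(1)] by (auto simp: S_def Z_def)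
      qed
      moreover obtain y where "y \<in> Y" "B y x \<noteq> 0" using Y YU perpX by auto
      then have "CARD('a) * card {y \<in> Y. B y x = 1} = card Y"
        using card_fibre_functional[of Y "\<lambda>y. B y x" y 1] singular_subspaceD(1)[OF sY(1)] by (simp add: B_simps)
      moreover have "card Y = CARD('a) * card U"
        using sY sU by (simp add: covers_def card_subspace singular_subspace_def)
      ultimately show ?thesis by simp
    qed
    have "card S = (\<Sum>Y\<in>?Y. card {y \<in> S. vec.span (insert y U) = Y})"
    proof (intro card_eq_sum_fibres)
      show "(\<lambda>y. vec.span (insert y U)) ` S \<subseteq> ?Y"
      proof (rule image_subsetI)
        fix y assume y: "y \<in> S"
        have "vec.span (insert y U) \<in> covers U"
          using y SU by (intro span_insert_in_covers U) (auto simp: S_def Z_def)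
        moreover have "y \<in> vec.span (insert y U)" by (auto intro: vec.span_base)
        moreover have "y \<notin> perp X" using y perpX by (auto simp: S_def Z_def)
        ultimately show "vec.span (insert y U) \<in> ?Y" by blast
      qed
    qed auto
    then show ?thesis using fib by simp
  qed
  let ?q = "CARD('a)" and ?c = "card {Y \<in> covers U. \<not> Y \<subseteq> perp X}"
  have "?q ^ (2 * vec.dim U + 2) * ?c = card U * (?q * (?q * (?c * card U)))"
    using card_subspace[OF sU] by (simp add: power_add power2_eq_square mult_2)
  also have "\<dots> = \<rho> * (card U * card (perp U))"
    unfolding cY[symmetric] cS cZ[symmetric] by (simp add: mult_ac)
  finally show ?thesis by (simp add: card_perp[OF U])
qed

end

text \<open>\<open>d\<close> is the excess of the dimension over that of a hyperbolic space. It
  combines with \<open>\<rho>\<close> to the parameter: in the classical polar spaces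
  \<open>\<rho> * CARD('a) ^ d\<close> is \<open>q powr e\<close>.\<close>

locale ranked_polar_geometry = polar_geometry B \<sigma> \<epsilon> N \<tau> \<rho>
  for B :: "'a::{field,finite} ^ 'm::finite \<Rightarrow> 'a ^ 'm \<Rightarrow> 'a" and \<sigma> \<epsilon> N \<tau> \<rho> +
  fixes n d :: nat
  assumes generator_exists: "\<exists>M. singular_subspace M \<and> vec.dim M = n"
    and rank_le: "singular_subspace U \<Longrightarrow> vec.dim U \<le> n"
    and dim_space: "CARD('m) = 2 * n + d"
begin

text \<open>A generator \<open>M\<close> is larger than \<open>U\<close>, so the pairing of
  \<open>U\<close> and \<open>M\<close> shows that \<open>perp U \<inter> M\<close> is larger than
  \<open>perp M \<inter> U\<close>. Hence some vector of \<open>M\<close> outside \<open>U\<close>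
  is orthogonal to \<open>U\<close> and extends it.\<close>

lemma covers_nonempty:
  assumes U: "singular_subspace U" and d: "vec.dim U < n"
  shows "covers U \<noteq> {}"
proof -
  obtain M where M: "singular_subspace M" "vec.dim M = n" using generator_exists by auto
  have sU: "vec.subspace U" and sM: "vec.subspace M" using U M by (auto simp: singular_subspace_def)
  have "card M > card U"
    using d M two_le_card_field[where 'a = 'a] by (simp add: card_subspace sU sM)
  have "\<not> perp U \<inter> M \<subseteq> U"
  proof
    assume "perp U \<inter> M \<subseteq> U"
    then have "perp U \<inter> M \<subseteq> perp M \<inter> U" using singular_subspaceD(4)[OF M(1)] by auto
    then have "card (perp U \<inter> M) \<le> card (perp M \<inter> U)" by (intro card_mono) auto
    then have "card U * card (perp U \<inter> M) \<le> card U * card (perp M \<inter> U)" by simp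
    also have "\<dots> < card M * card (perp M \<inter> U)"
    proof -
      have "0 \<in> perp M \<inter> U" using subspace_perp sU by (auto simp: vec.subspace_0)
      then have "card (perp M \<inter> U) > 0" by (auto simp: card_gt_0_iff)
      then show ?thesis using \<open>card M > card U\<close> by simp
    qed
    finally show False using card_pairing[OF sU sM] by simp
  qed
  then obtain x where "x \<in> perp U" "x \<in> M" "x \<notin> U" by auto
  then show ?thesis using span_insert_in_covers[OF U] singular_subspaceD(2)[OF M(1)] by blast
qed

lemma card_noncollinear_covers':
  assumes U: "singular_subspace U" and X: "X \<in> covers U"
  shows "card {Y \<in> covers U. \<not> Y \<subseteq> perp X} = \<rho> * CARD('a) ^ d * CARD('a) ^ (2 * (n - Suc (vec.dim U)))"
proof -
  have "Suc (vec.dim U) \<le> n" using X rank_le[of X] by (simp add: covers_def)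
  then have "CARD('m) = d + 2 * (n - Suc (vec.dim U)) + (2 * vec.dim U + 2)" using dim_space by simp
  then have "CARD('a) ^ (2 * vec.dim U + 2) * card {Y \<in> covers U. \<not> Y \<subseteq> perp X}
      = CARD('a) ^ (2 * vec.dim U + 2) * (\<rho> * CARD('a) ^ d * CARD('a) ^ (2 * (n - Suc (vec.dim U))))"
    unfolding card_noncollinear_covers[OF assms] by (simp add: power_add mult_ac)
  then show ?thesis by simp
qed

text \<open>The number of points of a polar space of rank \<open>k\<close>, counted from one point:
  the point itself, the \<open>q\<close> others on each line through it, and the points not
  collinear with it.\<close>

primrec num_covers :: "nat \<Rightarrow> nat" where
  "num_covers 0 = 0"
| "num_covers (Suc k) = 1 + CARD('a) * num_covers k + \<rho> * CARD('a) ^ d * CARD('a) ^ (2 * k)"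

lemma card_covers: "singular_subspace U \<Longrightarrow> vec.dim U + k = n \<Longrightarrow> card (covers U) = num_covers k"
proof (induction k arbitrary: U)
  case 0
  then have "covers U = {}" using rank_le by (fastforce simp: covers_def)
  then show ?case by simp
next
  case (Suc k)
  note U = Suc.prems(1)
  have sU: "vec.subspace U" using U by (simp add: singular_subspace_def)
  obtain X where X: "X \<in> covers U" using covers_nonempty[OF U] Suc.prems by auto
  have X': "singular_subspace X" "vec.dim X = Suc (vec.dim U)" "U \<subseteq> X" using X by (auto simp: covers_def)
  have sX: "vec.subspace X" using X' by (simp add: singular_subspace_def)
  let ?C = "{Y \<in> covers U. Y \<noteq> X \<and> Y \<subseteq> perp X}" and ?D = "{Y \<in> covers U. \<not> Y \<subseteq> perp X}"
  have split: "covers U = insert X (?C \<union> ?D)"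
    using X singular_subspaceD(4)[OF X'(1)] by auto
  have "card (covers U) = Suc (card ?C + card ?D)"
  proof -
    have "card (covers U) = Suc (card (?C \<union> ?D))"
      by (subst split, subst card_insert_disjoint) (use singular_subspaceD(4)[OF X'(1)] in auto)
    also have "card (?C \<union> ?D) = card ?C + card ?D" by (intro card_Un_disjoint) auto
    finally show ?thesis .
  qed
  \<comment> \<open>A collinear \<open>Y\<close> is sent to the line
    \<open>vec.span (X \<union> Y)\<close>, a cover of \<open>X\<close>; the fibre over a line
    consists of its points other than \<open>X\<close>.\<close>
  moreover have "card ?C = CARD('a) * num_covers k"
  proof -
    have img: "vec.span (X \<union> Y) \<in> covers X" if Y: "Y \<in> ?C" for Y
    proof -
      obtain y where y: "y \<in> Y" "y \<notin> U" "Y = vec.span (insert y U)" using cover_obtain[OF sU] Y by auto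
      have "y \<notin> X"
      proof
        assume "y \<in> X"
        then have "X = vec.span (insert y U)" using cover_eq_span[OF sU X] y by simp
        then show False using y Y by simp
      qed
      moreover have "vec.span (X \<union> Y) = vec.span (insert y X)"
      proof
        have "Y \<subseteq> vec.span (insert y X)" unfolding y(3) using X' by (intro vec.span_mono) auto
        then show "vec.span (X \<union> Y) \<subseteq> vec.span (insert y X)"
          by (intro vec.span_minimal) (auto intro: vec.span_base simp: vec.subspace_span)
        show "vec.span (insert y X) \<subseteq> vec.span (X \<union> Y)" using y by (intro vec.span_mono) auto
      qed
      moreover have "y \<in> perp X" "N y = 0" using y Y by (auto simp: covers_def singular_subspace_def)
      ultimately show ?thesis using span_insert_in_covers[OF X'(1)] by simp
    qed
    have fib: "card {Y \<in> ?C. vec.span (X \<union> Y) = W} = CARD('a)" if W: "W \<in> covers X" for W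
    proof -
      have W': "singular_subspace W" "vec.subspace W" "X \<subseteq> W" "vec.dim W = Suc (vec.dim X)"
        using W by (auto simp: covers_def singular_subspace_def)
      let ?I = "{Y. vec.subspace Y \<and> U \<subseteq> Y \<and> Y \<subseteq> W \<and> vec.dim Y = Suc (vec.dim U)}"
      have "{Y \<in> ?C. vec.span (X \<union> Y) = W} = ?I - {X}"
      proof (intro equalityI subsetI)
        fix Y assume "Y \<in> {Y \<in> ?C. vec.span (X \<union> Y) = W}"
        then show "Y \<in> ?I - {X}" by (auto simp: covers_def singular_subspace_def intro: vec.span_base)
      next
        fix Y assume Y: "Y \<in> ?I - {X}"
        then have sY: "singular_subspace Y" using W' singular_subspace_subset by blast
        have "Y \<subseteq> perp X" using Y W' singular_subspaceD(4)[OF W'(1)] perp_mono[of X W] by auto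
        with Y sY have C: "Y \<in> ?C" by (auto simp: covers_def)
        moreover have "vec.span (X \<union> Y) = W"
        proof (rule subspace_eqI_dim)
          show "vec.span (X \<union> Y) \<subseteq> W" using Y W' by (intro vec.span_minimal) auto
          show "vec.dim W \<le> vec.dim (vec.span (X \<union> Y))" using img[OF C] W' by (simp add: covers_def)
        qed (auto simp: W' vec.subspace_span)
        ultimately show "Y \<in> {Y \<in> ?C. vec.span (X \<union> Y) = W}" by simp
      qed
      moreover have "card ?I = CARD('a) + 1"
        using W' X' by (intro card_intermediate_subspaces sU) auto
      moreover have "X \<in> ?I" using X' W' sX by auto
      ultimately show ?thesis by simp
    qed
    have "card ?C = (\<Sum>W\<in>covers X. card {Y \<in> ?C. vec.span (X \<union> Y) = W})"
      using img by (intro card_eq_sum_fibres) auto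
    also have "\<dots> = CARD('a) * card (covers X)" using fib by simp
    also have "card (covers X) = num_covers k" using Suc X' by simp
    finally show ?thesis .
  qed
  moreover have "card ?D = \<rho> * CARD('a) ^ d * CARD('a) ^ (2 * k)"
    using card_noncollinear_covers'[OF U X] Suc.prems by (simp flip: Suc.prems(2))
  ultimately show ?case by simp
qed

end

section \<open>Transitivity on hyperbolic frames\<close>

context polar_geometry begin

definition isometric :: "('a ^ 'm \<Rightarrow> 'a ^ 'm) \<Rightarrow> bool" where
  "isometric g \<longleftrightarrow> (\<forall>x y. g (x + y) = g x + g y) \<and> (\<forall>c x. g (c *s x) = c *s g x) \<and>
     (\<forall>x y. B (g x) (g y) = B x y) \<and> (\<forall>x. N (g x) = N x)"

lemma isometricD:
  assumes "isometric g"
  shows "g (x + y) = g x + g y" "g (c *s x) = c *s g x" "B (g x) (g y) = B x y" "N (g x) = N x"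
  using assms by (auto simp: isometric_def)

lemma isometric_id: "isometric (\<lambda>x. x)"
  by (simp add: isometric_def)

lemma isometric_comp: "isometric g \<Longrightarrow> isometric h \<Longrightarrow> isometric (\<lambda>x. g (h x))"
  by (simp add: isometric_def)

text \<open>A vector killed by \<open>g\<close> is singular and orthogonal to everything, hence
  zero; finiteness gives surjectivity.\<close>

lemma isometric_bij: assumes g: "isometric g" shows "bij g"
proof -
  have "inj g"
  proof (rule injI)
    fix x y assume e: "g x = g y"
    have "g (x - y) = 0" using isometricD(1)[OF g, of "x - y" y] e by simp
    then have "N (x - y) = 0" "\<And>z. B (x - y) z = 0"
      using isometricD(3)[OF g, of "x - y"] isometricD(4)[OF g, of "x - y"] by auto
    then show "x = y" using nondegenerate[of "x - y"] by simp
  qed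
  then show ?thesis by (simp add: bij_def finite_UNIV_inj_surj)
qed

lemma isometric_inv: assumes g: "isometric g" shows "isometric (inv g)"
proof -
  have gi: "g (inv g x) = x" "inv g (g x) = x" for x
    using isometric_bij[OF g] by (simp_all add: bij_def surj_f_inv_f)
  have "inv g (x + y) = inv g x + inv g y" for x y
    using gi(2)[of "inv g x + inv g y"] by (simp add: isometricD(1)[OF g] gi)
  moreover have "inv g (c *s x) = c *s inv g x" for c x
    using gi(2)[of "c *s inv g x"] by (simp add: isometricD(2)[OF g] gi)
  moreover have "B (inv g x) (inv g y) = B x y" for x y
    using isometricD(3)[OF g, of "inv g x" "inv g y"] by (simp add: gi)
  moreover have "N (inv g x) = N x" for x
    using isometricD(4)[OF g, of "inv g x"] by (simp add: gi)
  ultimately show ?thesis by (simp add: isometric_def)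
qed

text \<open>An Eichler--Siegel transformation centred at \<open>u\<close>.\<close>

lemma siegel_transformation:
  assumes N: "N u = 0" "N y = 0" "N y' = 0" and e: "B y u = B y' u" "B y u \<noteq> 0"
  shows "\<exists>g. isometric g \<and> g u = u \<and> g y = y' \<and>
    (\<forall>z. B z u = 0 \<longrightarrow> B z y = 0 \<longrightarrow> B z y' = 0 \<longrightarrow> g z = z)"
proof -
  define v where "v = y' - y"
  define a where "a z = B z u / B y u" for z
  \<comment> \<open>Solved from \<open>B (g z) (g y) = B z y\<close>, where \<open>g y\<close> is to
    be \<open>y'\<close>.\<close>
  define l where "l z = (a z * B y y' - B z v) / B u y" for z
  define g where "g z = z + a z *s v + l z *s u" for z
  have uy: "B u y \<noteq> 0" using e B_sym_0 by blast
  have uu: "B u u = 0" "B y y = 0" "B y' y' = 0" using N by (simp_all add: B_self)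
  have vu: "B v u = 0" "B u v = 0" using e B_sym_0[of v u] by (simp_all add: v_def B_diff_left)
  have vv: "B v v = - B y y' - B y' y" by (simp add: v_def B_simps uu)
  have aB: "a z * B y u = B z u" for z using e by (simp add: a_def)
  have lB: "l z * B u y = a z * B y y' - B z v" for z using uy by (simp add: l_def)
  have uz: "B u z = \<sigma> (a z) * B u y" for z
    unfolding B_swap[of u z] B_swap[of u y] aB[of z, symmetric] by (simp add: sigma_mult mult_ac)
  have zu: "B z u = a z * B y u" for z by (simp add: aB)
  have 1: "\<sigma> (l w) * B z u = a z * (\<sigma> (a w) * B y' y - B v w)" for z w
  proof -
    have "\<sigma> (l w) * B z u = a z * (\<sigma> (l w) * B y u)" by (simp add: zu[of z])
    also have "\<sigma> (l w) * B y u = \<epsilon> * \<sigma> (l w * B u y)" by (simp add: sigma_mult B_swap[of y u] mult.left_commute)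
    also have "\<dots> = \<sigma> (a w) * B y' y - B v w"
      unfolding lB B_swap[of y' y] B_swap[of v w] by (simp add: sigma_diff sigma_mult algebra_simps)
    finally show ?thesis .
  qed
  have 2: "l z * B u w = \<sigma> (a w) * (a z * B y y' - B z v)" for z w
    unfolding uz[of w] lB[symmetric] by (simp add: mult_ac)
  have B: "B (g z) (g w) = B z w" for z w
  proof -
    have "B (g z) (g w) = B z w + \<sigma> (a w) * B z v + \<sigma> (l w) * B z u + a z * B v w
        + a z * \<sigma> (a w) * B v v + l z * B u w"
      unfolding g_def by (simp add: B_simps vu uu algebra_simps)
    also have "\<dots> = B z w" unfolding 1 2 vv by (simp add: algebra_simps)
    finally show ?thesis .
  qed
  have Ng: "N (g z) = N z" for z
  proof -
    have f: "\<sigma> (a z * \<sigma> (a z)) = a z * \<sigma> (a z)" by (simp add: sigma_mult sigma_sigma mult.commute)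
    have "N v = N (y' + (-1) *s y)" by (simp add: v_def)
    also have "\<dots> = - \<tau> (B y' y)" unfolding N_add N_scale B_scale_right using N by (simp add: tau_uminus)
    finally have Nv: "N v = - \<tau> (B y' y)" .
    have "N (g z) = N z + a z * \<sigma> (a z) * N v + \<tau> (\<sigma> (a z) * B z v + \<sigma> (l z) * B z u)"
      unfolding g_def by (simp add: N_add N_scale N B_simps vu tau_add)
    also have "\<sigma> (a z) * B z v + \<sigma> (l z) * B z u
        = \<sigma> (a z) * B z v + (- (\<epsilon> * \<sigma> (\<sigma> (a z) * B z v)) + a z * \<sigma> (a z) * B y' y)"
      unfolding 1 B_swap[of v z] by (simp add: sigma_mult sigma_sigma algebra_simps)
    also have "\<tau> \<dots> = a z * \<sigma> (a z) * \<tau> (B y' y)"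
      unfolding tau_add tau_uminus tau_sigma tau_scale[OF f] by simp
    finally show ?thesis by (simp add: Nv)
  qed
  have a_lin: "a (z + w) = a z + a w" "a (c *s z) = c * a z" for z w c
    by (simp_all add: a_def B_simps add_divide_distrib)
  have l_lin: "l (z + w) = l z + l w" "l (c *s z) = c * l z" for z w c
    by (simp_all add: l_def a_lin B_simps algebra_simps add_divide_distrib diff_divide_distrib)
  have "isometric g"
    unfolding isometric_def using B Ng
    by (auto simp: g_def a_lin l_lin algebra_simps vec.scale_right_distrib)
  moreover have "g u = u" by (simp add: g_def a_def l_def uu vu)
  moreover have "g y = y'"
  proof -
    have "a y = 1" using e by (simp add: a_def)
    moreover have "l y = 0" by (simp add: l_def \<open>a y = 1\<close> v_def B_simps uu)
    ultimately show ?thesis by (simp add: g_def v_def)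
  qed
  moreover have "g z = z" if "B z u = 0" "B z y = 0" "B z y' = 0" for z
    using that by (simp add: g_def l_def a_def v_def B_simps)
  ultimately show ?thesis by blast
qed

text \<open>The two points are exchanged inside the plane that they span, and \<open>z0 z\<close>,
  the component of \<open>z\<close> orthogonal to this plane, is kept.\<close>

lemma swap_transformation:
  assumes N: "N x = 0" "N x' = 0" and nz: "B x x' \<noteq> 0"
  shows "\<exists>g. isometric g \<and> (\<exists>c. c \<noteq> 0 \<and> g x = c *s x') \<and> (\<forall>z. B z x = 0 \<longrightarrow> B z x' = 0 \<longrightarrow> g z = z)"
proof -
  define s where "s = B x x'"
  define t where "t = B x' x"
  \<comment> \<open>Forced by \<open>B (g x) (g x') = B x x'\<close>: with
    \<open>g x = a *s x'\<close> and \<open>g x' = x\<close> this reads \<open>a * t = s\<close>.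
    Since \<open>\<sigma>\<close> exchanges \<open>s\<close> and \<open>t\<close> up to the factor
    \<open>\<epsilon>\<close>, also \<open>\<sigma> a * s = t\<close>.\<close>
  define a where "a = s / t"
  define al where "al z = B z x' / s" for z
  define be where "be z = B z x / t" for z
  define z0 where "z0 z = z - al z *s x - be z *s x'" for z
  define g where "g z = z0 z + ((al z * a) *s x' + be z *s x)" for z
  have nz': "s \<noteq> 0" "t \<noteq> 0" using nz B_sym_0 by (auto simp: s_def t_def)
  have xx: "B x x = 0" "B x' x' = 0" using N by (simp_all add: B_self)
  have z0x: "B (z0 z) x = 0" "B (z0 z) x' = 0" for z
    using nz' by (simp_all add: z0_def B_simps xx al_def be_def flip: s_def t_def)
  then have xz0: "B x (z0 z) = 0" "B x' (z0 z) = 0" for z using B_sym_0 by blast+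
  have at: "a * t = s" using nz' by (simp add: a_def)
  have sa: "\<sigma> a * s = t"
  proof -
    have "t = \<epsilon> * \<sigma> s" "s = \<epsilon> * \<sigma> t" unfolding s_def t_def by (rule B_swap)+
    then have "\<sigma> s = \<epsilon> * t" "\<sigma> t = \<epsilon> * s" by (metis eps_eps(2))+
    then show ?thesis using nz' by (simp add: a_def sigma_divide)
  qed
  have z: "z = z0 z + (al z *s x + be z *s x')" for z by (simp add: z0_def)
  have B: "B (g z) (g w) = B z w" for z w
  proof -
    have "B (g z) (g w) = B (z0 z) (z0 w) + al z * \<sigma> (be w) * (a * t) + be z * \<sigma> (al w) * (\<sigma> a * s)"
      unfolding g_def by (simp add: B_simps z0x xz0 xx sigma_mult algebra_simps flip: s_def t_def)
    moreover have "B z w = B (z0 z) (z0 w) + al z * \<sigma> (be w) * s + be z * \<sigma> (al w) * t"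
      by (subst z, subst (2) z) (simp add: B_simps z0x xz0 xx algebra_simps flip: s_def t_def)
    ultimately show ?thesis by (simp add: at sa)
  qed
  have Ng: "N (g z) = N z" for z
  proof -
    have "N (g z) = N (z0 z) + \<tau> (al z * \<sigma> (be z) * (a * t))"
      unfolding g_def N_add[of "z0 z"] by (simp add: N_add N_scale N B_simps z0x mult_ac flip: t_def)
    moreover have "N z = N (z0 z) + \<tau> (al z * \<sigma> (be z) * s)"
      by (subst z, unfold N_add[of "z0 z"]) (simp add: N_add N_scale N B_simps z0x mult_ac flip: s_def)
    ultimately show ?thesis by (simp add: at)
  qed
  have lin: "al (z + w) = al z + al w" "al (c *s z) = c * al z" "be (z + w) = be z + be w" "be (c *s z) = c * be z" for z w c
    by (simp_all add: al_def be_def B_simps add_divide_distrib)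
  have "isometric g"
    unfolding isometric_def using B Ng
    by (auto simp: g_def z0_def lin algebra_simps vec.scale_right_distrib vec.scale_right_diff_distrib)
  moreover have "g x = a *s x'"
    using nz' by (simp add: g_def z0_def al_def be_def xx flip: s_def)
  moreover have "a \<noteq> 0" using nz' by (simp add: a_def)
  moreover have "g z = z" if "B z x = 0" "B z x' = 0" for z
    using that by (simp add: g_def z0_def al_def be_def)
  ultimately show ?thesis by blast
qed

text \<open>Non-orthogonal \<open>x\<close> and \<open>x'\<close> are exchanged directly. Otherwise
  a singular \<open>z\<close> orthogonal to neither of them serves as an intermediate stop; the
  partners \<open>y\<close> and \<open>y'\<close> provide it while keeping it orthogonal to
  \<open>H\<close>.\<close>

lemma move_point:
  assumes N: "N x = 0" "N x' = 0" "N y = 0" "N y' = 0" and nz: "B x y \<noteq> 0" "B x' y' \<noteq> 0"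
    and H: "\<And>h. h \<in> H \<Longrightarrow> B h x = 0 \<and> B h x' = 0 \<and> B h y = 0 \<and> B h y' = 0"
  shows "\<exists>g. isometric g \<and> (\<exists>c. c \<noteq> 0 \<and> g x = c *s x') \<and> (\<forall>h\<in>H. g h = h)"
proof -
  have direct: "\<exists>g. isometric g \<and> (\<exists>c. c \<noteq> 0 \<and> g x = c *s x') \<and> (\<forall>h\<in>H. g h = h)"
    if "N x = 0" "N x' = 0" "B x x' \<noteq> 0" "\<And>h. h \<in> H \<Longrightarrow> B h x = 0 \<and> B h x' = 0" for x x'
    using swap_transformation[OF that(1-3)] that(4) by blast
  show ?thesis
  proof (cases "B x x' = 0")
    case False
    then show ?thesis using direct N H by blast
  next
    case True
    have "\<exists>z. N z = 0 \<and> B x z \<noteq> 0 \<and> B z x' \<noteq> 0 \<and> (\<forall>h\<in>H. B h z = 0)"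
    proof (cases "B x y' = 0 \<and> B y x' = 0")
      case False
      then show ?thesis using N nz H B_sym_0 by blast
    next
      case xy: True
      have yx: "B y x \<noteq> 0" using nz B_sym_0 by blast
      \<comment> \<open>The sum \<open>y + y'\<close> is orthogonal to neither \<open>x\<close> nor
        \<open>x'\<close>, but it may fail to be singular. Adding this multiple of \<open>x\<close>
        to \<open>y'\<close> makes the second summand orthogonal to \<open>y\<close>, so that the
        sum becomes singular.\<close>
      define s where "s = \<sigma> (- B y y' / B y x)"
      define w where "w = y' + s *s x"
      have "N w = 0" using xy N B_sym_0[of x y'] by (simp add: w_def N_add N_scale B_simps)
      moreover have "B y w = 0" using yx by (simp add: w_def s_def B_simps sigma_sigma)
      ultimately have "N (y + w) = 0" using N by (simp add: N_add)
      moreover have "B x (y + w) \<noteq> 0" using xy nz N by (simp add: w_def B_simps B_self)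
      moreover have "B (y + w) x' \<noteq> 0" using xy nz True B_sym_0[of x' y'] by (simp add: w_def B_simps)
      moreover have "B h (y + w) = 0" if "h \<in> H" for h using H[OF that] by (simp add: w_def B_simps)
      ultimately show ?thesis by blast
    qed
    then obtain z where z: "N z = 0" "B x z \<noteq> 0" "B z x' \<noteq> 0" "\<And>h. h \<in> H \<Longrightarrow> B h z = 0" by blast
    have Hz: "\<And>h. h \<in> H \<Longrightarrow> B h x = 0 \<and> B h z = 0" "\<And>h. h \<in> H \<Longrightarrow> B h z = 0 \<and> B h x' = 0"
      using H z(4) by blast+
    obtain g c where g: "isometric g" "c \<noteq> 0" "g x = c *s z" "\<And>h. h \<in> H \<Longrightarrow> g h = h"
      using direct[OF N(1) z(1,2) Hz(1)] by blast
    obtain g' c' where g': "isometric g'" "c' \<noteq> 0" "g' z = c' *s x'" "\<And>h. h \<in> H \<Longrightarrow> g' h = h"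
      using direct[OF z(1) N(2) z(3) Hz(2)] by blast
    have "isometric (\<lambda>x. g' (g x))" using g g' by (simp add: isometric_comp)
    moreover have "g' (g x) = (c * c') *s x'" using g(3) g'(3) by (simp add: isometricD(2)[OF g'(1)] vec.scale_scale)
    moreover have "c * c' \<noteq> 0" using g(2) g'(2) by simp
    moreover have "g' (g h) = h" if "h \<in> H" for h using g(4)[OF that] g'(4)[OF that] by simp
    ultimately show ?thesis by (intro exI[of _ "\<lambda>x. g' (g x)"]) blast
  qed
qed

text \<open>Once \<open>x\<close> has reached \<open>x'\<close>, a Siegel transformation centred at
  \<open>x'\<close> moves the image of \<open>y\<close> without disturbing
  \<open>x'\<close>.\<close>

lemma move_hyperbolic_pair:
  assumes N: "N x = 0" "N x' = 0" "N y = 0" "N y' = 0" and nz: "B x y \<noteq> 0" "B x' y' \<noteq> 0"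
    and H: "\<And>h. h \<in> H \<Longrightarrow> B h x = 0 \<and> B h x' = 0 \<and> B h y = 0 \<and> B h y' = 0"
  shows "\<exists>g. isometric g \<and> (\<exists>c. c \<noteq> 0 \<and> g x = c *s x') \<and> (\<exists>c. c \<noteq> 0 \<and> g y = c *s y') \<and> (\<forall>h\<in>H. g h = h)"
proof -
  have "\<exists>g. isometric g \<and> (\<exists>c. c \<noteq> 0 \<and> g x = c *s x') \<and> (\<forall>h\<in>H. g h = h)"
    by (rule move_point[OF N nz H])
  then obtain g c where g: "isometric g" "c \<noteq> 0" "g x = c *s x'" "\<And>h. h \<in> H \<Longrightarrow> g h = h"
    by blast
  \<comment> \<open>Scales \<open>y'\<close> to have the same product with \<open>x'\<close> as
    \<open>g y\<close>, as \<open>siegel_transformation\<close> demands.\<close>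
  define k where "k = B (g y) x' / B y' x'"
  have nz': "B y' x' \<noteq> 0" using nz B_sym_0 by blast
  have "B (g y) (g x) \<noteq> 0" using nz B_sym_0 by (simp add: isometricD(3)[OF g(1)])
  then have gy: "B (g y) x' \<noteq> 0" using g by (simp add: B_simps)
  have Ny: "N (g y) = 0" "N (k *s y') = 0" using N by (simp_all add: isometricD(4)[OF g(1)] N_scale)
  have By: "B (g y) x' = B (k *s y') x'" using nz' by (simp add: k_def B_simps)
  obtain g' where g': "isometric g'" "g' x' = x'" "g' (g y) = k *s y'"
      "\<And>z. B z x' = 0 \<Longrightarrow> B z (g y) = 0 \<Longrightarrow> B z (k *s y') = 0 \<Longrightarrow> g' z = z"
    using siegel_transformation[OF N(2) Ny By gy] by blast
  have "g' (g h) = h" if h: "h \<in> H" for h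
  proof -
    have "B h (g y) = B h y" using isometricD(3)[OF g(1), of h y] g(4)[OF h] by simp
    then show ?thesis using g'(4)[of h] H[OF h] g(4)[OF h] by (simp add: B_simps)
  qed
  moreover have "g' (g x) = c *s x'" using g(3) g'(2) by (simp add: isometricD(2)[OF g'(1)])
  moreover have "k \<noteq> 0" using gy nz' by (simp add: k_def)
  ultimately show ?thesis using isometric_comp[OF g'(1) g(1)] g(2) g'(3)
    by (intro exI[of _ "\<lambda>x. g' (g x)"]) blast
qed

definition hyperbolic_frame :: "nat \<Rightarrow> (nat \<Rightarrow> 'a ^ 'm) \<Rightarrow> (nat \<Rightarrow> 'a ^ 'm) \<Rightarrow> bool" where
  "hyperbolic_frame k x y \<longleftrightarrow>
     (\<forall>i\<in>{1..k}. N (x i) = 0 \<and> N (y i) = 0 \<and> B (x i) (y i) \<noteq> 0) \<and>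
     (\<forall>i\<in>{1..k}. \<forall>j\<in>{1..k}. B (x i) (x j) = 0 \<and> B (y i) (y j) = 0 \<and> (i \<noteq> j \<longrightarrow> B (x i) (y j) = 0))"

lemma hyperbolic_frame_sym: "hyperbolic_frame k x y \<Longrightarrow> hyperbolic_frame k y x"
proof -
  have "B (y i) (x j) = 0 \<longleftrightarrow> B (x j) (y i) = 0" for i j by (rule B_sym_0)
  then show "hyperbolic_frame k x y \<Longrightarrow> hyperbolic_frame k y x" by (simp add: hyperbolic_frame_def)
qed

text \<open>The pairs are moved one after another by isometries that fix the vectors already
  reached, collected in \<open>?H\<close>. Agreement up to scalars suffices because the result is
  applied to spans.\<close>

theorem witt_frames:
  assumes "hyperbolic_frame k x y" "hyperbolic_frame k x' y'"
  shows "\<exists>g. isometric g \<and> (\<forall>i\<in>{1..k}. (\<exists>c. c \<noteq> 0 \<and> g (x i) = c *s x' i) \<and> (\<exists>c. c \<noteq> 0 \<and> g (y i) = c *s y' i))"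
  using assms
proof (induction k)
  case 0 then show ?case using isometric_id by auto
next
  case (Suc k)
  have "hyperbolic_frame k x y" "hyperbolic_frame k x' y'"
    using Suc.prems by (auto simp: hyperbolic_frame_def)
  from Suc.IH[OF this] obtain g where g1: "isometric g" and g2: "\<forall>i\<in>{1..k}. (\<exists>c. c \<noteq> 0 \<and> g (x i) = c *s x' i) \<and>
      (\<exists>c. c \<noteq> 0 \<and> g (y i) = c *s y' i)"
    by (elim exE conjE)
  note g = g1 g2[rule_format, THEN conjunct1] g2[rule_format, THEN conjunct2]
  let ?k = "Suc k" and ?H = "x' ` {1..k} \<union> y' ` {1..k}"
  note fr = Suc.prems[unfolded hyperbolic_frame_def]
  have k: "?k \<in> {1..?k}" and ik: "\<And>i. i \<in> {1..k} \<Longrightarrow> i \<in> {1..?k} \<and> i \<noteq> ?k" by auto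
  have N: "N (g (x ?k)) = 0" "N (x' ?k) = 0" "N (g (y ?k)) = 0" "N (y' ?k) = 0"
    "B (g (x ?k)) (g (y ?k)) \<noteq> 0" "B (x' ?k) (y' ?k) \<noteq> 0"
    using fr k by (auto simp: isometricD[OF g(1)])
  have scal: "B h (g z) = 0" if "g w = c *s h" "c \<noteq> 0" "B w z = 0" for h w z c
  proof -
    have "c * B h (g z) = B (g w) (g z)" using that by (simp add: B_simps)
    also have "\<dots> = 0" unfolding isometricD(3)[OF g(1)] by (rule that(3))
    finally show ?thesis using that by simp
  qed
  have H: "B h (g (x ?k)) = 0 \<and> B h (x' ?k) = 0 \<and> B h (g (y ?k)) = 0 \<and> B h (y' ?k) = 0" if h: "h \<in> ?H" for h
  proof -
    from h consider i where "i \<in> {1..k}" "h = x' i" | i where "i \<in> {1..k}" "h = y' i" by blast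
    then show ?thesis
    proof cases
      case 1
      obtain c where "c \<noteq> 0" "g (x i) = c *s h" using g(2) 1 by blast
      moreover have "B (x i) (x ?k) = 0" "B (x i) (y ?k) = 0" "B h (x' ?k) = 0" "B h (y' ?k) = 0"
        using fr ik[OF 1(1)] k 1(2) by simp_all
      ultimately show ?thesis using scal by simp
    next
      case 2
      obtain c where "c \<noteq> 0" "g (y i) = c *s h" using g(3) 2 by blast
      moreover have "B (y i) (y ?k) = 0" "B h (y' ?k) = 0" "B (x ?k) (y i) = 0" "B (x' ?k) h = 0"
        using fr ik[OF 2(1)] k 2(2) by simp_all
      then have "B (y i) (y ?k) = 0" "B h (y' ?k) = 0" "B (y i) (x ?k) = 0" "B h (x' ?k) = 0"
        using B_sym_0[of "x ?k"] B_sym_0[of "x' ?k"] by simp_all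
      ultimately show ?thesis using scal by simp
    qed
  qed
  have "\<exists>g'. isometric g' \<and> (\<exists>c. c \<noteq> 0 \<and> g' (g (x ?k)) = c *s x' ?k) \<and>
      (\<exists>c. c \<noteq> 0 \<and> g' (g (y ?k)) = c *s y' ?k) \<and> (\<forall>h\<in>?H. g' h = h)"
    by (rule move_hyperbolic_pair[OF N H])
  then obtain g' c c' where g': "isometric g'" "c \<noteq> 0" "g' (g (x ?k)) = c *s x' ?k" "c' \<noteq> 0" "g' (g (y ?k)) = c' *s y' ?k"
      "\<And>h. h \<in> ?H \<Longrightarrow> g' h = h"
    by blast
  have st: "(\<exists>c. c \<noteq> 0 \<and> g' (g (x i)) = c *s x' i) \<and> (\<exists>c. c \<noteq> 0 \<and> g' (g (y i)) = c *s y' i)" if "i \<in> {1..?k}" for i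
  proof (cases "i = ?k")
    case True then show ?thesis using g' by blast
  next
    case False
    then have i: "i \<in> {1..k}" using that by auto
    then have "g' (x' i) = x' i" "g' (y' i) = y' i" using g'(6) by blast+
    then show ?thesis using g(2)[OF i] g(3)[OF i] by (metis isometricD(2)[OF g'(1)])
  qed
  show ?case
    by (rule exI[of _ "\<lambda>x. g' (g x)"], rule conjI, rule isometric_comp[OF g'(1) g(1)], rule ballI, rule st)
qed

end

section \<open>Maximal flags and their adjacency relations\<close>

definition relation_operator :: "('f::finite \<Rightarrow> 'f \<Rightarrow> bool) \<Rightarrow> real ^ 'f \<Rightarrow> real ^ 'f" where
  "relation_operator R v = (\<chi> x. \<Sum>y | R x y. v $ y)"

lemma relation_operator_nth: "relation_operator R v $ x = (\<Sum>y | R x y. v $ y)"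
  by (simp add: relation_operator_def)

lemma linear_relation_operator: "linear (relation_operator R)"
  by (rule linearI) (simp_all add: vec_eq_iff relation_operator_nth sum.distrib sum_distrib_left)

lemma symmetric_relation_operator:
  assumes "symp R"
  shows "relation_operator R v \<bullet> w = v \<bullet> relation_operator R w"
proof -
  have eq: "relation_operator R v \<bullet> w = (\<Sum>x\<in>UNIV. \<Sum>y\<in>UNIV. if R x y then v $ y * w $ x else 0)" for v w
    by (simp add: inner_vec_def relation_operator_nth sum_distrib_right sum.If_cases)
  have "relation_operator R v \<bullet> w = (\<Sum>y\<in>UNIV. \<Sum>x\<in>UNIV. if R x y then v $ y * w $ x else 0)"
    unfolding eq by (rule sum.swap)
  also have "\<dots> = relation_operator R w \<bullet> v"
    unfolding eq using assms by (intro sum.cong) (auto dest: sympD)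
  finally show ?thesis by (simp add: inner_commute)
qed

text \<open>A unique intermediate vertex makes the product of two 0-1 matrices again a 0-1 matrix,
  so identities between operators reduce to identities between relations.\<close>

lemma relation_operator_comp:
  assumes "\<And>x y y' z. R x y \<Longrightarrow> S y z \<Longrightarrow> R x y' \<Longrightarrow> S y' z \<Longrightarrow> y = y'"
  shows "relation_operator R (relation_operator S v) = relation_operator (R OO S) v"
proof -
  have "(\<Sum>y | R x y. \<Sum>z | S y z. v $ z) = (\<Sum>z | (R OO S) x z. v $ z)" for x
  proof -
    have "(\<Sum>y | R x y. \<Sum>z | S y z. v $ z) = (\<Sum>(y, z)\<in>Sigma {y. R x y} (\<lambda>y. {z. S y z}). v $ z)"
      by (simp add: sum.Sigma)
    also have "\<dots> = (\<Sum>z\<in>snd ` Sigma {y. R x y} (\<lambda>y. {z. S y z}). v $ z)"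
      by (subst sum.reindex) (use assms in \<open>auto simp: inj_on_def intro!: sum.cong\<close>)
    also have "snd ` Sigma {y. R x y} (\<lambda>y. {z. S y z}) = {z. (R OO S) x z}" by force
    finally show ?thesis .
  qed
  then show ?thesis by (simp add: vec_eq_iff relation_operator_nth)
qed

lemma relation_operator_support:
  assumes "relation_operator R v $ x \<noteq> 0"
  obtains y where "R x y" "v $ y \<noteq> 0"
  using assms unfolding relation_operator_nth by (metis (mono_tags, lifting) mem_Collect_eq sum.neutral)

text \<open>Adjacency operators of disjoint unions of complete graphs on \<open>c + 1\<close> vertices.\<close>

lemma relation_operator_quadratic:
  fixes R :: "'f::finite \<Rightarrow> 'f \<Rightarrow> bool"
  assumes sym: "symp R" and irr: "\<And>x. \<not> R x x" and tr: "\<And>x y z. R x y \<Longrightarrow> R y z \<Longrightarrow> x \<noteq> z \<Longrightarrow> R x z"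
    and F: "\<And>x y. R x y \<Longrightarrow> x \<in> F" and c: "\<And>x. x \<in> F \<Longrightarrow> card {y. R x y} = c"
    and v: "\<And>x. x \<notin> F \<Longrightarrow> v $ x = 0"
  shows "relation_operator R (relation_operator R v) = (real c - 1) *\<^sub>R relation_operator R v + real c *\<^sub>R v"
proof -
  have "(\<Sum>y | R x y. \<Sum>z | R y z. v $ z) = (real c - 1) * (\<Sum>y | R x y. v $ y) + real c * v $ x" for x
  proof (cases "x \<in> F")
    case False
    then have "{y. R x y} = {}" using F by auto
    then show ?thesis using v False by simp
  next
    case True
    let ?s = "\<Sum>y | R x y. v $ y"
    have "(\<Sum>z | R y z. v $ z) = v $ x + ?s - v $ y" if y: "R x y" for y
    proof -
      have "{z. R y z} = insert x ({z. R x z} - {y})"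
        using y irr tr sym by (blast dest: sympD)
      then have "(\<Sum>z | R y z. v $ z) = v $ x + sum (($) v) ({z. R x z} - {y})" using irr by simp
      then show ?thesis using y by (simp add: sum_diff1)
    qed
    then have "(\<Sum>y | R x y. \<Sum>z | R y z. v $ z) = (\<Sum>y | R x y. v $ x + ?s - v $ y)" by simp
    also have "\<dots> = real c * (v $ x + ?s) - ?s" by (simp add: sum_subtractf c[OF True])
    finally show ?thesis by (simp add: algebra_simps)
  qed
  then show ?thesis by (simp add: vec_eq_iff relation_operator_nth)
qed

text \<open>A single vector of \<open>U'\<close> outside \<open>U\<close> already completes
  \<open>U\<close> to \<open>L\<close>.\<close>

lemma distinct_hyperplanes_span:
  fixes U :: "('a::{field,finite} ^ 'm::finite) set"
  assumes "vec.subspace U" "vec.subspace U'" "vec.subspace L" "vec.subspace W"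
    and "U \<noteq> U'" "vec.dim U = i" "vec.dim U' = i" "vec.dim L = Suc i"
    and "U \<subseteq> L" "U' \<subseteq> L" "U \<subseteq> W" "U' \<subseteq> W"
  shows "L \<subseteq> W"
proof -
  have "\<not> U' \<subseteq> U" using subspace_eqI_dim[of U' U] assms by auto
  then obtain x where x: "x \<in> U'" "x \<notin> U" by auto
  then have "vec.span (insert x U) = L" using assms by (intro span_insert_eqI) auto
  moreover have "vec.span (insert x U) \<subseteq> W" using assms x by (intro vec.span_minimal) auto
  ultimately show ?thesis by simp
qed

section \<open>Flags, their parts and adjacency\<close>

context ranked_polar_geometry begin

definition flags :: "('a ^ 'm) set set set" where
  "flags = {U ` {1..n} | U. (\<forall>i\<in>{1..n}. singular_subspace (U i) \<and> vec.dim (U i) = i) \<and>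
     (\<forall>i\<in>{1..<n}. U i \<subseteq> U (Suc i))}"

text \<open>\<open>part X i\<close> is meaningful for \<open>i \<le> n\<close> only; for larger \<open>i\<close> it is an unspecified set.\<close>

definition part :: "('a ^ 'm) set set \<Rightarrow> nat \<Rightarrow> ('a ^ 'm) set" where
  "part X i = (if i = 0 then {0} else THE U. U \<in> X \<and> vec.dim U = i)"

lemma part_0 [simp]: "part X 0 = {0}"
  by (simp add: part_def)

lemma part_image:
  assumes "\<forall>i\<in>{1..n}. vec.dim (U i) = i" "1 \<le> i" "i \<le> n"
  shows "part (U ` {1..n}) i = U i"
proof -
  have "(THE W. W \<in> U ` {1..n} \<and> vec.dim W = i) = U i"
    by (rule the_equality) (use assms in auto)
  then show ?thesis using assms by (simp add: part_def)
qed

lemma flag_part: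
  assumes X: "X \<in> flags"
  shows "X = part X ` {1..n}"
    and "i \<le> n \<Longrightarrow> singular_subspace (part X i)" "i \<le> n \<Longrightarrow> vec.dim (part X i) = i"
    and "i \<le> j \<Longrightarrow> j \<le> n \<Longrightarrow> part X i \<subseteq> part X j"
    and "i \<le> n \<Longrightarrow> vec.subspace (part X i)"
proof -
  obtain U where U: "X = U ` {1..n}" "\<forall>i\<in>{1..n}. singular_subspace (U i) \<and> vec.dim (U i) = i"
      "\<forall>i\<in>{1..<n}. U i \<subseteq> U (Suc i)"
    using X by (auto simp: flags_def)
  have c: "part X i = U i" if "1 \<le> i" "i \<le> n" for i using part_image[of U i] U that by simp
  show "X = part X ` {1..n}" using c U(1) by (metis (no_types, lifting) atLeastAtMost_iff image_cong)
  have s: "singular_subspace (part X i) \<and> vec.dim (part X i) = i" if "i \<le> n" for i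
  proof (cases "i = 0")
    case True then show ?thesis using singular_subspace_0 dim_eqI_card[of "{0 :: 'a ^ 'm}" 0] by (simp add: vec.subspace_single_0)
  next
    case False then show ?thesis using c[of i] U that by simp
  qed
  show "singular_subspace (part X i)" "vec.dim (part X i) = i" "vec.subspace (part X i)" if "i \<le> n"
    using s[OF that] singular_subspaceD(1) by auto
  show "i \<le> j \<Longrightarrow> j \<le> n \<Longrightarrow> part X i \<subseteq> part X j"
  proof (induction j)
    case 0 then show ?case by simp
  next
    case (Suc j)
    have step: "part X j \<subseteq> part X (Suc j)"
    proof (cases "j = 0")
      case True
      then show ?thesis using s[of "Suc j"] Suc.prems by (auto simp: vec.subspace_0 dest!: singular_subspaceD(1))
    next
      case False then show ?thesis using c[of j] c[of "Suc j"] U(3) Suc.prems by simp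
    qed
    show ?case
    proof (cases "i = Suc j")
      case False
      then show ?thesis using Suc step by auto
    qed simp
  qed
qed

lemma flag_eqI:
  assumes "X \<in> flags" "Y \<in> flags" "\<And>i. i \<le> n \<Longrightarrow> part X i = part Y i"
  shows "X = Y"
proof -
  have "part X ` {1..n} = part Y ` {1..n}" using assms(3) by (intro image_cong) auto
  then show ?thesis using flag_part(1)[OF assms(1)] flag_part(1)[OF assms(2)] by simp
qed

lemma flag_update:
  assumes X: "X \<in> flags" and i: "1 \<le> i" "i \<le> n" and U: "singular_subspace U" "vec.dim U = i"
    and lo: "part X (i - 1) \<subseteq> U" and hi: "i < n \<Longrightarrow> U \<subseteq> part X (Suc i)"
  shows "\<exists>Y\<in>flags. part Y i = U \<and> (\<forall>j\<le>n. j \<noteq> i \<longrightarrow> part Y j = part X j)"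
proof -
  define V where "V = (part X)(i := U)"
  have dimV: "\<forall>j\<in>{1..n}. vec.dim (V j) = j" using U flag_part(3)[OF X] by (simp add: V_def)
  have "V ` {1..n} \<in> flags"
  proof -
    have "V j \<subseteq> V (Suc j)" if "j \<in> {1..<n}" for j
      using that lo hi i flag_part(4)[OF X, of j "Suc j"] by (auto simp: V_def)
    then show ?thesis using dimV U flag_part(2)[OF X] unfolding flags_def
      by (intro CollectI exI[of _ V]) (auto simp: V_def)
  qed
  moreover have "part (V ` {1..n}) j = V j" if "j \<le> n" for j
    using part_image[OF dimV, of j] that i by (cases "j = 0") (auto simp: V_def)
  ultimately show ?thesis using i by (intro bexI[of _ "V ` {1..n}"]) (auto simp: V_def)
qed

definition agree_off :: "nat set \<Rightarrow> ('a ^ 'm) set set \<Rightarrow> ('a ^ 'm) set set \<Rightarrow> bool" where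
  "agree_off K X Y \<longleftrightarrow> X \<in> flags \<and> Y \<in> flags \<and> (\<forall>j\<le>n. j \<notin> K \<longrightarrow> part X j = part Y j)"

lemma agree_offD:
  "agree_off K X Y \<Longrightarrow> X \<in> flags" "agree_off K X Y \<Longrightarrow> Y \<in> flags"
  "agree_off K X Y \<Longrightarrow> j \<le> n \<Longrightarrow> j \<notin> K \<Longrightarrow> part X j = part Y j"
  by (auto simp: agree_off_def)

lemma agree_off_below:
  assumes "agree_off {a, Suc a} X Z" "1 \<le> a" "Suc a \<le> n"
  shows "part X (a - 1) = part Z (a - 1)"
  by (rule agree_offD(3)[OF assms(1)]) (use assms in auto)

lemma agree_off_sym: "agree_off K X Y \<Longrightarrow> agree_off K Y X"
  by (auto simp: agree_off_def)

lemma agree_off_trans: "agree_off K X Y \<Longrightarrow> agree_off L Y Z \<Longrightarrow> K \<union> L \<subseteq> M \<Longrightarrow> agree_off M X Z"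
  unfolding agree_off_def by (metis UnCI subsetD)

definition adjacent :: "nat \<Rightarrow> ('a ^ 'm) set set \<Rightarrow> ('a ^ 'm) set set \<Rightarrow> bool" where
  "adjacent i X Y \<longleftrightarrow> agree_off {i} X Y \<and> part X i \<noteq> part Y i"

lemma adjacent_sym: "adjacent i X Y \<Longrightarrow> adjacent i Y X"
  by (auto simp: adjacent_def intro: agree_off_sym)

lemma symp_adjacent: "symp (adjacent i)"
  by (simp add: symp_def adjacent_sym)

lemma adjacent_update:
  assumes X: "X \<in> flags" and i: "1 \<le> i" "i \<le> n" and U: "singular_subspace U" "vec.dim U = i"
    and lo: "part X (i - 1) \<subseteq> U" and hi: "i < n \<Longrightarrow> U \<subseteq> part X (Suc i)" and ne: "part X i \<noteq> U"
  shows "\<exists>Y. adjacent i X Y \<and> part Y i = U"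
  using flag_update[OF assms(1-7)] X ne by (auto simp: adjacent_def agree_off_def)

lemma adjacent_unique: "adjacent i X Y \<Longrightarrow> adjacent i X Y' \<Longrightarrow> part Y i = part Y' i \<Longrightarrow> Y = Y'"
proof (rule flag_eqI)
  fix j assume a: "adjacent i X Y" "adjacent i X Y'" "part Y i = part Y' i" and j: "j \<le> n"
  show "part Y j = part Y' j"
  proof (cases "j = i")
    case False
    then have "part X j = part Y j" "part X j = part Y' j" using a j by (auto simp: adjacent_def agree_off_def)
    then show ?thesis by simp
  qed (use a in simp)
qed (auto simp: adjacent_def agree_off_def)

text \<open>For \<open>i < n\<close> the candidates are the points of a projective line, for
  \<open>i = n\<close> the generators through a subspace of type \<open>n - 1\<close>, of which
  there are \<open>num_covers 1\<close>; in both cases the part of \<open>X\<close> itself is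
  removed.\<close>

lemma card_adjacent:
  assumes X: "X \<in> flags" and i: "1 \<le> i" "i \<le> n"
  shows "card {Y. adjacent i X Y} = (if i < n then CARD('a) else \<rho> * CARD('a) ^ d)"
proof -
  define I where "I = {U. singular_subspace U \<and> vec.dim U = i \<and> part X (i - 1) \<subseteq> U \<and> (i < n \<longrightarrow> U \<subseteq> part X (Suc i))}"
  have "bij_betw (\<lambda>Y. part Y i) {Y. adjacent i X Y} (I - {part X i})"
  proof (rule bij_betw_imageI)
    show "inj_on (\<lambda>Y. part Y i) {Y. adjacent i X Y}"
      by (rule inj_onI, rule adjacent_unique[of i X]) auto
    show "(\<lambda>Y. part Y i) ` {Y. adjacent i X Y} = I - {part X i}"
    proof (intro equalityI subsetI)
      fix U assume "U \<in> (\<lambda>Y. part Y i) ` {Y. adjacent i X Y}"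
      then obtain Y where Y: "adjacent i X Y" "U = part Y i" by auto
      have F: "Y \<in> flags" "part Y (i - 1) = part X (i - 1)" "i < n \<Longrightarrow> part Y (Suc i) = part X (Suc i)"
        using Y i by (auto simp: adjacent_def agree_off_def)
      show "U \<in> I - {part X i}"
        using Y i flag_part[OF F(1)] F(2,3) flag_part(4)[OF F(1), of "i - 1" i] flag_part(4)[OF F(1), of i "Suc i"]
        by (auto simp: I_def adjacent_def)
    next
      fix U assume "U \<in> I - {part X i}"
      then have "singular_subspace U" "vec.dim U = i" "part X (i - 1) \<subseteq> U" "i < n \<Longrightarrow> U \<subseteq> part X (Suc i)" "part X i \<noteq> U"
        by (simp_all add: I_def not_sym)
      from adjacent_update[OF X i this] show "U \<in> (\<lambda>Y. part Y i) ` {Y. adjacent i X Y}" by force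
    qed
  qed
  then have "card {Y. adjacent i X Y} = card (I - {part X i})" by (rule bij_betw_same_card)
  moreover have "part X i \<in> I"
    using i flag_part[OF X] by (auto simp: I_def)
  moreover have "card I = 1 + (if i < n then CARD('a) else \<rho> * CARD('a) ^ d)"
  proof (cases "i < n")
    case True
    have "I = {U. vec.subspace U \<and> part X (i - 1) \<subseteq> U \<and> U \<subseteq> part X (Suc i) \<and> vec.dim U = Suc (vec.dim (part X (i - 1)))}"
    proof -
      have s: "singular_subspace U \<longleftrightarrow> vec.subspace U" if "U \<subseteq> part X (Suc i)" for U
        using that True singular_subspaceD(1)[of U] singular_subspace_subset[OF flag_part(2)[OF X, of "Suc i"]] by auto
      have "Suc (vec.dim (part X (i - 1))) = i" using i flag_part(3)[OF X, of "i - 1"] by simp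
      then show ?thesis unfolding I_def by (intro Collect_cong) (use True s in auto)
    qed
    moreover have "card \<dots> = CARD('a) + 1"
      using True i flag_part(3,5)[OF X] flag_part(4)[OF X, of "i - 1" "Suc i"]
      by (intro card_intermediate_subspaces) auto
    ultimately show ?thesis using True by simp
  next
    case False
    have "I = covers (part X (i - 1))"
      using False i flag_part(3)[OF X, of "i - 1"] by (auto simp: I_def covers_def)
    moreover have "card (covers (part X (i - 1))) = num_covers 1"
      using False i flag_part(2,3)[OF X, of "i - 1"] by (intro card_covers) auto
    ultimately show ?thesis using False by simp
  qed
  ultimately show ?thesis by simp
qed

section \<open>Composites of adjacency relations and the braid relation of type A2\<close>

lemma adjacent_comp_unique:
  assumes "adjacent i X Y" "adjacent j Y Z" "adjacent i X Y'" "adjacent j Y' Z" "i \<noteq> j" "i \<le> n"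
  shows "Y = Y'"
proof (rule adjacent_unique[OF assms(1,3)])
  show "part Y i = part Y' i" using assms by (simp add: adjacent_def agree_off_def)
qed

text \<open>A change at \<open>j\<close> depends only on the parts of type \<open>j - 1\<close> and
  \<open>j + 1\<close>, and a change at \<open>i\<close> touches neither.\<close>

lemma far_swap:
  assumes "1 \<le> i" "Suc i < j \<or> Suc j < i" "1 \<le> j" "i \<le> n" "j \<le> n" "adjacent i X Y" "adjacent j Y Z"
  shows "\<exists>Y'. adjacent j X Y' \<and> adjacent i Y' Z"
proof -
  have F: "X \<in> flags" "Y \<in> flags" "Z \<in> flags" using assms by (auto simp: adjacent_def agree_off_def)
  have XY: "k \<le> n \<Longrightarrow> k \<noteq> i \<Longrightarrow> part X k = part Y k" and YZ: "k \<le> n \<Longrightarrow> k \<noteq> j \<Longrightarrow> part Y k = part Z k" for k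
    using assms by (auto simp: adjacent_def agree_off_def)
  have ij: "i \<noteq> j" "j \<noteq> i" using assms(2) by auto
  have lo: "part X (j - 1) = part Z (j - 1)" and hi: "j < n \<Longrightarrow> part X (Suc j) = part Z (Suc j)"
  proof -
    have "j - 1 \<noteq> i" "j - 1 \<noteq> j" "j - 1 \<le> n" "Suc j \<noteq> i" "Suc j \<noteq> j" using assms(1-5) by linarith+
    then show "part X (j - 1) = part Z (j - 1)" "j < n \<Longrightarrow> part X (Suc j) = part Z (Suc j)"
      using XY YZ by (metis, metis Suc_leI)
  qed
  have "\<exists>Y'. adjacent j X Y' \<and> part Y' j = part Z j"
  proof (rule adjacent_update)
    show "part X j \<noteq> part Z j" using XY[of j] ij assms by (simp add: adjacent_def)
    show "part X (j - 1) \<subseteq> part Z j" unfolding lo using assms by (intro flag_part(4)[OF F(3)]) simp_all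
    show "part Z j \<subseteq> part X (Suc j)" if "j < n" unfolding hi[OF that] using that by (intro flag_part(4)[OF F(3)]) simp_all
  qed (use assms(3) in \<open>simp_all add: F assms flag_part(2,3)\<close>)
  then obtain Y' where Y': "adjacent j X Y'" "part Y' j = part Z j" by blast
  then have F': "Y' \<in> flags" and XY': "\<And>k. k \<le> n \<Longrightarrow> k \<noteq> j \<Longrightarrow> part Y' k = part X k"
    by (simp_all add: adjacent_def agree_off_def)
  have "part X i \<noteq> part Z i" using YZ[of i] ij assms by (simp add: adjacent_def)
  moreover have "part Y' k = part Z k" if "k \<le> n" "k \<noteq> i" for k
    using XY[OF that] YZ[of k] XY'[of k] Y'(2) that by (cases "k = j") simp_all
  ultimately have "adjacent i Y' Z"
    using F(3) F' XY'[of i] ij assms(4) by (simp add: adjacent_def agree_off_def)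
  then show ?thesis using Y' by blast
qed

text \<open>The flag in the middle must be \<open>X\<close> with \<open>part Z a\<close> inserted;
  the last inclusion says that this is a flag.\<close>

lemma adjacent_comp_iff:
  assumes a: "1 \<le> a" "Suc a \<le> n"
  shows "(adjacent a OO adjacent (Suc a)) X Z \<longleftrightarrow> agree_off {a, Suc a} X Z \<and>
    part X a \<noteq> part Z a \<and> part X (Suc a) \<noteq> part Z (Suc a) \<and> part Z a \<subseteq> part X (Suc a)"
proof
  assume "(adjacent a OO adjacent (Suc a)) X Z"
  then obtain Y where Y: "adjacent a X Y" "adjacent (Suc a) Y Z" by blast
  then have "agree_off {a, Suc a} X Z" by (auto simp: adjacent_def intro: agree_off_trans)
  moreover have e: "part Y a = part Z a" "part Y (Suc a) = part X (Suc a)"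
    using Y a by (simp_all add: adjacent_def agree_off_def)
  moreover have "part Y a \<subseteq> part Y (Suc a)"
    using Y a by (intro flag_part(4)) (auto simp: adjacent_def agree_off_def)
  ultimately show "agree_off {a, Suc a} X Z \<and>
    part X a \<noteq> part Z a \<and> part X (Suc a) \<noteq> part Z (Suc a) \<and> part Z a \<subseteq> part X (Suc a)"
    using Y a by (simp add: adjacent_def)
next
  assume R: "agree_off {a, Suc a} X Z \<and>
    part X a \<noteq> part Z a \<and> part X (Suc a) \<noteq> part Z (Suc a) \<and> part Z a \<subseteq> part X (Suc a)"
  then have F: "X \<in> flags" "Z \<in> flags" by (auto simp: agree_off_def)
  have "part X (a - 1) = part Z (a - 1)" using R a agree_off_below by blast
  then have "\<exists>Y. adjacent a X Y \<and> part Y a = part Z a"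
    using R a F flag_part(2,3)[OF F(2)] flag_part(4)[OF F(2), of "a - 1" a] by (intro adjacent_update) auto
  then obtain Y where Y: "adjacent a X Y" "part Y a = part Z a" by blast
  have "part Y j = part Z j" if "j \<le> n" "j \<noteq> Suc a" for j
    using that Y R by (cases "j = a") (simp_all add: adjacent_def agree_off_def)
  then have "adjacent (Suc a) Y Z"
    using R a F Y by (simp add: adjacent_def agree_off_def)
  then show "(adjacent a OO adjacent (Suc a)) X Z" using Y by blast
qed

lemma adjacent_comp_converse: "(adjacent i OO adjacent j) X Z \<longleftrightarrow> (adjacent j OO adjacent i) Z X"
  using adjacent_sym by blast

lemma adjacent_comp_iff':
  assumes a: "1 \<le> a" "Suc a \<le> n"
  shows "(adjacent (Suc a) OO adjacent a) X Z \<longleftrightarrow> agree_off {a, Suc a} X Z \<and>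
    part X a \<noteq> part Z a \<and> part X (Suc a) \<noteq> part Z (Suc a) \<and> part X a \<subseteq> part Z (Suc a)"
  unfolding adjacent_comp_converse[of "Suc a"] adjacent_comp_iff[OF a] using agree_off_sym by metis

text \<open>In the projective plane \<open>part X (a + 2) / part X (a - 1)\<close>, neither point
  lies on the line of the other flag.\<close>

definition opposite_A2 :: "nat \<Rightarrow> ('a ^ 'm) set set \<Rightarrow> ('a ^ 'm) set set \<Rightarrow> bool" where
  "opposite_A2 a X Z \<longleftrightarrow> agree_off {a, Suc a} X Z \<and>
    \<not> part X a \<subseteq> part Z (Suc a) \<and> \<not> part Z a \<subseteq> part X (Suc a)"

text \<open>The point of the first intermediate flag has to be the intersection of the lines of
  \<open>X\<close> and \<open>Z\<close>, whence uniqueness. The other word of the braid relation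
  leads to the same relation through the dual argument below.\<close>

lemma path_A2_lower:
  assumes a: "1 \<le> a" "Suc (Suc a) \<le> n"
  shows "adjacent a OO (adjacent (Suc a) OO adjacent a) = opposite_A2 a"
    and "adjacent a X Y \<Longrightarrow> (adjacent (Suc a) OO adjacent a) Y Z \<Longrightarrow>
      adjacent a X Y' \<Longrightarrow> (adjacent (Suc a) OO adjacent a) Y' Z \<Longrightarrow> Y = Y'"
proof -
  have a': "1 \<le> a" "Suc a \<le> n" using a by auto
  have path: "agree_off {a, Suc a} X Z \<and> part X a \<noteq> part Y a \<and> part Y a \<noteq> part Z a \<and> part X (Suc a) \<noteq> part Z (Suc a) \<and>
      part Y a \<subseteq> part X (Suc a) \<and> part Y a \<subseteq> part Z (Suc a)"
    if "adjacent a X Y" "(adjacent (Suc a) OO adjacent a) Y Z" for X Y Z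
  proof -
    note P = that[unfolded adjacent_comp_iff'[OF a']]
    have "agree_off {a, Suc a} X Z" using P by (auto simp: adjacent_def intro: agree_off_trans)
    moreover have "part Y (Suc a) = part X (Suc a)" using P a by (simp add: adjacent_def agree_off_def)
    moreover have "part Y a \<subseteq> part Y (Suc a)" using P a by (intro flag_part(4)) (auto simp: adjacent_def agree_off_def)
    ultimately show ?thesis using P by (simp add: adjacent_def)
  qed
  show "Y = Y'" if "adjacent a X Y" "(adjacent (Suc a) OO adjacent a) Y Z"
      "adjacent a X Y'" "(adjacent (Suc a) OO adjacent a) Y' Z"
  proof (rule ccontr)
    assume "Y \<noteq> Y'"
    then have ne: "part Y a \<noteq> part Y' a" using adjacent_unique that by blast
    have F: "X \<in> flags" "Y \<in> flags" "Y' \<in> flags" "Z \<in> flags" using that path[OF that(1,2)] by (simp_all add: adjacent_def agree_off_def)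
    have "part X (Suc a) \<subseteq> part Z (Suc a)"
      by (rule distinct_hyperplanes_span[of "part Y a" "part Y' a" _ _ a])
        (use path[OF that(1,2)] path[OF that(3,4)] ne a F in \<open>simp_all add: flag_part(3,5)\<close>)
    then have "part X (Suc a) = part Z (Suc a)"
      by (rule subspace_eqI_dim[rotated 2]) (use a F in \<open>simp_all add: flag_part(3,5)\<close>)
    then show False using path[OF that(1,2)] by simp
  qed
  show "adjacent a OO (adjacent (Suc a) OO adjacent a) = opposite_A2 a"
  proof (intro ext iffI)
    fix X Z assume "(adjacent a OO (adjacent (Suc a) OO adjacent a)) X Z"
    then obtain Y where Y: "adjacent a X Y" "(adjacent (Suc a) OO adjacent a) Y Z" by blast
    note p = path[OF this]
    have F: "X \<in> flags" "Y \<in> flags" "Z \<in> flags" using Y p by (simp_all add: adjacent_def agree_off_def)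
    note c = flag_part(3,5)[OF F(1)] flag_part(3,5)[OF F(2)] flag_part(3,5)[OF F(3)]
      flag_part(4)[OF F(1), of a "Suc a"] flag_part(4)[OF F(3), of a "Suc a"]
    have "\<not> part X a \<subseteq> part Z (Suc a)"
    proof
      assume "part X a \<subseteq> part Z (Suc a)"
      then have "part X (Suc a) \<subseteq> part Z (Suc a)"
        by - (rule distinct_hyperplanes_span[of "part X a" "part Y a" _ _ a]; use p c a F in \<open>simp_all add: flag_part(3,5)\<close>)
      then have "part X (Suc a) = part Z (Suc a)" by (rule subspace_eqI_dim[rotated 2]) (use c a F in \<open>simp_all add: flag_part(3,5)\<close>)
      then show False using p by simp
    qed
    moreover have "\<not> part Z a \<subseteq> part X (Suc a)"
    proof
      assume "part Z a \<subseteq> part X (Suc a)"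
      then have "part Z (Suc a) \<subseteq> part X (Suc a)"
        by - (rule distinct_hyperplanes_span[of "part Y a" "part Z a" _ _ a]; use p c a F in \<open>simp_all add: flag_part(3,5)\<close>)
      then have "part Z (Suc a) = part X (Suc a)" by (rule subspace_eqI_dim[rotated 2]) (use c a F in \<open>simp_all add: flag_part(3,5)\<close>)
      then show False using p by simp
    qed
    ultimately show "opposite_A2 a X Z" using p by (simp add: opposite_A2_def)
  next
    fix X Z assume o: "opposite_A2 a X Z"
    then have F: "X \<in> flags" "Z \<in> flags" and e: "\<And>j. j \<le> n \<Longrightarrow> j \<noteq> a \<Longrightarrow> j \<noteq> Suc a \<Longrightarrow> part X j = part Z j"
      by (auto simp: opposite_A2_def agree_off_def)
    note cX = flag_part[OF F(1)] and cZ = flag_part[OF F(2)]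
    have below: "part X (a - 1) = part Z (a - 1)"
      using o a' agree_off_below by (simp add: opposite_A2_def)
    obtain x where x: "x \<in> part X a" "x \<notin> part Z (Suc a)" using o by (auto simp: opposite_A2_def)
    have "\<not> part X (Suc a) \<subseteq> part X a"
    proof
      assume "part X (Suc a) \<subseteq> part X a"
      from vec.dim_subset[OF this] show False using cX(3)[of a] cX(3)[of "Suc a"] a by simp
    qed
    then obtain l where l: "l \<in> part X (Suc a)" "l \<notin> part X a" by auto
    have top: "part X (Suc (Suc a)) = part Z (Suc (Suc a))" using e a by simp
    have "x \<in> part Z (Suc (Suc a))" "l \<in> part Z (Suc (Suc a))"
      using x(1) l(1) cX(4)[of a "Suc (Suc a)"] cX(4)[of "Suc a" "Suc (Suc a)"] a top by auto
    moreover have "vec.span (insert x (part Z (Suc a))) = part Z (Suc (Suc a))"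
      using x \<open>x \<in> part Z (Suc (Suc a))\<close> cZ(3,5) cZ(4)[of "Suc a" "Suc (Suc a)"] a by (intro span_insert_eqI) auto
    ultimately have "l \<in> vec.span (insert x (part Z (Suc a)))" by simp
    moreover have "vec.span (part Z (Suc a)) = part Z (Suc a)" using cZ(5) a by (simp add: vec.span_eq_iff)
    \<comment> \<open>Two lines of a plane meet: \<open>x\<close> spans the plane over
      \<open>part Z (a + 1)\<close>, so subtracting a multiple of \<open>x\<close> takes
      \<open>l\<close> into \<open>part Z (a + 1)\<close>. The result stays in
      \<open>part X (a + 1)\<close> and outside \<open>part X a\<close>.\<close>
    ultimately obtain k where k: "l - k *s x \<in> part Z (Suc a)" by (auto simp: vec.span_insert)
    define w where "w = l - k *s x"
    have kx: "k *s x \<in> part X a" "k *s x \<in> part X (Suc a)"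
      using x cX(5) cX(4)[of a "Suc a"] a by (auto intro: vec.subspace_scale)
    have wZ: "w \<in> part Z (Suc a)" using k by (simp add: w_def)
    have wX: "w \<in> part X (Suc a)" using l kx cX(5) a by (simp add: w_def vec.subspace_diff)
    have wXa: "w \<notin> part X a"
    proof
      assume "w \<in> part X a"
      then have "w + k *s x \<in> part X a" using kx cX(5) a by (simp add: vec.subspace_add)
      then show False using l by (simp add: w_def)
    qed
    let ?A = "part X (a - 1)"
    have a1: "a - 1 \<le> a" "a - 1 \<le> Suc a" "a - 1 \<le> n" "a \<le> n" "Suc a \<le> n" using a by auto
    have A: "?A \<subseteq> part X a" "?A \<subseteq> part X (Suc a)" "?A \<subseteq> part Z (Suc a)" "vec.subspace ?A" "vec.dim ?A = a - 1"
      using cX(4)[OF a1(1,4)] cX(4)[OF a1(2,5)] cZ(4)[OF a1(2,5)] below cX(3,5)[OF a1(3)] by simp_all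
    let ?P = "vec.span (insert w ?A)"
    have PX: "?P \<subseteq> part X (Suc a)" and PZ: "?P \<subseteq> part Z (Suc a)"
      using wX wZ A(2,3) cX(5)[OF a1(5)] cZ(5)[OF a1(5)] by (simp_all add: vec.span_minimal)
    have wP: "w \<in> ?P" by (simp add: vec.span_base)
    have "\<exists>Y. adjacent a X Y \<and> part Y a = ?P"
    proof (rule adjacent_update)
      show "singular_subspace ?P" using singular_subspace_subset[OF cX(2)[of "Suc a"]] PX a by simp
      have "w \<notin> ?A" using A(1) wXa by auto
      then show "vec.dim ?P = a" using A(4,5) a by (simp add: dim_insert_subspace)
      show "?A \<subseteq> ?P" by (auto intro: vec.span_base)
      show "part X a \<noteq> ?P" using wP wXa by auto
    qed (use F a PX in simp_all)
    then obtain Y where Y: "adjacent a X Y" "part Y a = ?P" by blast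
    have "(adjacent (Suc a) OO adjacent a) Y Z"
      unfolding adjacent_comp_iff'[OF a']
    proof (intro conjI)
      have "agree_off {a} Y X" "agree_off {a, Suc a} X Z"
        using o Y by (simp_all add: opposite_A2_def adjacent_def agree_off_sym)
      then show "agree_off {a, Suc a} Y Z" by (rule agree_off_trans) auto
      have "part Y (Suc a) = part X (Suc a)" using Y a by (simp add: adjacent_def agree_off_def)
      moreover have "part X a \<subseteq> part X (Suc a)" using cX(4)[of a "Suc a"] a by simp
      ultimately show "part Y (Suc a) \<noteq> part Z (Suc a)" using o by (auto simp: opposite_A2_def)
      show "part Y a \<noteq> part Z a" using o PX Y by (fastforce simp: opposite_A2_def)
      show "part Y a \<subseteq> part Z (Suc a)" using PZ Y by simp
    qed
    then show "(adjacent a OO (adjacent (Suc a) OO adjacent a)) X Z" using Y by blast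
  qed
qed

text \<open>Dually, the first intermediate flag uses the line joining the points
  \<open>part X a\<close> and \<open>part Z a\<close>.\<close>

lemma path_A2_upper:
  assumes a: "1 \<le> a" "Suc (Suc a) \<le> n"
  shows "adjacent (Suc a) OO (adjacent a OO adjacent (Suc a)) = opposite_A2 a"
    and "adjacent (Suc a) X Y \<Longrightarrow> (adjacent a OO adjacent (Suc a)) Y Z \<Longrightarrow>
      adjacent (Suc a) X Y' \<Longrightarrow> (adjacent a OO adjacent (Suc a)) Y' Z \<Longrightarrow> Y = Y'"
proof -
  have a': "1 \<le> a" "Suc a \<le> n" using a by auto
  have path: "agree_off {a, Suc a} X Z \<and> part X a \<noteq> part Z a \<and> part X (Suc a) \<noteq> part Y (Suc a) \<and> part Y (Suc a) \<noteq> part Z (Suc a) \<and>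
      part X a \<subseteq> part Y (Suc a) \<and> part Z a \<subseteq> part Y (Suc a)"
    if "adjacent (Suc a) X Y" "(adjacent a OO adjacent (Suc a)) Y Z" for X Y Z
  proof -
    note P = that[unfolded adjacent_comp_iff[OF a']]
    have "agree_off {a, Suc a} X Z" using P by (auto simp: adjacent_def intro: agree_off_trans)
    moreover have "part Y a = part X a" using P a by (simp add: adjacent_def agree_off_def)
    moreover have "part Y a \<subseteq> part Y (Suc a)" using P a by (intro flag_part(4)) (auto simp: adjacent_def agree_off_def)
    ultimately show ?thesis using P by (simp add: adjacent_def)
  qed
  show "Y = Y'" if "adjacent (Suc a) X Y" "(adjacent a OO adjacent (Suc a)) Y Z"
      "adjacent (Suc a) X Y'" "(adjacent a OO adjacent (Suc a)) Y' Z"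
  proof (rule adjacent_unique[OF that(1,3)])
    have F: "X \<in> flags" "Y \<in> flags" "Y' \<in> flags" "Z \<in> flags" using that path[OF that(1,2)] by (simp_all add: adjacent_def agree_off_def)
    have "part Y (Suc a) \<subseteq> part Y' (Suc a)"
      by (rule distinct_hyperplanes_span[of "part X a" "part Z a" _ _ a])
        (use path[OF that(1,2)] path[OF that(3,4)] a F in \<open>simp_all add: flag_part(3,5)\<close>)
    then show "part Y (Suc a) = part Y' (Suc a)"
      by (rule subspace_eqI_dim[rotated 2]) (use a F in \<open>simp_all add: flag_part(3,5)\<close>)
  qed
  show "adjacent (Suc a) OO (adjacent a OO adjacent (Suc a)) = opposite_A2 a"
  proof (intro ext iffI)
    fix X Z assume "(adjacent (Suc a) OO (adjacent a OO adjacent (Suc a))) X Z"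
    then obtain Y where Y: "adjacent (Suc a) X Y" "(adjacent a OO adjacent (Suc a)) Y Z" by blast
    note p = path[OF this]
    have F: "X \<in> flags" "Y \<in> flags" "Z \<in> flags" using Y p by (simp_all add: adjacent_def agree_off_def)
    note c = flag_part(3,5)[OF F(1)] flag_part(3,5)[OF F(2)] flag_part(3,5)[OF F(3)]
      flag_part(4)[OF F(1), of a "Suc a"] flag_part(4)[OF F(3), of a "Suc a"]
    have "\<not> part X a \<subseteq> part Z (Suc a)"
    proof
      assume "part X a \<subseteq> part Z (Suc a)"
      then have "part Y (Suc a) \<subseteq> part Z (Suc a)"
        by - (rule distinct_hyperplanes_span[of "part X a" "part Z a" _ _ a]; use p c a F in \<open>simp_all add: flag_part(3,5)\<close>)
      then have "part Y (Suc a) = part Z (Suc a)" by (rule subspace_eqI_dim[rotated 2]) (use c a F in \<open>simp_all add: flag_part(3,5)\<close>)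
      then show False using p by simp
    qed
    moreover have "\<not> part Z a \<subseteq> part X (Suc a)"
    proof
      assume "part Z a \<subseteq> part X (Suc a)"
      then have "part Y (Suc a) \<subseteq> part X (Suc a)"
        by - (rule distinct_hyperplanes_span[of "part X a" "part Z a" _ _ a]; use p c a F in \<open>simp_all add: flag_part(3,5)\<close>)
      then have "part Y (Suc a) = part X (Suc a)" by (rule subspace_eqI_dim[rotated 2]) (use c a F in \<open>simp_all add: flag_part(3,5)\<close>)
      then show False using p by simp
    qed
    ultimately show "opposite_A2 a X Z" using p by (simp add: opposite_A2_def)
  next
    fix X Z assume o: "opposite_A2 a X Z"
    then have F: "X \<in> flags" "Z \<in> flags" and e: "\<And>j. j \<le> n \<Longrightarrow> j \<noteq> a \<Longrightarrow> j \<noteq> Suc a \<Longrightarrow> part X j = part Z j"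
      by (auto simp: opposite_A2_def agree_off_def)
    note cX = flag_part[OF F(1)] and cZ = flag_part[OF F(2)]
    have below: "part X (a - 1) = part Z (a - 1)"
      using o a' agree_off_below by (simp add: opposite_A2_def)
    have sub: "part X a \<subseteq> part X (Suc a)" "part Z a \<subseteq> part Z (Suc a)"
      using cX(4)[of a "Suc a"] cZ(4)[of a "Suc a"] a by auto
    obtain y where y: "y \<in> part Z a" "y \<notin> part X (Suc a)" using o by (auto simp: opposite_A2_def)
    have yXa: "y \<notin> part X a" using y sub by auto
    have top: "part X (Suc (Suc a)) = part Z (Suc (Suc a))" using e a by simp
    let ?M = "vec.span (insert y (part X a))" and ?A = "part X (a - 1)"
    have a1: "a - 1 \<le> a" "a - 1 \<le> Suc a" "a - 1 \<le> n" "a \<le> n" "Suc a \<le> n" using a by auto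
    have A: "?A \<subseteq> part X a" "?A \<subseteq> part X (Suc a)" "?A \<subseteq> part Z a" "vec.subspace ?A" "vec.dim ?A = a - 1"
      using cX(4)[OF a1(1,4)] cX(4)[OF a1(2,5)] cZ(4)[OF a1(1,4)] below cX(3,5)[OF a1(3)] by simp_all
    have "y \<in> part X (Suc (Suc a))" using y cZ(4)[of a "Suc (Suc a)"] a top by auto
    then have MX: "?M \<subseteq> part X (Suc (Suc a))"
      using cX(4)[of a "Suc (Suc a)"] cX(5) a by (intro vec.span_minimal) auto
    have XM: "part X a \<subseteq> ?M" "y \<in> ?M" by (auto intro: vec.span_base)
    have "y \<notin> ?A" using A(1) yXa by auto
    then have "vec.span (insert y ?A) = part Z a"
      using y A(3-5) cZ(3,5)[OF a1(4)] a by (intro span_insert_eqI) simp_all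
    moreover have "vec.span (insert y ?A) \<subseteq> ?M" using A(1) by (intro vec.span_mono) auto
    ultimately have ZM: "part Z a \<subseteq> ?M" by simp
    have "\<exists>Y. adjacent (Suc a) X Y \<and> part Y (Suc a) = ?M"
    proof (rule adjacent_update)
      show "singular_subspace ?M" using singular_subspace_subset[OF cX(2)[of "Suc (Suc a)"]] MX a by simp
      show "vec.dim ?M = Suc a" using yXa cX(3,5) a by (simp add: dim_insert_subspace)
      show "part X (Suc a) \<noteq> ?M" using y XM by auto
    qed (use F a MX XM in simp_all)
    then obtain Y where Y: "adjacent (Suc a) X Y" "part Y (Suc a) = ?M" by blast
    have "(adjacent a OO adjacent (Suc a)) Y Z"
      unfolding adjacent_comp_iff[OF a']
    proof (intro conjI)
      have "agree_off {Suc a} Y X" "agree_off {a, Suc a} X Z"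
        using o Y by (simp_all add: opposite_A2_def adjacent_def agree_off_sym)
      then show "agree_off {a, Suc a} Y Z" by (rule agree_off_trans) auto
      have "part Y a = part X a" using Y a by (simp add: adjacent_def agree_off_def)
      then show "part Y a \<noteq> part Z a" using y yXa by auto
      show "part Y (Suc a) \<noteq> part Z (Suc a)" using o XM Y by (auto simp: opposite_A2_def)
      show "part Z a \<subseteq> part Y (Suc a)" using ZM Y by simp
    qed
    then show "(adjacent (Suc a) OO (adjacent a OO adjacent (Suc a))) X Z" using Y by blast
  qed
qed

end

section \<open>The braid relation of type B2 and the Hecke algebra of the flags\<close>

context ranked_polar_geometry begin

text \<open>Opposite flags of the generalised quadrangle above the part of type
  \<open>n - 2\<close>: the points are not collinear and the lines do not meet.\<close>

definition opposite_B2 :: "('a ^ 'm) set set \<Rightarrow> ('a ^ 'm) set set \<Rightarrow> bool" where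
  "opposite_B2 X Z \<longleftrightarrow> agree_off {n - 1, n} X Z \<and>
    \<not> part Z (n - 1) \<subseteq> perp (part X (n - 1)) \<and> part X n \<inter> part Z n \<subseteq> part X (n - 2)"

text \<open>A path is determined by its middle flag: the point is the unique point on the line of
  \<open>X\<close> collinear with the point of \<open>Z\<close>, and the line joins these two
  points.\<close>

lemma path_B2:
  assumes n: "2 \<le> n"
  shows "(adjacent (n - 1) OO adjacent n) OO (adjacent (n - 1) OO adjacent n) = opposite_B2"
    and "(adjacent (n - 1) OO adjacent n) X Y \<Longrightarrow> (adjacent (n - 1) OO adjacent n) Y Z \<Longrightarrow>
      (adjacent (n - 1) OO adjacent n) X Y' \<Longrightarrow> (adjacent (n - 1) OO adjacent n) Y' Z \<Longrightarrow> Y = Y'"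
proof -
  define a where "a = n - 1"
  have an: "n = Suc a" "n - 1 = a" "n - 2 = a - 1" and a: "1 \<le> a" "Suc a \<le> n" "a \<le> n" "a - 1 \<le> n" "a - 1 \<le> a" "a - 1 \<le> Suc a" "Suc (a - 1) = a"
    using n by (auto simp: a_def)
  have nea: "n \<noteq> a" "a \<noteq> n" using n by (simp_all add: a_def)
  note R = adjacent_comp_iff[OF a(1,2), folded an(1)] and below = agree_off_below[OF _ a(1,2), folded an(1)]
  have hyp: "part Y n \<subseteq> W"
    if Y: "Y \<in> flags" and Z: "Z \<in> flags" and W: "vec.subspace W" "part Y a \<noteq> part Z a" "part Z a \<subseteq> part Y n"
      "part Y a \<subseteq> W" "part Z a \<subseteq> W" for Y Z W
    by (rule distinct_hyperplanes_span[OF flag_part(5)[OF Y a(3)] flag_part(5)[OF Z a(3)] flag_part(5)[OF Y le_refl] W(1,2)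
        flag_part(3)[OF Y a(3)] flag_part(3)[OF Z a(3)] trans[OF flag_part(3)[OF Y le_refl] an(1)]
        flag_part(4)[OF Y a(3) le_refl] W(3,4,5)])
  have path: "agree_off {a, n} X Y \<and> agree_off {a, n} Y Z \<and> agree_off {a, n} X Z
      \<and> part X a \<noteq> part Y a \<and> part X n \<noteq> part Y n \<and> part Y a \<subseteq> part X n
      \<and> part Y a \<noteq> part Z a \<and> part Y n \<noteq> part Z n \<and> part Z a \<subseteq> part Y n
      \<and> part Y a = perp (part Z a) \<inter> part X n"
    if "(adjacent a OO adjacent n) X Y" "(adjacent a OO adjacent n) Y Z" for X Y Z
  proof -
    note P = that[unfolded R]
    have XZ: "agree_off {a, n} X Z" using P by (auto intro: agree_off_trans)
    have F: "X \<in> flags" "Y \<in> flags" "Z \<in> flags" using P by (simp_all add: agree_off_def)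
    note sp = flag_part(5)[OF F(1)] flag_part(5)[OF F(2)] flag_part(5)[OF F(3)]
    note dm = flag_part(3)[OF F(1)] flag_part(3)[OF F(2)] flag_part(3)[OF F(3)]
    have YY: "part Y a \<subseteq> part Y n" using flag_part(4)[OF F(2), of a n] an by simp
    \<comment> \<open>Otherwise \<open>part Z a\<close> lies in \<open>part X n\<close>, and then
      the generators of \<open>X\<close> and \<open>Y\<close> coincide, or some vector of it extends
      \<open>part X n\<close> to a singular subspace of dimension \<open>n + 1\<close>.\<close>
    have 1: "\<not> part X n \<subseteq> perp (part Z a)"
    proof
      assume h: "part X n \<subseteq> perp (part Z a)"
      show False
      proof (cases "part Z a \<subseteq> part X n")
        case True
        have "part X n \<subseteq> part Y n"
          by (rule distinct_hyperplanes_span[of "part Y a" "part Z a" _ _ a])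
            (use P True YY a an sp dm in simp_all)
        then have "part X n = part Y n" by (rule subspace_eqI_dim[rotated 2]) (use sp dm in simp_all)
        then show False using P an by simp
      next
        case False
        then obtain y where y: "y \<in> part Z a" "y \<notin> part X n" by blast
        have "y \<in> perp (part X n)" using h y by (auto simp: perp_def B_sym_0)
        moreover have "N y = 0" using singular_subspaceD(2)[OF flag_part(2)[OF F(3) a(3)]] y by simp
        ultimately have "vec.span (insert y (part X n)) \<in> covers (part X n)"
          using flag_part(2)[OF F(1) le_refl] y by (intro span_insert_in_covers)
        then show False using rank_le[of "vec.span (insert y (part X n))"] dm(1)[OF le_refl] by (simp add: covers_def)
      qed
    qed
    have 2: "part Y a \<subseteq> perp (part Z a) \<inter> part X n"
    proof -
      have "singular_subspace (part Y n)" by (rule flag_part(2)[OF F(2) le_refl])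
      then have "part Y n \<subseteq> perp (part Z a)"
        using singular_subspaceD(4) perp_mono[of "part Z a" "part Y n"] P an by auto
      then show ?thesis using YY P an by auto
    qed
    have "part Y a = perp (part Z a) \<inter> part X n"
    proof (rule subspace_eqI_dim[OF _ _ 2])
      show s: "vec.subspace (perp (part Z a) \<inter> part X n)" using subspace_perp sp(1) by (simp add: vec.subspace_inter)
      show "vec.dim (perp (part Z a) \<inter> part X n) \<le> vec.dim (part Y a)"
      proof (rule ccontr)
        assume "\<not> ?thesis"
        then have "vec.dim (part X n) \<le> vec.dim (perp (part Z a) \<inter> part X n)" using dm a an by simp
        then have "perp (part Z a) \<inter> part X n = part X n"
          by (intro subspace_eqI_dim s) (simp_all add: sp)
        then show False using 1 by auto
      qed
    qed (use sp a in simp)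
    then show ?thesis using P XZ by simp
  qed
  show "Y = Y'" if h: "(adjacent (n - 1) OO adjacent n) X Y" "(adjacent (n - 1) OO adjacent n) Y Z"
      "(adjacent (n - 1) OO adjacent n) X Y'" "(adjacent (n - 1) OO adjacent n) Y' Z"
  proof -
    note p = path[OF h(1,2)[unfolded an(2)]] and p' = path[OF h(3,4)[unfolded an(2)]]
    have F: "X \<in> flags" "Y \<in> flags" "Z \<in> flags" "Y' \<in> flags" using p p' agree_offD(1,2) by blast+
    have ea: "part Y a = part Y' a" using p p' by simp
    have "part Y n \<subseteq> part Y' n"
      by (rule hyp[OF F(2,3) flag_part(5)[OF F(4) le_refl]])
        (use p p' ea flag_part(4)[OF F(4) a(3) le_refl] in simp_all)
    then have en: "part Y n = part Y' n"
      by (rule subspace_eqI_dim[rotated 2]) (simp_all add: flag_part(3,5) F)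
    show "Y = Y'"
    proof (rule flag_eqI[OF F(2,4)])
      fix j assume j: "j \<le> n"
      show "part Y j = part Y' j"
      proof (cases "j \<in> {a, n}")
        case True then show ?thesis using ea en an by auto
      next
        case False
        have "part X j = part Y j" "part X j = part Y' j"
          by (rule agree_offD(3)[OF conjunct1[OF p] j False], rule agree_offD(3)[OF conjunct1[OF p'] j False])
        then show ?thesis by simp
      qed
    qed
  qed
  show "(adjacent (n - 1) OO adjacent n) OO (adjacent (n - 1) OO adjacent n) = opposite_B2"
    unfolding an(2)
  proof (intro ext iffI)
    fix X Z assume "((adjacent a OO adjacent n) OO (adjacent a OO adjacent n)) X Z"
    then obtain Y where Y: "(adjacent a OO adjacent n) X Y" "(adjacent a OO adjacent n) Y Z" by blast
    note p = path[OF Y]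
    have F: "X \<in> flags" "Y \<in> flags" "Z \<in> flags" using p agree_offD(1,2) by blast+
    have "\<not> part Z a \<subseteq> perp (part X a)"
    proof
      assume "part Z a \<subseteq> perp (part X a)"
      then have "part X a \<subseteq> perp (part Z a)" by (simp add: subset_perp_sym)
      moreover have "part X a \<subseteq> part X n" by (rule flag_part(4)[OF F(1) a(3) le_refl])
      ultimately have "part X a \<subseteq> part Y a" using p by simp
      then have "part X a = part Y a" by (rule subspace_eqI_dim[rotated 2]) (use a in \<open>simp_all add: flag_part(3,5) F\<close>)
      moreover have "part X a \<noteq> part Y a" using p by (elim conjE)
      ultimately show False by contradiction
    qed
    moreover have "part X n \<inter> part Z n \<subseteq> part X (a - 1)"
    proof (rule subsetI, rule ccontr)
      fix z assume z: "z \<in> part X n \<inter> part Z n" "z \<notin> part X (a - 1)"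
      have ZZ: "part Z a \<subseteq> part Z n" by (rule flag_part(4)[OF F(3) a(3) le_refl])
      have "part Z n \<subseteq> perp (part Z a)"
        using singular_subspaceD(4)[OF flag_part(2)[OF F(3) le_refl]] perp_mono[OF ZZ] by blast
      then have zY: "z \<in> part Y a" using p z by blast
      have XY: "part X (a - 1) = part Y (a - 1)" "part X (a - 1) = part Z (a - 1)"
        using p below by blast+
      have "vec.span (insert z (part X (a - 1))) = part Y a"
        using z(2) zY flag_part(4)[OF F(2) a(5,3)] a unfolding XY(1)
        by (intro span_insert_eqI) (simp_all add: flag_part(3,5) F)
      moreover have "vec.span (insert z (part X (a - 1))) \<subseteq> part Z n"
        using z(1) flag_part(4)[OF F(3) a(4) le_refl] unfolding XY(2)
        by (intro vec.span_minimal) (simp_all add: flag_part(5) F)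
      ultimately have YZ: "part Y a \<subseteq> part Z n" by simp
      have "part Y n \<subseteq> part Z n"
        by (rule hyp[OF F(2,3) flag_part(5)[OF F(3) le_refl]]; insert p YZ ZZ; elim conjE; assumption)
      then have "part Y n = part Z n" by (rule subspace_eqI_dim[rotated 2]) (simp_all add: flag_part(3,5) F)
      then show False using p by simp
    qed
    moreover have "agree_off {a, n} X Z" using p by (elim conjE)
    ultimately show "opposite_B2 X Z" unfolding opposite_B2_def an(2,3) by (intro conjI)
  next
    fix X Z assume o: "opposite_B2 X Z"
    have ag: "agree_off {a, n} X Z" and o1: "\<not> part Z a \<subseteq> perp (part X a)"
      and o2: "part X n \<inter> part Z n \<subseteq> part X (a - 1)"
      using o unfolding opposite_B2_def an(2,3) by simp_all
    have F: "X \<in> flags" "Z \<in> flags" using ag by (simp_all add: agree_off_def)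
    have bXZ: "part X (a - 1) = part Z (a - 1)" by (rule below[OF ag])
    note cX = flag_part[OF F(1)] and cZ = flag_part[OF F(2)]
    let ?A = "part X (a - 1)" and ?G = "part X n"
    have A: "?A \<subseteq> ?G" "?A \<subseteq> part Z a" "vec.dim ?A = a - 1" "vec.subspace ?A"
      using cX(4)[OF a(4) le_refl] cZ(4)[OF a(5,3)] cX(3,5)[OF a(4)] bXZ by simp_all
    have G: "singular_subspace ?G" "vec.dim ?G = n" "vec.subspace ?G" using cX(2,3,5) by auto
    have Za: "singular_subspace (part Z a)" "vec.dim (part Z a) = a" "vec.subspace (part Z a)" using cZ(2,3,5)[OF a(3)] by auto
    have "part Z a \<in> covers ?A" using A Za a(7) by (simp add: covers_def)
    then obtain y where y: "y \<in> part Z a" "y \<notin> ?A" "part Z a = vec.span (insert y ?A)" using cover_obtain[OF A(4)] by metis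
    have Ny: "N y = 0" using Za(1) y singular_subspaceD(2) by blast
    have GA: "?G \<subseteq> perp ?A" using singular_subspaceD(4)[OF G(1)] perp_mono[OF A(1)] by blast
    \<comment> \<open>The projection of \<open>part Z a\<close> to the generator of
      \<open>X\<close>; it has dimension \<open>a\<close> because a vector of
      \<open>part X a\<close> is not orthogonal to \<open>part Z a\<close>.\<close>
    define P where "P = perp (part Z a) \<inter> ?G"
    have Peq: "P = {g \<in> ?G. B g y = 0}"
      unfolding P_def y(3) perp_span using GA by (auto simp: perp_def)
    obtain x where x: "x \<in> part X a" "x \<notin> perp (part Z a)" using o1 subset_perp_sym by blast
    have xG: "x \<in> ?G" using x cX(4)[OF a(3) le_refl] by blast
    have xP: "x \<notin> P" using x by (simp add: P_def)
    then have xy: "B x y \<noteq> 0" using xG by (simp add: Peq)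
    have yG: "y \<notin> ?G" using singular_subspaceD(3)[OF G(1) xG] xy by blast
    have yP: "y \<notin> P" using yG by (simp add: P_def)
    have sP: "vec.subspace P" unfolding P_def by (intro vec.subspace_inter subspace_perp G)
    have ssP: "singular_subspace P" by (rule singular_subspace_subset[OF G(1) sP]) (simp add: P_def)
    have dP: "vec.dim P = a"
    proof (rule dim_eqI_card[OF sP])
      have "CARD('a) * card P = card ?G"
        unfolding Peq using card_fibre_functional[OF G(3), of "\<lambda>g. B g y" x 0] xG xy by (simp add: B_simps)
      then show "card P = CARD('a) ^ a" using card_subspace[OF G(3)] G(2) an(1) by simp
    qed
    have AP: "?A \<subseteq> P"
      unfolding P_def using A(1,2) singular_subspaceD(4)[OF Za(1)] by blast
    have yperp: "y \<in> perp P"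
    proof (rule perpI)
      fix g assume "g \<in> P"
      then have "B g y = 0" by (simp add: Peq)
      then show "B y g = 0" using B_sym_0 by blast
    qed
    \<comment> \<open>The generator joining \<open>P\<close> and \<open>part Z a\<close>.\<close>
    define G' where "G' = vec.span (insert y P)"
    have "G' \<in> covers P" unfolding G'_def by (rule span_insert_in_covers[OF ssP yperp Ny yP])
    then have G': "singular_subspace G'" "P \<subseteq> G'" "vec.dim G' = n" using dP an(1) by (simp_all add: covers_def)
    have yG': "y \<in> G'" by (simp add: G'_def vec.span_base)
    have ZG': "part Z a \<subseteq> G'" unfolding y(3) G'_def using AP by (intro vec.span_mono) auto
    have "\<exists>Y. adjacent a X Y \<and> part Y a = P"
    proof (rule adjacent_update[OF F(1) a(1,3) ssP dP AP])
      show "P \<subseteq> part X (Suc a)" unfolding an(1)[symmetric] by (simp add: P_def)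
      show "part X a \<noteq> P" using x(1) xP by blast
    qed
    then obtain Y1 where Y1: "adjacent a X Y1" "part Y1 a = P" by blast
    have FY1: "Y1 \<in> flags" "part Y1 n = ?G" using Y1(1) nea by (simp_all add: adjacent_def agree_off_def)
    have "\<exists>Y. adjacent n Y1 Y \<and> part Y n = G'"
    proof (rule adjacent_update[OF FY1(1) _ _ G'(1,3)])
      show "part Y1 (n - 1) \<subseteq> G'" using G'(2) Y1(2) an(2) by simp
      show "part Y1 n \<noteq> G'" using yG yG' FY1(2) by blast
    qed (use n in simp_all)
    then obtain Y where Y: "adjacent n Y1 Y" "part Y n = G'" by blast
    have XY: "(adjacent a OO adjacent n) X Y" using Y1 Y by blast
    have "part Y a = P" using Y(1) Y1(2) nea a(3) by (simp add: adjacent_def agree_off_def)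
    have "agree_off {a, n} Y X" using XY[unfolded R] by (simp add: agree_off_sym)
    then have YZ: "agree_off {a, n} Y Z" using ag by (rule agree_off_trans) simp
    have "G' \<noteq> part Z n"
    proof
      assume "G' = part Z n"
      then have "P \<subseteq> ?A" using o2 G'(2) by (auto simp: P_def)
      then have "vec.dim P \<le> vec.dim ?A" by (rule vec.dim_subset)
      then show False using dP A(3) a(1) by simp
    qed
    moreover have "P \<noteq> part Z a" using y(1) yP by blast
    ultimately have "(adjacent a OO adjacent n) Y Z"
      unfolding R using YZ \<open>part Y a = P\<close> Y(2) ZG' by simp
    then show "((adjacent a OO adjacent n) OO (adjacent a OO adjacent n)) X Z" using XY by blast
  qed
qed

lemma opposite_B2_sym:
  assumes "2 \<le> n" "opposite_B2 X Z"
  shows "opposite_B2 Z X"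
proof -
  have "{n - 1, n} = {n - 1, Suc (n - 1)}" "n - 1 - 1 = n - 2" using assms(1) by auto
  then have "part X (n - 2) = part Z (n - 2)"
    using agree_off_below[of "n - 1" X Z] assms by (simp add: opposite_B2_def)
  then show ?thesis
    using assms(2) agree_off_sym unfolding opposite_B2_def subset_perp_sym[of "part Z (n - 1)"] by (simp add: Int_commute)
qed

lemma path_B2':
  assumes n: "2 \<le> n"
  shows "(adjacent n OO adjacent (n - 1)) OO (adjacent n OO adjacent (n - 1)) = opposite_B2"
proof (intro ext)
  fix X Z
  have c: "(adjacent n OO adjacent (n - 1)) X Y \<longleftrightarrow> (adjacent (n - 1) OO adjacent n) Y X" for X Y
    by (rule adjacent_comp_converse)
  have "((adjacent n OO adjacent (n - 1)) OO (adjacent n OO adjacent (n - 1))) X Z \<longleftrightarrow>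
      ((adjacent (n - 1) OO adjacent n) OO (adjacent (n - 1) OO adjacent n)) Z X"
    using c by (simp only: relcompp_apply) blast
  also have "\<dots> \<longleftrightarrow> opposite_B2 X Z"
    unfolding path_B2(1)[OF n] using opposite_B2_sym[OF n] by blast
  finally show "((adjacent n OO adjacent (n - 1)) OO (adjacent n OO adjacent (n - 1))) X Z = opposite_B2 X Z" .
qed

abbreviation adj_op :: "nat \<Rightarrow> real ^ (('a ^ 'm) set set) \<Rightarrow> real ^ (('a ^ 'm) set set)" where
  "adj_op i \<equiv> relation_operator (adjacent i)"

lemma adj_op_comp:
  assumes "i \<noteq> j" "i \<le> n"
  shows "adj_op i (adj_op j v) = relation_operator (adjacent i OO adjacent j) v"
  by (rule relation_operator_comp) (rule adjacent_comp_unique[OF _ _ _ _ assms])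

lemma adj_op_far:
  assumes "1 \<le> i" "Suc i < j \<or> Suc j < i" "1 \<le> j" "i \<le> n" "j \<le> n"
  shows "adj_op i (adj_op j v) = adj_op j (adj_op i v)"
proof -
  have "adjacent i OO adjacent j = adjacent j OO adjacent i"
    using far_swap[of i j] far_swap[of j i] assms by (intro ext) blast
  moreover have "i \<noteq> j" using assms(2) by auto
  ultimately show ?thesis using assms by (simp add: adj_op_comp)
qed

lemma adj_op_braid_A2:
  assumes a: "1 \<le> a" "Suc (Suc a) \<le> n"
  shows "adj_op a (adj_op (Suc a) (adj_op a v)) = adj_op (Suc a) (adj_op a (adj_op (Suc a) v))"
proof -
  have "adj_op a (adj_op (Suc a) (adj_op a v)) = relation_operator (opposite_A2 a) v"
    unfolding path_A2_lower(1)[OF a, symmetric] using a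
    by (simp add: adj_op_comp relation_operator_comp[OF path_A2_lower(2)[OF a]])
  moreover have "adj_op (Suc a) (adj_op a (adj_op (Suc a) v)) = relation_operator (opposite_A2 a) v"
    unfolding path_A2_upper(1)[OF a, symmetric] using a
    by (simp add: adj_op_comp relation_operator_comp[OF path_A2_upper(2)[OF a]])
  ultimately show ?thesis by simp
qed

lemma adj_op_braid_B2:
  assumes n: "2 \<le> n"
  shows "adj_op n (adj_op (n - 1) (adj_op n (adj_op (n - 1) v))) = adj_op (n - 1) (adj_op n (adj_op (n - 1) (adj_op n v)))"
proof -
  let ?R = "adjacent (n - 1) OO adjacent n" and ?R' = "adjacent n OO adjacent (n - 1)"
  have ne: "n - 1 \<noteq> n" "n \<noteq> n - 1" using n by auto
  have "adj_op (n - 1) (adj_op n (adj_op (n - 1) (adj_op n v))) = relation_operator (?R OO ?R) v"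
    using ne by (simp add: adj_op_comp relation_operator_comp[OF path_B2(2)[OF n]])
  moreover have "adj_op n (adj_op (n - 1) (adj_op n (adj_op (n - 1) v))) = relation_operator (?R' OO ?R') v"
  proof -
    have "Y = Y'" if "?R' X Y" "?R' Y Z" "?R' X Y'" "?R' Y' Z" for X Y Y' Z
      using path_B2(2)[OF n, of Z Y X Y'] that unfolding adjacent_comp_converse[of n "n - 1"] by blast
    then have "relation_operator ?R' (relation_operator ?R' v) = relation_operator (?R' OO ?R') v"
      by (rule relation_operator_comp)
    then show ?thesis by (simp only: adj_op_comp[OF ne(2) le_refl])
  qed
  ultimately show ?thesis unfolding path_B2(1)[OF n] path_B2'[OF n] by simp
qed

text \<open>Coordinates run over all sets of sets of vectors, since the index of
  \<open>real ^ _\<close> is a type. The quadratic relations hold for the vectors that vanish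
  outside the flags.\<close>

definition flag_space :: "(real ^ (('a ^ 'm) set set)) set" where
  "flag_space = {v. \<forall>X. X \<notin> flags \<longrightarrow> v $ X = 0}"

lemma adj_op_flag_space: "adj_op i v \<in> flag_space"
proof -
  have "{Y. adjacent i X Y} = {}" if "X \<notin> flags" for X using that by (auto simp: adjacent_def agree_off_def)
  then show ?thesis by (simp add: flag_space_def relation_operator_nth)
qed

lemma adj_op_quadratic:
  assumes i: "1 \<le> i" "i \<le> n" and v: "v \<in> flag_space"
  defines "c \<equiv> if i < n then CARD('a) else \<rho> * CARD('a) ^ d"
  shows "adj_op i (adj_op i v) = (real c - 1) *\<^sub>R adj_op i v + real c *\<^sub>R v"
proof (rule relation_operator_quadratic[OF symp_adjacent])
  show "adjacent i X Y \<Longrightarrow> X \<in> flags" for X Y by (simp add: adjacent_def agree_off_def)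
  show "X \<in> flags \<Longrightarrow> card {Y. adjacent i X Y} = c" for X using card_adjacent[OF _ i] by (simp add: c_def)
  show "adjacent i X Z" if "adjacent i X Y" "adjacent i Y Z" "X \<noteq> Z" for X Y Z
  proof -
    have ag: "agree_off {i} X Z" using that by (auto simp: adjacent_def intro: agree_off_trans)
    moreover have "part X i \<noteq> part Z i"
    proof
      assume e: "part X i = part Z i"
      have "X = Z"
      proof (rule flag_eqI)
        fix j assume "j \<le> n"
        then show "part X j = part Z j" using e ag by (cases "j = i") (simp_all add: agree_off_def)
      qed (use ag in \<open>simp_all add: agree_off_def\<close>)
      then show False using that(3) by simp
    qed
    ultimately show ?thesis by (simp add: adjacent_def)
  qed
qed (use v in \<open>simp_all add: adjacent_def flag_space_def\<close>)

text \<open>The numbering is reversed: the node of type \<open>n\<close> carries the parameter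
  \<open>Q\<close> and comes first, and \<open>T k\<close> changes the part of type
  \<open>n - 1 - k\<close>.\<close>

lemma hecke_flags:
  assumes n: "1 \<le> n" and rho: "\<rho> > 0"
  shows "hecke_algebra flag_space n (real CARD('a)) (real (\<rho> * CARD('a) ^ d)) (adj_op n) (\<lambda>k. adj_op (n - 1 - k))"
proof (rule hecke_algebra.intro)
  show "subspace flag_space" by (auto simp: flag_space_def subspace_def)
  show "1 \<le> n" by (rule n)
  show "1 < real CARD('a)" using two_le_card_field[where 'a = 'a] by simp
  show "0 < real (\<rho> * CARD('a) ^ d)" using rho by simp
  show "linear (adj_op n)" by (rule linear_relation_operator)
  show "adj_op n v \<bullet> w = v \<bullet> adj_op n w" for v w by (rule symmetric_relation_operator[OF symp_adjacent])
  show "adj_op n v \<in> flag_space" for v by (rule adj_op_flag_space)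
  show "adj_op n (adj_op n v) = (real (\<rho> * CARD('a) ^ d) - 1) *\<^sub>R adj_op n v + real (\<rho> * CARD('a) ^ d) *\<^sub>R v" if "v \<in> flag_space" for v
    using adj_op_quadratic[of n v] n that by simp
  fix k assume k: "Suc k < n"
  have i: "1 \<le> n - 1 - k" "n - 1 - k \<le> n" "n - 1 - k < n" using k by auto
  show "linear (adj_op (n - 1 - k))" by (rule linear_relation_operator)
  show "adj_op (n - 1 - k) v \<bullet> w = v \<bullet> adj_op (n - 1 - k) w" for v w by (rule symmetric_relation_operator[OF symp_adjacent])
  show "adj_op (n - 1 - k) v \<in> flag_space" for v by (rule adj_op_flag_space)
  show "adj_op (n - 1 - k) (adj_op (n - 1 - k) v) = (real CARD('a) - 1) *\<^sub>R adj_op (n - 1 - k) v + real CARD('a) *\<^sub>R v"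
    if "v \<in> flag_space" for v
    using adj_op_quadratic[OF i(1,2) that] i(3) by simp
  show "adj_op (n - 1 - k) (adj_op (n - 1 - l) v) = adj_op (n - 1 - l) (adj_op (n - 1 - k) v)" if "Suc l < n" "Suc k < l" for l v
    using that by (intro adj_op_far) auto
  show "adj_op (n - 1 - k) (adj_op n v) = adj_op n (adj_op (n - 1 - k) v)" if "0 < k" for v
    using that k by (intro adj_op_far) auto
next
  fix k v assume k: "Suc (Suc k) < n"
  then have e: "n - 1 - k = Suc (n - 1 - Suc k)" by simp
  have "1 \<le> n - 1 - Suc k" "Suc (Suc (n - 1 - Suc k)) \<le> n" using k by auto
  from adj_op_braid_A2[OF this, of v]
  show "adj_op (n - 1 - k) (adj_op (n - 1 - Suc k) (adj_op (n - 1 - k) v)) = adj_op (n - 1 - Suc k) (adj_op (n - 1 - k) (adj_op (n - 1 - Suc k) v))"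
    unfolding e by (rule sym)
next
  fix v assume "Suc 0 < n"
  then show "adj_op n (adj_op (n - 1 - 0) (adj_op n (adj_op (n - 1 - 0) v))) = adj_op (n - 1 - 0) (adj_op n (adj_op (n - 1 - 0) (adj_op n v)))"
    using adj_op_braid_B2[of v] by simp
qed

end

section \<open>Opposition and the ratio bound\<close>

context ranked_polar_geometry begin

text \<open>A singular vector outside \<open>G\<close> and orthogonal to it would enlarge
  \<open>G\<close> beyond the rank.\<close>

lemma generator_maximal:
  assumes "singular_subspace G" "vec.dim G = n" "singular_subspace H" "H \<subseteq> perp G"
  shows "H \<subseteq> G"
proof (rule subsetI, rule ccontr)
  fix y assume y: "y \<in> H" "y \<notin> G"
  then have "vec.span (insert y G) \<in> covers G"
    using assms singular_subspaceD(2)[OF assms(3)] by (intro span_insert_in_covers) auto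
  then show False using rank_le[of "vec.span (insert y G)"] assms(2) by (simp add: covers_def)
qed

text \<open>For \<open>a = n - k\<close>, the flags in the support of \<open>J k\<close> applied to the flag \<open>X\<close>: the part \<open>Y a\<close>
  is opposite to \<open>X a\<close> in the residue of \<open>X (a - 1)\<close>, and the remaining parts of \<open>Y\<close> are the
  projections of those of \<open>X\<close>.\<close>

definition projects :: "nat \<Rightarrow> ('a ^ 'm) set set \<Rightarrow> ('a ^ 'm) set set \<Rightarrow> bool" where
  "projects a X Y \<longleftrightarrow> X \<in> flags \<and> Y \<in> flags \<and> (\<forall>j<a. part X j = part Y j) \<and>
     \<not> part Y a \<subseteq> perp (part X a) \<and> (\<forall>j. a \<le> j \<longrightarrow> j \<le> n \<longrightarrow> part Y j \<subseteq> vec.span (part Y a \<union> part X j))"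

lemma projects_n:
  assumes "adjacent n X Y"
  shows "projects n X Y"
proof -
  have F: "X \<in> flags" "Y \<in> flags" "\<And>j. j < n \<Longrightarrow> part X j = part Y j" "part X n \<noteq> part Y n"
    using assms by (simp_all add: adjacent_def agree_off_def)
  have "\<not> part Y n \<subseteq> perp (part X n)"
  proof
    assume "part Y n \<subseteq> perp (part X n)"
    then have "part Y n \<subseteq> part X n"
      by (rule generator_maximal[OF flag_part(2,3)[OF F(1) le_refl] flag_part(2)[OF F(2) le_refl]])
    then have "part Y n = part X n"
      by (rule subspace_eqI_dim[rotated 2]) (simp_all add: F flag_part(3,5))
    then show False using F(4) by simp
  qed
  then show ?thesis using F(1-3) by (auto simp: projects_def intro: vec.span_base)
qed

text \<open>With \<open>P = part X' a = part Y' a\<close>, the parts of type \<open>a + 1\<close> of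
  \<open>X\<close> and \<open>Y\<close> are spanned by \<open>P\<close> and the respective parts of
  type \<open>a\<close>. Orthogonality of the latter would thus make the former orthogonal, against
  the hypothesis on \<open>X'\<close> and \<open>Y'\<close>.\<close>

lemma projects_step:
  assumes a: "1 \<le> a" "Suc a \<le> n"
    and XX: "adjacent a X X'" and p: "projects (Suc a) X' Y'" and YY: "adjacent a Y' Y"
  shows "projects a X Y"
proof -
  have F: "X \<in> flags" "X' \<in> flags" "Y' \<in> flags" "Y \<in> flags"
    using XX YY by (simp_all add: adjacent_def agree_off_def)
  have eX: "part X j = part X' j" "part Y' j = part Y j" if "j \<le> n" "j \<noteq> a" for j
    using XX YY that by (simp_all add: adjacent_def agree_off_def)
  have nX: "part X a \<noteq> part X' a" "part Y a \<noteq> part Y' a" using XX YY by (simp_all add: adjacent_def not_sym)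
  have pj: "part X' j = part Y' j" if "j < Suc a" for j using p that by (simp add: projects_def)
  have a': "a \<le> n" "a \<le> Suc a" "Suc a \<noteq> a" using a by auto
  define P where "P = part X' a"
  have PY: "P = part Y' a" using pj[of a] by (simp add: P_def)
  have PX1: "P \<subseteq> part X (Suc a)" unfolding P_def eX(1)[OF a(2) a'(3)] by (rule flag_part(4)[OF F(2) a'(2) a(2)])
  have PY1: "P \<subseteq> part Y (Suc a)" unfolding PY eX(2)[OF a(2) a'(3), symmetric] by (rule flag_part(4)[OF F(3) a'(2) a(2)])
  have X1: "part X (Suc a) \<subseteq> vec.span (part X a \<union> P)"
    by (rule distinct_hyperplanes_span[OF flag_part(5)[OF F(1) a'(1)] _ flag_part(5)[OF F(1) a(2)] vec.subspace_span _
          flag_part(3)[OF F(1) a'(1)] _ flag_part(3)[OF F(1) a(2)] flag_part(4)[OF F(1) a'(2) a(2)] PX1])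
      (use nX(1) flag_part(3,5)[OF F(2) a'(1)] in \<open>auto simp: P_def intro: vec.span_base\<close>)
  have Y1: "part Y (Suc a) \<subseteq> vec.span (part Y a \<union> P)"
    by (rule distinct_hyperplanes_span[OF flag_part(5)[OF F(4) a'(1)] _ flag_part(5)[OF F(4) a(2)] vec.subspace_span _
          flag_part(3)[OF F(4) a'(1)] _ flag_part(3)[OF F(4) a(2)] flag_part(4)[OF F(4) a'(2) a(2)] PY1])
      (use nX(2) flag_part(3,5)[OF F(3) a'(1)] in \<open>auto simp: PY intro: vec.span_base\<close>)
  have "\<not> part Y a \<subseteq> perp (part X a)"
  proof
    assume h: "part Y a \<subseteq> perp (part X a)"
    have sX: "part X (Suc a) \<subseteq> perp (part X (Suc a))" and sY: "part Y (Suc a) \<subseteq> perp (part Y (Suc a))"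
      using flag_part(2)[OF F(1) a(2)] flag_part(2)[OF F(4) a(2)] by (simp_all add: singular_subspaceD(4))
    have Xa: "part X a \<subseteq> part X (Suc a)" and Ya: "part Y a \<subseteq> part Y (Suc a)"
      using flag_part(4)[OF F(1) a'(2) a(2)] flag_part(4)[OF F(4) a'(2) a(2)] by auto
    have "part Y a \<union> P \<subseteq> perp (part X a \<union> P)"
      using h sX sY Xa Ya PX1 PY1 unfolding perp_def by blast
    then have "vec.span (part Y a \<union> P) \<subseteq> perp (vec.span (part X a \<union> P))"
      unfolding perp_span by (intro vec.span_minimal subspace_perp)
    then have "part Y (Suc a) \<subseteq> perp (part X (Suc a))" using X1 Y1 perp_mono[OF X1] by blast
    then have "part Y' (Suc a) \<subseteq> perp (part X' (Suc a))" using eX[OF a(2) a'(3)] by simp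
    then show False using p by (simp add: projects_def)
  qed
  moreover have "part Y j \<subseteq> vec.span (part Y a \<union> part X j)" if j: "a \<le> j" "j \<le> n" for j
  proof (cases "j = a")
    case True then show ?thesis by (auto intro: vec.span_base)
  next
    case False
    then have j': "Suc a \<le> j" using j by simp
    have "part Y' j \<subseteq> vec.span (part Y' (Suc a) \<union> part X' j)" using p j j' by (simp add: projects_def)
    then have 1: "part Y j \<subseteq> vec.span (part Y (Suc a) \<union> part X j)"
      using eX[OF j(2) False] eX[OF a(2) a'(3)] by simp
    have "P \<subseteq> part X j" using PX1 flag_part(4)[OF F(1) j' j(2)] by blast
    then have "vec.span (part Y a \<union> P) \<subseteq> vec.span (part Y a \<union> part X j)" by (intro vec.span_mono) blast
    then have "part Y (Suc a) \<union> part X j \<subseteq> vec.span (part Y a \<union> part X j)"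
      using Y1 vec.span_superset[of "part Y a \<union> part X j"] by blast
    then have "vec.span (part Y (Suc a) \<union> part X j) \<subseteq> vec.span (part Y a \<union> part X j)"
      by (intro vec.span_minimal vec.subspace_span)
    then show ?thesis using 1 by blast
  qed
  moreover have "part X j = part Y j" if "j < a" for j
    using eX[of j] pj[of j] that a by simp
  ultimately show ?thesis using F by (simp add: projects_def)
qed

text \<open>Opposition in the residue of the common part of type \<open>a\<close>; for
  \<open>a = 0\<close> it becomes opposition of flags.\<close>

definition opposite_above :: "nat \<Rightarrow> ('a ^ 'm) set set \<Rightarrow> ('a ^ 'm) set set \<Rightarrow> bool" where
  "opposite_above a X Y \<longleftrightarrow> X \<in> flags \<and> Y \<in> flags \<and> (\<forall>j\<le>a. part X j = part Y j) \<and>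
     (\<forall>j. a < j \<longrightarrow> j \<le> n \<longrightarrow> perp (part X j) \<inter> part Y j \<subseteq> part X a)"

text \<open>A vector of \<open>part Y j\<close> orthogonal to \<open>part X j\<close> is also
  orthogonal to \<open>part Z (a + 1)\<close>, which lies in \<open>part Y j\<close>, and hence to
  \<open>part Z j\<close> by the projection property. So it lies in \<open>part Z (a + 1)\<close>,
  where exactly \<open>part X a\<close> is orthogonal to \<open>part X (a + 1)\<close>.\<close>

lemma opposite_above_step:
  assumes b: "Suc a \<le> n" and p: "projects (Suc a) X Z" and o: "opposite_above (Suc a) Z Y"
  shows "opposite_above a X Y"
proof -
  have F: "X \<in> flags" "Z \<in> flags" "Y \<in> flags" using p o by (simp_all add: projects_def opposite_above_def)
  have XZ: "part X j = part Z j" if "j \<le> a" for j using p that by (simp add: projects_def)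
  have ZY: "part Z j = part Y j" if "j \<le> Suc a" for j using o that by (simp add: opposite_above_def)
  have a': "a \<le> n" "a \<le> Suc a" using b by auto
  have hyper: "perp (part X (Suc a)) \<inter> part Z (Suc a) = part X a"
  proof (rule sym, rule subspace_eqI_dim)
    show s: "vec.subspace (perp (part X (Suc a)) \<inter> part Z (Suc a))"
      by (intro vec.subspace_inter subspace_perp flag_part(5)[OF F(2) b])
    show "vec.subspace (part X a)" by (rule flag_part(5)[OF F(1) a'(1)])
    have "part X a \<subseteq> part X (Suc a)" by (rule flag_part(4)[OF F(1) a'(2) b])
    moreover have "part X (Suc a) \<subseteq> perp (part X (Suc a))"
      by (rule singular_subspaceD(4)[OF flag_part(2)[OF F(1) b]])
    moreover have "part X a \<subseteq> part Z (Suc a)" unfolding XZ[OF le_refl] by (rule flag_part(4)[OF F(2) a'(2) b])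
    ultimately show "part X a \<subseteq> perp (part X (Suc a)) \<inter> part Z (Suc a)" by blast
    show "vec.dim (perp (part X (Suc a)) \<inter> part Z (Suc a)) \<le> vec.dim (part X a)"
    proof (rule ccontr)
      assume "\<not> ?thesis"
      then have "vec.dim (part Z (Suc a)) \<le> vec.dim (perp (part X (Suc a)) \<inter> part Z (Suc a))"
        using flag_part(3)[OF F(1) a'(1)] flag_part(3)[OF F(2) b] by simp
      then have "perp (part X (Suc a)) \<inter> part Z (Suc a) = part Z (Suc a)"
        by (intro subspace_eqI_dim s flag_part(5)[OF F(2) b]) auto
      then show False using p by (auto simp: projects_def)
    qed
  qed
  have "perp (part X j) \<inter> part Y j \<subseteq> part X a" if j: "a < j" "j \<le> n" for j
  proof
    fix y assume y: "y \<in> perp (part X j) \<inter> part Y j"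
    have j': "Suc a \<le> j" using j by simp
    have ZYj: "part Z (Suc a) \<subseteq> part Y j" unfolding ZY[OF le_refl] by (rule flag_part(4)[OF F(3) j' j(2)])
    then have "y \<in> perp (part Z (Suc a))"
      using y singular_subspaceD(4)[OF flag_part(2)[OF F(3) j(2)]] perp_mono by blast
    then have "y \<in> perp (part Z (Suc a) \<union> part X j)" using y by (auto simp: perp_def)
    then have "y \<in> perp (vec.span (part Z (Suc a) \<union> part X j))" by (simp add: perp_span)
    moreover have "part Z j \<subseteq> vec.span (part Z (Suc a) \<union> part X j)" using p j j' by (simp add: projects_def)
    ultimately have yZ: "y \<in> perp (part Z j)" using perp_mono by blast
    have "y \<in> part Z (Suc a)"
    proof (cases "j = Suc a")
      case True then show ?thesis using y ZY[of j] by simp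
    next
      case False
      then have "Suc a < j" using j' by simp
      then have "perp (part Z j) \<inter> part Y j \<subseteq> part Z (Suc a)"
        using o[unfolded opposite_above_def, THEN conjunct2, THEN conjunct2, THEN conjunct2] j(2) by blast
      then show ?thesis using y yZ by blast
    qed
    moreover have "y \<in> perp (part X (Suc a))"
      using y perp_mono[OF flag_part(4)[OF F(1) j' j(2)]] by blast
    ultimately show "y \<in> part X a" using hyper by blast
  qed
  then show ?thesis using F XZ ZY by (simp add: opposite_above_def)
qed

section \<open>Geometric opposition and Hoffman's ratio bound\<close>

definition opposite_flags :: "('a ^ 'm) set set \<Rightarrow> ('a ^ 'm) set set \<Rightarrow> bool" where
  "opposite_flags X Y \<longleftrightarrow> X \<in> flags \<and> Y \<in> flags \<and> (\<forall>i\<in>{1..n}. perp (part X i) \<inter> part Y i = {0})"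

text \<open>The rows of \<open>A\<close> are supported on opposite flags, so its quadratic form
  vanishes at the indicator vector \<open>v\<close> of \<open>C\<close>, while the all-one vector
  \<open>u\<close> of the flags is an eigenvector for the row sum. The least eigenvalue bound at a
  combination of both gives the inequality.\<close>

theorem hoffman_bound:
  assumes n: "1 \<le> n" and rho: "\<rho> > 0" and C: "C \<subseteq> flags"
    and ekr: "\<And>X Y. X \<in> C \<Longrightarrow> Y \<in> C \<Longrightarrow> \<not> opposite_flags X Y"
  defines "q \<equiv> real CARD('a)" and "Q \<equiv> real (\<rho> * CARD('a) ^ d)"
  assumes c: "c \<ge> 0" and bd: "\<And>k. k \<le> n \<Longrightarrow> odd k \<Longrightarrow>
      q ^ ((n choose 2) + ((n - k) choose 2) + (k choose 2)) * Q ^ (n - k) \<le> c"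
  shows "real (card C) * (q ^ (2 * (n choose 2)) * Q ^ n + c) \<le> c * real (card flags)"
proof -
  interpret H: hecke_algebra flag_space n q Q "adj_op n" "\<lambda>k. adj_op (n - Suc k)"
    using hecke_flags[OF n rho] by (simp add: q_def Q_def)
  have J_support: "\<exists>Y. v $ Y \<noteq> 0 \<and> projects (n - k) X Y" if "k < n" "H.J k v $ X \<noteq> 0" for k v X
    using that
  proof (induction k arbitrary: v X)
    case 0
    then have "adj_op n v $ X \<noteq> 0" by simp
    then obtain Y where "adjacent n X Y" "v $ Y \<noteq> 0" by (rule relation_operator_support)
    then show ?case using projects_n by auto
  next
    case (Suc k)
    let ?a = "n - Suc k"
    have a: "1 \<le> ?a" "Suc ?a \<le> n" "n - k = Suc ?a" using Suc.prems(1) by auto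
    have "adj_op ?a (H.J k (adj_op ?a v)) $ X \<noteq> 0" using Suc.prems(2) by simp
    then obtain X' where X': "adjacent ?a X X'" "H.J k (adj_op ?a v) $ X' \<noteq> 0" by (rule relation_operator_support)
    then obtain Y' where Y': "adj_op ?a v $ Y' \<noteq> 0" "projects (Suc ?a) X' Y'" using Suc.IH[of "adj_op ?a v" X'] Suc.prems(1) a(3) by auto
    obtain Y where Y: "adjacent ?a Y' Y" "v $ Y \<noteq> 0" using Y'(1) by (rule relation_operator_support)
    show ?case using projects_step[OF a(1,2) X'(1) Y'(2) Y(1)] Y(2) by blast
  qed
  \<comment> \<open>\<open>A k\<close> involves the nodes of type greater than \<open>n - k\<close>,
    so flags joined by it agree up to type \<open>n - k\<close>.\<close>
  have A_support: "\<exists>Y. v $ Y \<noteq> 0 \<and> opposite_above (n - k) X Y"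
    if "k \<le> n" "H.A k v $ X \<noteq> 0" "v \<in> flag_space" for k v X
    using that
  proof (induction k arbitrary: X)
    case 0
    then have "X \<in> flags" by (auto simp: flag_space_def)
    then show ?case using 0 by (intro exI[of _ X]) (simp add: opposite_above_def)
  next
    case (Suc k)
    let ?a = "n - Suc k"
    have a: "Suc ?a \<le> n" "n - k = Suc ?a" using Suc.prems(1) by auto
    have "H.J k (H.A k v) $ X \<noteq> 0" using Suc.prems(2) by simp
    then obtain Z where Z: "H.A k v $ Z \<noteq> 0" "projects (Suc ?a) X Z" using J_support[of k "H.A k v" X] Suc.prems(1) a(2) by auto
    then obtain Y where "v $ Y \<noteq> 0" "opposite_above (Suc ?a) Z Y" using Suc.IH[of Z] Suc.prems a(2) by auto
    then show ?case using opposite_above_step[OF a(1) Z(2)] by blast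
  qed
  define u :: "real ^ (('a ^ 'm) set set)" where "u = (\<chi> X. if X \<in> flags then 1 else 0)"
  define v :: "real ^ (('a ^ 'm) set set)" where "v = (\<chi> X. if X \<in> C then 1 else 0)"
  let ?N = "real (card flags)" and ?c = "real (card C)" and ?D = "q ^ (2 * (n choose 2)) * Q ^ n"
  have uS: "u \<in> flag_space" and vS: "v \<in> flag_space" using C by (auto simp: flag_space_def u_def v_def)
  have adj_op_u: "adj_op i u = (if i < n then q else Q) *\<^sub>R u" if i: "1 \<le> i" "i \<le> n" for i
  proof -
    have "(\<Sum>Y | adjacent i X Y. u $ Y) = (if i < n then q else Q) * u $ X" for X
    proof (cases "X \<in> flags")
      case True
      have "(\<Sum>Y | adjacent i X Y. u $ Y) = (\<Sum>Y | adjacent i X Y. 1)"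
        by (intro sum.cong) (auto simp: u_def adjacent_def agree_off_def)
      then show ?thesis using True card_adjacent[OF True i] by (simp add: u_def q_def Q_def)
    next
      case False
      then have "{Y. adjacent i X Y} = {}" by (auto simp: adjacent_def agree_off_def)
      then show ?thesis using False by (simp add: u_def)
    qed
    then show ?thesis by (simp add: vec_eq_iff relation_operator_nth)
  qed
  have J_u: "H.J k u = (q ^ (2 * k) * Q) *\<^sub>R u" if "k < n" for k
    using that
  proof (induction k)
    case 0
    then show ?case using adj_op_u[of n] n by simp
  next
    case (Suc k)
    have Tu: "adj_op (n - Suc k) u = q *\<^sub>R u" using adj_op_u[of "n - Suc k"] Suc.prems by auto
    then have "H.J (Suc k) u = adj_op (n - Suc k) (H.J k (q *\<^sub>R u))" by simp
    also have "H.J k (q *\<^sub>R u) = (q * (q ^ (2 * k) * Q)) *\<^sub>R u"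
      using Suc linear_scale[OF H.lin_J[of k]] by simp
    also have "adj_op (n - Suc k) \<dots> = (q * (q ^ (2 * k) * Q) * q) *\<^sub>R u"
      unfolding linear_scale[OF linear_relation_operator] Tu by simp
    finally show ?case by (simp add: mult_ac)
  qed
  have A_u: "H.A k u = (q ^ (2 * (k choose 2)) * Q ^ k) *\<^sub>R u" if "k \<le> n" for k
    using that
  proof (induction k)
    case 0 then show ?case by (simp add: numeral_2_eq_2)
  next
    case (Suc k)
    then show ?case using J_u[of k] linear_scale[OF H.lin_J[of k]]
      by (simp add: H.choose2_Suc power_add mult_ac)
  qed
  have uu: "u \<bullet> u = ?N" and vv: "v \<bullet> v = ?c" and uv: "u \<bullet> v = ?c"
    using C by (auto simp: inner_vec_def u_def v_def sum.If_cases if_distrib[of "\<lambda>x. x * _"] Int_absorb1 cong: if_cong)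
  have v_C: "v $ X \<noteq> 0 \<longleftrightarrow> X \<in> C" for X by (simp add: v_def)
  have vAv: "v \<bullet> H.A n v = 0"
  proof -
    have "v $ X * H.A n v $ X = 0" for X
    proof (rule ccontr)
      assume h: "v $ X * H.A n v $ X \<noteq> 0"
      then have "v $ X \<noteq> 0" "H.A n v $ X \<noteq> 0" by auto
      then have X: "X \<in> C" "H.A n v $ X \<noteq> 0" by (auto simp: v_C)
      then obtain Y where Y: "v $ Y \<noteq> 0" "opposite_above 0 X Y" using A_support[OF le_refl _ vS] by auto
      have "Y \<in> C" using Y(1) by (simp add: v_C)
      moreover have "opposite_flags X Y"
        unfolding opposite_flags_def
      proof (intro conjI ballI)
        show F: "X \<in> flags" "Y \<in> flags" using Y(2) by (auto simp: opposite_above_def)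
        fix i assume i: "i \<in> {1..n}"
        then have "perp (part X i) \<inter> part Y i \<subseteq> {0}" using Y(2) by (simp add: opposite_above_def)
        moreover have "0 \<in> perp (part X i) \<inter> part Y i"
          using i flag_part(5)[OF F(2), of i] subspace_perp by (auto simp: vec.subspace_0)
        ultimately show "perp (part X i) \<inter> part Y i = {0}" by blast
      qed
      ultimately show False using ekr X(1) by blast
    qed
    then show ?thesis unfolding inner_vec_def inner_real_def by (intro sum.neutral ballI)
  qed
  have uAu: "u \<bullet> H.A n u = ?D * ?N" and vAu: "v \<bullet> H.A n u = ?D * ?c"
    using A_u[OF le_refl] uu uv by (simp_all add: inner_commute)
  have uAv: "u \<bullet> H.A n v = ?D * ?c"
    using H.sym_A[OF le_refl, of u v] vAu by (simp add: inner_commute)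
  \<comment> \<open>Up to the factor \<open>?N\<close>, the component of \<open>v\<close> orthogonal
    to \<open>u\<close>; the scaling avoids a division by the number of flags.\<close>
  define w where "w = ?N *\<^sub>R v - ?c *\<^sub>R u"
  have wS: "w \<in> flag_space" unfolding w_def using uS vS H.S by (intro subspace_diff subspace_scale)
  interpret A: linear "H.A n" by (rule H.lin_A[OF le_refl])
  have ww: "w \<bullet> w = ?N * ?c * (?N - ?c)"
    unfolding w_def by (simp add: inner_diff uu vv uv inner_commute algebra_simps)
  have wAw: "w \<bullet> H.A n w = - (?N * ?c * (?c * ?D))"
    unfolding w_def by (simp add: A.diff A.scale inner_diff uAu uAv vAu vAv algebra_simps)
  have least: "- c * (w \<bullet> w) \<le> w \<bullet> H.A n w"
    by (rule H.least_eigenvalue[OF c bd wS])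
  show ?thesis
  proof (cases "card C = 0")
    case True then show ?thesis using c by simp
  next
    case False
    then have "?c > 0" by (simp only: of_nat_0_less_iff neq0_conv)
    moreover have "card C \<le> card flags" using C by (intro card_mono) auto
    ultimately have pos: "?N * ?c > 0" by (simp add: order.strict_trans2)
    have "(?N * ?c) * (?c * ?D) \<le> (?N * ?c) * (c * (?N - ?c))"
      using least unfolding ww wAw by (simp add: algebra_simps)
    then have "?c * ?D \<le> c * (?N - ?c)" using pos by (simp only: mult_le_cancel_left_pos)
    then show ?thesis by (simp add: algebra_simps)
  qed
qed

section \<open>The number of flags\<close>

primrec cover_chains :: "nat \<Rightarrow> ('a ^ 'm) set \<Rightarrow> ('a ^ 'm) set list set" where
  "cover_chains 0 U = {[]}"
| "cover_chains (Suc k) U = (\<Union>W\<in>covers U. (#) W ` cover_chains k W)"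

lemma finite_cover_chains: "finite (cover_chains k U)"
  by (induction k arbitrary: U) auto

lemma card_cover_chains:
  "singular_subspace U \<Longrightarrow> vec.dim U + k = n \<Longrightarrow> card (cover_chains k U) = (\<Prod>i<k. num_covers (Suc i))"
proof (induction k arbitrary: U)
  case 0 then show ?case by simp
next
  case (Suc k)
  have "card (cover_chains (Suc k) U) = (\<Sum>W\<in>covers U. card ((#) W ` cover_chains k W))"
    unfolding cover_chains.simps by (intro card_UN_disjoint) (auto simp: finite_cover_chains)
  also have "\<dots> = (\<Sum>W\<in>covers U. \<Prod>i<k. num_covers (Suc i))"
    using Suc by (intro sum.cong) (auto simp: card_image covers_def)
  also have "\<dots> = num_covers (Suc k) * (\<Prod>i<k. num_covers (Suc i))"
    using card_covers[OF Suc.prems] by simp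
  finally show ?case by (simp add: mult.commute)
qed

lemma cover_chains_iff:
  "l \<in> cover_chains k U \<longleftrightarrow> length l = k \<and> (\<forall>j<k. l ! j \<in> covers ((U # l) ! j))"
proof (induction k arbitrary: U l)
  case 0 then show ?case by simp
next
  case (Suc k)
  show ?case
  proof (cases l)
    case Nil then show ?thesis by auto
  next
    case (Cons W l')
    have "l \<in> cover_chains (Suc k) U \<longleftrightarrow> W \<in> covers U \<and> l' \<in> cover_chains k W" using Cons by auto
    also have "\<dots> \<longleftrightarrow> length l = Suc k \<and> (\<forall>j<Suc k. l ! j \<in> covers ((U # l) ! j))"
      unfolding Suc using Cons by (auto simp: All_less_Suc2)
    finally show ?thesis .
  qed
qed

text \<open>Listing its parts turns a flag into a chain of covers starting at \<open>{0}\<close>,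
  and such lists can be counted recursively.\<close>

lemma card_flags: "card flags = (\<Prod>i<n. num_covers (Suc i))"
proof -
  let ?g = "\<lambda>X. map (part X) [1..<Suc n]"
  have nth: "?g X ! j = part X (Suc j)" "({0} # ?g X) ! j = part X j" if "j < n" for X j
    using that by (simp_all add: nth_Cons' del: upt_Suc)
  have "bij_betw ?g flags (cover_chains n {0})"
  proof (rule bij_betw_imageI)
    show "inj_on ?g flags"
    proof (rule inj_onI)
      fix X Y assume F: "X \<in> flags" "Y \<in> flags" and e: "?g X = ?g Y"
      show "X = Y"
      proof (rule flag_eqI[OF F])
        fix i assume i: "i \<le> n"
        show "part X i = part Y i"
        proof (cases i)
          case (Suc j)
          then have j: "j < n" using i by simp
          have "part X (Suc j) = part Y (Suc j)" unfolding nth(1)[OF j, symmetric] e ..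
          then show ?thesis using Suc by simp
        qed simp
      qed
    qed
    show "?g ` flags = cover_chains n {0}"
    proof (intro equalityI subsetI)
      fix l assume "l \<in> ?g ` flags"
      then obtain X where X: "X \<in> flags" "l = ?g X" by blast
      have "part X (Suc j) \<in> covers (part X j)" if "j < n" for j
        using that flag_part(2-4)[OF X(1), of "Suc j"] flag_part(3)[OF X(1), of j] flag_part(4)[OF X(1), of j "Suc j"]
        by (simp add: covers_def)
      then show "l \<in> cover_chains n {0}" unfolding X(2) cover_chains_iff using nth by (simp del: upt_Suc)
    next
      fix l assume l: "l \<in> cover_chains n {0}"
      define V where "V i = ({0} # l) ! i" for i
      have len: "length l = n" and cov: "\<And>j. j < n \<Longrightarrow> V (Suc j) \<in> covers (V j)"
        using l by (auto simp: cover_chains_iff V_def)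
      have V: "singular_subspace (V i) \<and> vec.dim (V i) = i" if "i \<le> n" for i
        using that
      proof (induction i)
        case 0
        have "vec.dim ({0} :: ('a ^ 'm) set) = 0" by (rule dim_eqI_card) (simp_all add: vec.subspace_single_0)
        then show ?case by (simp add: V_def singular_subspace_0)
      next
        case (Suc i)
        then show ?case using cov[of i] by (simp add: covers_def)
      qed
      have "V i \<subseteq> V (Suc i)" if "i < n" for i using cov[OF that] by (simp add: covers_def)
      then have F: "V ` {1..n} \<in> flags" using V unfolding flags_def by (intro CollectI exI[of _ V]) auto
      have p: "part (V ` {1..n}) i = V i" if "i \<in> {1..n}" for i
        using that V by (intro part_image) auto
      have "?g (V ` {1..n}) = l"
        by (rule nth_equalityI) (use len p nth(1) in \<open>auto simp: V_def simp del: upt_Suc\<close>)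
      then show "l \<in> ?g ` flags" using F by blast
    qed
  qed
  then have "card flags = card (cover_chains n {0})" by (rule bij_betw_same_card)
  moreover have "vec.dim ({0} :: ('a ^ 'm) set) = 0" by (rule dim_eqI_card) (simp_all add: vec.subspace_single_0)
  ultimately show ?thesis using card_cover_chains[OF singular_subspace_0, of n] by simp
qed

lemma num_covers_eq:
  defines "q \<equiv> real CARD('a)" and "Q \<equiv> real (\<rho> * CARD('a) ^ d)"
  shows "real (num_covers (Suc k)) = (q ^ Suc k - 1) / (q - 1) * (q ^ k * Q + 1)"
proof -
  have q: "q > 1" using two_le_card_field[where 'a = 'a] by (simp add: q_def)
  have step: "real (num_covers (Suc k)) = 1 + q * real (num_covers k) + Q * q ^ (2 * k)" for k
    by (simp add: q_def Q_def)
  \<comment> \<open>Multiplied by \<open>q\<close>, because the closed form contains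
    \<open>q ^ (k - 1) * Q + 1\<close>, whose exponent would be negative at
    \<open>k = 0\<close>.\<close>
  have ind: "(q - 1) * (q * real (num_covers k)) = (q ^ k - 1) * (q ^ k * Q + q)" for k
  proof (induction k)
    case 0 then show ?case by simp
  next
    case (Suc k)
    have "(q - 1) * (q * real (num_covers (Suc k)))
        = q * ((q - 1) + (q - 1) * (q * real (num_covers k)) + (q - 1) * (Q * q ^ (2 * k)))"
      unfolding step by (simp add: algebra_simps)
    also have "\<dots> = (q ^ Suc k - 1) * (q ^ Suc k * Q + q)"
      unfolding Suc power_even_eq power2_eq_square by (simp add: algebra_simps)
    finally show ?case .
  qed
  have "q * ((q - 1) * real (num_covers (Suc k))) = q * ((q ^ Suc k - 1) * (q ^ k * Q + 1))"
    using ind[of "Suc k"] by (simp add: algebra_simps)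
  then have "(q - 1) * real (num_covers (Suc k)) = (q ^ Suc k - 1) * (q ^ k * Q + 1)" using q by simp
  then show ?thesis using q by (simp add: field_simps)
qed

end

section \<open>The classical forms\<close>

lemma prime_CHAR_finite_field: "prime CHAR('a::{field,finite})"
proof -
  have "CHAR('a) > 0" by (rule finite_imp_CHAR_pos) simp
  then show ?thesis by (rule prime_CHAR_semidom)
qed

text \<open>An additive subgroup that is not the whole field can be enlarged by a factor \<open>CHAR('a)\<close>.\<close>

lemma card_finite_field: "\<exists>k. CARD('a::{field,finite}) = CHAR('a) ^ k"
proof -
  let ?p = "CHAR('a)"
  have p: "prime ?p" by (rule prime_CHAR_finite_field)
  have p0: "of_int (int ?p) = (0 :: 'a)" by simp
  define sub where "sub H \<longleftrightarrow> 0 \<in> H \<and> (\<forall>x\<in>H. \<forall>y\<in>H. x - y \<in> H)" for H :: "'a set"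
  have enlarge: "\<exists>H'. sub H' \<and> card H' = ?p * card H" if H: "sub H" and x: "x \<notin> H" for H x
  proof -
    have neg: "- h \<in> H" if "h \<in> H" for h using H that unfolding sub_def by (metis diff_0)
    have add: "h + h' \<in> H" if "h \<in> H" "h' \<in> H" for h h'
      using H that neg[of h'] unfolding sub_def by (metis diff_minus_eq_add)
    have nat_mult: "of_nat i * h \<in> H" if "h \<in> H" for i h
      using H that add by (induction i) (auto simp: sub_def algebra_simps)
    have int_mult: "of_int i * h \<in> H" if "h \<in> H" for i h
      using nat_mult[OF that] neg by (cases i rule: int_cases2) auto
    \<comment> \<open>Bezout: if the subgroup contained a multiple of \<open>x\<close> by an integer
      prime to the characteristic, it would contain \<open>x\<close>.\<close>
    have notin: "of_int j * x \<notin> H" if j: "\<not> int ?p dvd j" for j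
    proof
      assume "of_int j * x \<in> H"
      have "coprime (int ?p) j" using p j by (simp add: prime_imp_coprime)
      then obtain u v where uv: "u * j + v * int ?p = 1"
        using bezout_int[of j "int ?p"] by (auto simp: coprime_commute coprime_iff_gcd_eq_1)
      have "of_int (u * j + v * int ?p) = (1 :: 'a)" unfolding uv by simp
      then have "of_int u * of_int j = (1 :: 'a)" by simp
      then have "x = of_int u * (of_int j * x)" by (metis mult.assoc mult_1)
      then show False using int_mult[OF \<open>of_int j * x \<in> H\<close>] x by metis
    qed
    define H' where "H' = (\<lambda>(h, i). h + of_int i * x) ` (H \<times> {0..<int ?p})"
    have H'eq: "H' = {h + of_int i * x | h i. h \<in> H}"
    proof (intro equalityI subsetI)
      fix z assume "z \<in> {h + of_int i * x | h i. h \<in> H}"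
      then obtain h i where z: "z = h + of_int i * x" "h \<in> H" by blast
      have "of_int i = (of_int (i mod int ?p) :: 'a)"
        using arg_cong[OF mult_div_mod_eq[of "int ?p" i], of "of_int :: int \<Rightarrow> 'a"] by (simp only: of_int_add of_int_mult p0) simp
      then have "z = (\<lambda>(h, i). h + of_int i * x) (h, i mod int ?p)" using z by simp
      moreover have "(h, i mod int ?p) \<in> H \<times> {0..<int ?p}" using z p prime_gt_0_nat by simp
      ultimately show "z \<in> H'" unfolding H'_def by blast
    qed (auto simp: H'_def)
    have "sub H'"
    proof -
      have "(h + of_int i * x) - (h' + of_int i' * x) \<in> H'" if "h \<in> H" "h' \<in> H" for h h' i i'
        unfolding H'eq using that H
        by (intro CollectI exI[of _ "h - h'"] exI[of _ "i - i'"]) (auto simp: sub_def algebra_simps)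
      moreover have "0 \<in> H'"
        unfolding H'eq using H by (intro CollectI exI[of _ 0]) (auto simp: sub_def)
      ultimately show ?thesis unfolding sub_def H'eq by blast
    qed
    moreover have "card H' = ?p * card H"
    proof -
      have "inj_on (\<lambda>(h, i). h + of_int i * x) (H \<times> {0..<int ?p})"
      proof (rule inj_onI, clarify)
        fix h i h' i' assume a: "h \<in> H" "h' \<in> H" "i \<in> {0..<int ?p}" "i' \<in> {0..<int ?p}"
          and e: "h + of_int i * x = h' + of_int i' * x"
        have "of_int (i - i') * x = h' - h" using e by (simp add: algebra_simps)
        moreover have "h' - h \<in> H" using H a by (simp add: sub_def)
        ultimately have "int ?p dvd i - i'" using notin[of "i - i'"] by metis
        then have "i = i'" using a zdvd_not_zless[of "i - i'" "int ?p"] zdvd_not_zless[of "i' - i" "int ?p"]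
          by (cases i i' rule: linorder_cases) (auto simp: dvd_diff_commute)
        then show "h = h' \<and> i = i'" using e by simp
      qed
      from card_image[OF this] show ?thesis unfolding H'_def by (simp add: card_cartesian_product)
    qed
    ultimately show ?thesis by blast
  qed
  have "\<exists>k. CARD('a) = ?p ^ k" if "sub H" "card H = ?p ^ k" for H k
    using that
  proof (induction "CARD('a) - card H" arbitrary: H k rule: less_induct)
    case less
    show ?case
    proof (cases "H = UNIV")
      case True then show ?thesis using less by blast
    next
      case False
      then obtain x where "x \<notin> H" by blast
      then obtain H' where H': "sub H'" "card H' = ?p * card H" using enlarge less by blast
      have "card H < CARD('a)" using False by (metis UNIV_I finite psubset_card_mono subset_UNIV psubsetI)
      moreover have "card H' > card H" using H' less p prime_gt_1_nat[OF p] by simp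
      ultimately have "CARD('a) - card H' < CARD('a) - card H" by linarith
      from less.hyps[OF this H'(1), of "Suc k"] show ?thesis using H' less by simp
    qed
  qed
  from this[of "{0}" 0] show ?thesis by (simp add: sub_def)
qed

text \<open>Multiplication by a nonzero \<open>x\<close> permutes the nonzero elements; comparing
  their product before and after gives \<open>x ^ (q - 1) = 1\<close>.\<close>

lemma finite_field_power_card:
  fixes x :: "'a::{field,finite}"
  shows "x ^ CARD('a) = x"
proof (cases "x = 0")
  case True then show ?thesis by simp
next
  case False
  let ?P = "\<Prod>(UNIV - {0 :: 'a})"
  have "bij_betw ((*) x) (UNIV - {0}) (UNIV - {0})"
    by (rule bij_betwI[where g = "\<lambda>y. y / x"]) (use False in auto)
  then have "?P = (\<Prod>y\<in>UNIV - {0}. x * y)" by (rule prod.reindex_bij_betw[symmetric])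
  also have "\<dots> = x ^ (CARD('a) - 1) * ?P" by (simp add: prod.distrib card_Diff_singleton)
  finally have "x ^ (CARD('a) - 1) = 1" by simp
  then have "x * x ^ (CARD('a) - 1) = x" by simp
  moreover have "Suc (CARD('a) - 1) = CARD('a)" using two_le_card_field[where 'a = 'a] by simp
  ultimately show ?thesis by (metis power_Suc)
qed

section \<open>The involution of a field of square order\<close>

context
  fixes r :: nat
  assumes r: "r ^ 2 = CARD('a::{field,finite})"
begin

lemma sqrt_card_ge_2: "r \<ge> 2"
proof (rule ccontr)
  assume "\<not> ?thesis"
  then have "r = 0 \<or> r = 1" by auto
  then show False using r two_le_card_field[where 'a = 'a] by auto
qed

text \<open>As a divisor of the prime power \<open>CARD('a)\<close>, the number \<open>r\<close> is
  a power of the characteristic.\<close>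

lemma frobenius_add: "((x :: 'a) + y) ^ r = x ^ r + y ^ r"
proof -
  obtain k where "CARD('a) = CHAR('a) ^ k" using card_finite_field by blast
  then have "r dvd CHAR('a) ^ k" using r by (metis dvd_triv_left power2_eq_square)
  then obtain j where "r = CHAR('a) ^ j" using prime_CHAR_finite_field divides_primepow_nat by blast
  then show ?thesis using freshmans_dream'[OF prime_CHAR_finite_field] by blast
qed

lemma frobenius_frobenius: "((x :: 'a) ^ r) ^ r = x"
  using finite_field_power_card[of x] r by (simp add: power_mult[symmetric] power2_eq_square)

text \<open>The trace maps the \<open>r * r\<close> field elements into the fixed elements of the
  involution. There are at most \<open>r\<close> of these, and at most \<open>r\<close> elements in
  each fibre, being roots of polynomials of degree \<open>r\<close>; so both estimates are
  tight.\<close>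

lemma card_trace_fibre:
  fixes c :: 'a
  assumes c: "c ^ r = c"
  shows "card {s :: 'a. s + s ^ r = c} = r"
proof -
  note r2 = sqrt_card_ge_2
  have roots: "card {s :: 'a. s ^ r + a * s + b = 0} \<le> r" for a b
  proof -
    define P where "P = monom 1 r + [:b, a:]"
    have "coeff P r = 1"
    proof -
      have "degree [:b, a:] < r" using r2 by (simp add: le_less_trans[OF degree_pCons_le])
      then show ?thesis by (simp add: P_def coeff_eq_0)
    qed
    then have "P \<noteq> 0" by auto
    moreover have "degree P \<le> r" unfolding P_def using r2
      by (intro degree_add_le degree_monom_le) (simp add: le_trans[OF degree_pCons_le])
    moreover have "{s. poly P s = 0} = {s. s ^ r + a * s + b = 0}"
      by (simp add: P_def poly_monom algebra_simps)
    ultimately show ?thesis using card_poly_roots_bound[of P] by simp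
  qed
  let ?t = "\<lambda>s :: 'a. s + s ^ r" and ?I = "range (\<lambda>s :: 'a. s + s ^ r)" and ?F = "{c :: 'a. c ^ r = c}"
  have fib: "card {s. ?t s = c} \<le> r" for c
    using roots[of 1 "- c"] by (simp add: add.commute)
  have F: "card ?F \<le> r" using roots[of "-1" 0] by simp
  have "?I \<subseteq> ?F" by (auto simp: frobenius_add frobenius_frobenius add.commute)
  then have IF: "card ?I \<le> card ?F" by (intro card_mono) auto
  have sum: "r * r = (\<Sum>c\<in>?I. card {s. ?t s = c})"
    using card_eq_sum_fibres[of "UNIV :: 'a set" ?I ?t] r by (simp add: power2_eq_square)
  also have "\<dots> \<le> card ?I * r" using sum_bounded_above[of ?I "\<lambda>c. card {s. ?t s = c}" r] fib by simp
  finally have "r \<le> card ?I" using r2 by simp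
  then have cI: "card ?I = r" and "card ?F \<le> card ?I" using IF F by auto
  then have "?I = ?F" using \<open>?I \<subseteq> ?F\<close> by (intro card_seteq) auto
  then have cIn: "c \<in> ?I" using c by simp
  show ?thesis
  proof (rule ccontr)
    assume "\<not> ?thesis"
    then have "card {s. ?t s = c} < r" using fib[of c] by simp
    then have "(\<Sum>c\<in>?I. card {s. ?t s = c}) < (\<Sum>c\<in>?I. r)"
      using fib cIn by (intro sum_strict_mono_ex1) auto
    then show False using sum cI by simp
  qed
qed

end

section \<open>The three kinds of forms as polar geometries\<close>

lemma bilinear_formD:
  assumes "bilinear_form f"
  shows "f (x + y) z = f x z + f y z" "f (c *s x) z = c * f x z"
    "f z (x + y) = f z x + f z y" "f z (c *s x) = c * f z x"
  using assms by (simp_all add: bilinear_form_def Vector_Spaces.linear_iff)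

lemma polar_geometry_quadratic:
  fixes Q :: "'a::{field,finite} ^ 'm::finite \<Rightarrow> 'a"
  assumes Q: "quadratic_form Q" and ns: "nonsingular Q"
  shows "polar_geometry (polar_form Q) (\<lambda>a. a) 1 Q (\<lambda>a. a) 1"
proof
  have b: "bilinear_form (polar_form Q)" and sc: "\<And>c x. Q (c *s x) = c ^ 2 * Q x"
    using Q by (auto simp: quadratic_form_def)
  show "polar_form Q (x + y) z = polar_form Q x z + polar_form Q y z"
    "polar_form Q (c *s x) z = c * polar_form Q x z" for x y z c by (rule bilinear_formD[OF b])+
  show "polar_form Q y x = 1 * polar_form Q x y" for x y by (simp add: polar_form_def add.commute)
  show "Q (c *s x) = c * c * Q x" for c x by (simp add: sc power2_eq_square)
  show "Q (x + y) = Q x + Q y + polar_form Q x y" for x y by (simp add: polar_form_def)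
  show "polar_form Q x x = 0" if "Q x = 0" for x
  proof -
    have "x + x = 2 *s x" by (simp add: vec_eq_iff)
    then show ?thesis using that sc[of 2 x] by (simp add: polar_form_def)
  qed
  show "x = 0" if "Q x = 0" "\<And>y. polar_form Q x y = 0" for x
    using ns that by (simp add: nonsingular_def)
qed auto

lemma polar_geometry_alternating:
  fixes f :: "'a::{field,finite} ^ 'm::finite \<Rightarrow> 'a ^ 'm \<Rightarrow> 'a"
  assumes f: "alternating_form f" and nd: "nondegenerate f"
  shows "polar_geometry f (\<lambda>a. a) (-1) (\<lambda>_. 0) (\<lambda>_. 0) CARD('a)"
proof
  have b: "bilinear_form f" and alt: "\<And>x. f x x = 0" using f by (auto simp: alternating_form_def)
  note bl = bilinear_formD[OF b]
  show "f (x + y) z = f x z + f y z" "f (c *s x) z = c * f x z" for x y z c by (rule bl)+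
  show "f y x = - 1 * f x y" for x y
    using alt[of "x + y"] unfolding bl by (simp add: alt eq_neg_iff_add_eq_0 add.commute)
  show "f x x = 0" for x by (rule alt)
  show "x = 0" if "\<And>y. f x y = 0" for x using nd that by (simp add: nondegenerate_def)
qed auto

lemma polar_geometry_hermitian:
  fixes f :: "'a::{field,finite} ^ 'm::finite \<Rightarrow> 'a ^ 'm \<Rightarrow> 'a"
  assumes f: "hermitian_form f" and nd: "nondegenerate f"
  shows "\<exists>r. r ^ 2 = CARD('a) \<and> polar_geometry f (\<lambda>a. a ^ r) 1 (\<lambda>x. f x x) (\<lambda>a. a + a ^ r) r"
proof -
  obtain r where r: "r ^ 2 = CARD('a)" and lin: "\<forall>y. Vector_Spaces.linear (*s) (*) (\<lambda>x. f x y)"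
    and sw': "\<forall>x y. f y x = f x y ^ r"
    using f unfolding hermitian_form_def by (elim exE conjE)
  have sw: "f z w = f w z ^ r" for z w by (rule sw'[rule_format])
  note fr = frobenius_add[OF r] and frfr = frobenius_frobenius[OF r]
  have l: "f (x + y) z = f x z + f y z" "f (c *s x) z = c * f x z" for x y z c
    using lin[rule_format, of z] by (simp_all add: Vector_Spaces.linear_iff)
  have rt: "f z (x + y) = f z x + f z y" "f z (c *s x) = c ^ r * f z x" for x y z c
    by (simp_all only: sw[of z] l fr power_mult_distrib)
  have "polar_geometry f (\<lambda>a. a ^ r) 1 (\<lambda>x. f x x) (\<lambda>a. a + a ^ r) r"
  proof
    show "f (x + y) z = f x z + f y z" "f (c *s x) z = c * f x z" for x y z c by (rule l)+
    show "f y x = 1 * f x y ^ r" for x y unfolding mult_1_left by (rule sw)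
    show "f (c *s x) (c *s x) = c * c ^ r * f x x" for c x by (simp add: l rt mult_ac)
    show "f (x + y) (x + y) = f x x + f y y + (f x y + f x y ^ r)" for x y
      unfolding sw[of y x, symmetric] by (simp add: l rt)
    show "card {a. a + a ^ r = f x x} = r" for x
      by (rule card_trace_fibre[OF r sw[symmetric]])
    show "x = 0" if "\<And>y. f x y = 0" for x using nd that by (simp add: nondegenerate_def)
    show "c * a + (c * a) ^ r = c * (a + a ^ r)" if "c ^ r = c" for c a :: 'a
      using that by (simp add: power_mult_distrib distrib_left)
    show "1 * a ^ r + (1 * a ^ r) ^ r = a + a ^ r" for a :: 'a by (simp add: frfr add.commute)
  qed (auto simp: fr frfr power_mult_distrib)
  then show ?thesis using r by blast
qed

section \<open>Opposition through the isometry group\<close>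

locale polar_space_form = ranked_polar_geometry B \<sigma> \<epsilon> N \<tau> \<rho> n d
  for B :: "'a::{field,finite} ^ 'm::finite \<Rightarrow> 'a ^ 'm \<Rightarrow> 'a" and \<sigma> \<epsilon> N \<tau> \<rho> n d +
  fixes \<Phi> :: "('a, 'a ^ 'm) form"
  assumes totally_isotropic_iff: "vec.subspace U \<Longrightarrow> totally_isotropic \<Phi> U \<longleftrightarrow> singular_subspace U"
    and isometric_preserves: "isometric g \<Longrightarrow> preserves_form \<Phi> g"
begin

lemma linear_isometric: "isometric g \<Longrightarrow> Vector_Spaces.linear (*s) (*s) g"
  by (simp add: Vector_Spaces.linear_iff isometric_def vec.vector_space_axioms)

lemma isometry_isometric: "isometric g \<Longrightarrow> isometry \<Phi> g"
  by (simp add: isometry_def linear_isometric isometric_bij isometric_preserves)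

lemma subspace_image_isometric: "isometric g \<Longrightarrow> vec.subspace U \<Longrightarrow> vec.subspace (g ` U)"
  by (intro module_hom.subspace_image[of "(*s)" "(*s)"] linear_isometric[THEN Vector_Spaces.linear.axioms(3)])

lemma span_image_isometric: "isometric g \<Longrightarrow> vec.span (g ` S) = g ` vec.span S"
  by (intro module_hom.span_image[of "(*s)" "(*s)"] linear_isometric[THEN Vector_Spaces.linear.axioms(3)])

lemma projectivity_comp:
  assumes "isometric g" "isometric h"
  shows "projectivity (\<lambda>x. g (h x)) = projectivity g \<circ> projectivity h"
  using subspace_image_isometric[OF assms(2)] by (auto simp: projectivity_def fun_eq_iff image_image)

lemma inv_projectivity:
  assumes g: "isometric g"
  shows "inv (projectivity g) = projectivity (inv g)"
proof (rule inv_unique_comp)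
  have gi: "(\<lambda>x. g (inv g x)) = (\<lambda>x. x)" "(\<lambda>x. inv g (g x)) = (\<lambda>x. x)"
    using isometric_bij[OF g] by (simp_all add: bij_def surj_f_inv_f)
  have id: "projectivity (\<lambda>x. x) = id" by (auto simp: projectivity_def fun_eq_iff)
  show "projectivity g \<circ> projectivity (inv g) = id" "projectivity (inv g) \<circ> projectivity g = id"
    unfolding projectivity_comp[OF g isometric_inv[OF g], symmetric] projectivity_comp[OF isometric_inv[OF g] g, symmetric] gi
    by (rule id)+
qed

lemma projectivity_in_polar_group: "isometric g \<Longrightarrow> projectivity g \<in> polar_group \<Phi>"
  using isometry_isometric by (auto simp: polar_group_def)

lemma maximal_flag_in_flags:
  assumes "maximal_flag \<Phi> n X"
  shows "X \<in> flags"
proof -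
  obtain U where U: "\<forall>i\<in>{1..n}. polar_subspace \<Phi> (U i) \<and> vec.dim (U i) = i"
      "\<forall>i\<in>{1..<n}. U i \<subset> U (Suc i)" "X = U ` {1..n}"
    using assms unfolding maximal_flag_def by blast
  have "singular_subspace (U i)" if "i \<in> {1..n}" for i
    using U(1) that totally_isotropic_iff[of "U i"] by (simp add: polar_subspace_def)
  then show ?thesis unfolding flags_def using U by (intro CollectI exI[of _ U]) auto
qed

text \<open>Corresponding parts have equal size, so \<open>card_pairing\<close> makes the kernels on
  the two sides equally large.\<close>

lemma opposite_flags_sym:
  assumes "opposite_flags X Y"
  shows "opposite_flags Y X"
proof -
  have F: "X \<in> flags" "Y \<in> flags" and o: "\<And>i. i \<in> {1..n} \<Longrightarrow> perp (part X i) \<inter> part Y i = {0}"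
    using assms by (simp_all add: opposite_flags_def)
  have "perp (part Y i) \<inter> part X i = {0}" if i: "i \<in> {1..n}" for i
  proof -
    have i': "i \<le> n" using i by simp
    have "card (part X i) = card (part Y i)"
      using F i' by (simp add: card_subspace flag_part(3,5))
    moreover have "card (part X i) > 0" using F i' by (simp add: card_subspace flag_part(5))
    ultimately have "card (perp (part Y i) \<inter> part X i) = 1"
      using card_pairing[OF flag_part(5)[OF F(1) i'] flag_part(5)[OF F(2) i']] o[OF i]
      by (cases "part Y i = {}") simp_all
    then obtain z where z: "perp (part Y i) \<inter> part X i = {z}" by (auto simp: card_1_singleton_iff)
    have "0 \<in> perp (part Y i) \<inter> part X i"
      using flag_part(5)[OF F(1) i'] subspace_perp by (auto simp: vec.subspace_0)
    then show ?thesis using z by auto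
  qed
  then show ?thesis using F by (simp add: opposite_flags_def)
qed

text \<open>In the pairing of \<open>part X i\<close> with \<open>part Y (i - 1)\<close> the kernel
  on the smaller side is trivial by opposition, so by \<open>card_pairing\<close> the kernel on the
  other side has \<open>CARD('a)\<close> vectors.\<close>

lemma opposite_flags_vector:
  assumes o: "opposite_flags X Y" and i: "i \<in> {1..n}"
  shows "\<exists>x. x \<noteq> 0 \<and> x \<in> part X i \<and> x \<in> perp (part Y (i - 1))"
proof -
  have F: "X \<in> flags" "Y \<in> flags" using o by (simp_all add: opposite_flags_def)
  have i': "i \<le> n" "i - 1 \<le> n" "i - 1 \<le> i" using i by auto
  have "perp (part X i) \<inter> part Y (i - 1) = {0}"
  proof (cases "i - 1 = 0")
    case True
    then show ?thesis using vec.subspace_0[OF subspace_perp] by auto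
  next
    case False
    then have "i - 1 \<in> {1..n}" using i by auto
    then have "perp (part X (i - 1)) \<inter> part Y (i - 1) = {0}" using o unfolding opposite_flags_def by blast
    moreover have "perp (part X i) \<subseteq> perp (part X (i - 1))"
      by (rule perp_mono[OF flag_part(4)[OF F(1) i'(3,1)]])
    moreover have "0 \<in> perp (part X i) \<inter> part Y (i - 1)"
      using flag_part(5)[OF F(2) i'(2)] subspace_perp by (auto simp: vec.subspace_0)
    ultimately show ?thesis by blast
  qed
  then have "CARD('a) ^ (i - 1) * card (perp (part Y (i - 1)) \<inter> part X i) = CARD('a) ^ i"
    using card_pairing[OF flag_part(5)[OF F(2) i'(2)] flag_part(5)[OF F(1) i'(1)]] F i'
    by (simp add: card_subspace flag_part(3,5))
  also have "\<dots> = CARD('a) ^ (i - 1) * CARD('a)" using i by (cases i) auto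
  finally have "card (perp (part Y (i - 1)) \<inter> part X i) = CARD('a)" by simp
  then have "card (perp (part Y (i - 1)) \<inter> part X i) > card {0 :: 'a ^ 'm}"
    using two_le_card_field[where 'a = 'a] by simp
  then have "\<not> perp (part Y (i - 1)) \<inter> part X i \<subseteq> {0}" using card_mono[of "{0 :: 'a ^ 'm}"] by (metis finite.emptyI finite_insert not_le)
  then show ?thesis by blast
qed

text \<open>The vectors of \<open>opposite_flags_vector\<close> for both orders of the flags form
  the frame. For \<open>i \<noteq> j\<close> one of the two choices makes \<open>x i\<close> and
  \<open>y j\<close> orthogonal; and \<open>x i\<close> is not orthogonal to \<open>y i\<close>,
  since it would then lie in \<open>perp (part Y i)\<close>.\<close>

lemma opposite_flags_frame:
  assumes o: "opposite_flags X Y"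
  shows "\<exists>x y. hyperbolic_frame n x y \<and> (\<forall>i\<le>n. part X i = vec.span (x ` {1..i}) \<and> part Y i = vec.span (y ` {1..i}))"
proof -
  have F: "X \<in> flags" "Y \<in> flags" using o by (simp_all add: opposite_flags_def)
  have o': "opposite_flags Y X" by (rule opposite_flags_sym[OF o])
  obtain x where x: "\<And>i. i \<in> {1..n} \<Longrightarrow> x i \<noteq> 0 \<and> x i \<in> part X i \<and> x i \<in> perp (part Y (i - 1))"
    using opposite_flags_vector[OF o] by metis
  obtain y where y: "\<And>i. i \<in> {1..n} \<Longrightarrow> y i \<noteq> 0 \<and> y i \<in> part Y i \<and> y i \<in> perp (part X (i - 1))"
    using opposite_flags_vector[OF o'] by metis
  have span: "part X i = vec.span (x ` {1..i}) \<and> (i \<in> {1..n} \<longrightarrow> part X i = vec.span (insert (x i) (part X (i - 1))))"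
    if o: "opposite_flags X Y" and x: "\<And>i. i \<in> {1..n} \<Longrightarrow> x i \<noteq> 0 \<and> x i \<in> part X i \<and> x i \<in> perp (part Y (i - 1))"
      and i: "i \<le> n" for X Y x i
    using i
  proof (induction i)
    case 0 then show ?case by simp
  next
    case (Suc i)
    have F: "X \<in> flags" "Y \<in> flags" using o by (simp_all add: opposite_flags_def)
    have xi: "x (Suc i) \<noteq> 0" "x (Suc i) \<in> part X (Suc i)" "x (Suc i) \<in> perp (part Y i)" using x[of "Suc i"] Suc.prems by auto
    have "x (Suc i) \<notin> part X i"
    proof
      assume h: "x (Suc i) \<in> part X i"
      show False
      proof (cases "i = 0")
        case True then show False using h xi by simp
      next
        case False
        then have "perp (part Y i) \<inter> part X i = {0}"
          using opposite_flags_sym[OF o] Suc.prems by (simp add: opposite_flags_def)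
        then show False using h xi by blast
      qed
    qed
    then have 1: "vec.span (insert (x (Suc i)) (part X i)) = part X (Suc i)"
      using xi Suc.prems flag_part(4)[OF F(1), of i "Suc i"]
      by (intro span_insert_eqI) (simp_all add: F flag_part(3,5))
    have "{1..Suc i} = insert (Suc i) {1..i}" by auto
    then have "vec.span (x ` {1..Suc i}) = vec.span (insert (x (Suc i)) (vec.span (x ` {1..i})))"
      by (simp add: vec.span_insert vec.span_span)
    then show ?case using Suc 1 by simp
  qed
  have zero: "B (x i) (y j) = 0" if "i < j" "i \<in> {1..n}" "j \<in> {1..n}"
    and "\<And>i. i \<in> {1..n} \<Longrightarrow> x i \<in> part X i" "\<And>i. i \<in> {1..n} \<Longrightarrow> y i \<in> perp (part X (i - 1))" "X \<in> flags" for x y X i j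
  proof -
    have "part X i \<subseteq> part X (j - 1)" using that by (intro flag_part(4)) auto
    then show ?thesis using that(2-5) perpD(2) by blast
  qed
  have frame: "hyperbolic_frame n x y"
    unfolding hyperbolic_frame_def
  proof (intro conjI ballI impI)
    fix i assume i: "i \<in> {1..n}"
    have i': "i \<le> n" "i - 1 \<le> n" using i by auto
    show "N (x i) = 0" "N (y i) = 0"
      using x[OF i] y[OF i] singular_subspaceD(2)[OF flag_part(2)[OF F(1) i'(1)]] singular_subspaceD(2)[OF flag_part(2)[OF F(2) i'(1)]] by auto
    show "B (x i) (y i) \<noteq> 0"
    proof
      assume h: "B (x i) (y i) = 0"
      have "part Y i = vec.span (insert (y i) (part Y (i - 1)))" using span[OF o' y i'(1)] i by blast
      moreover have "x i \<in> perp (insert (y i) (part Y (i - 1)))" using x[OF i] h by (simp add: perp_def)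
      ultimately have "x i \<in> perp (part Y i) \<inter> part X i" using x[OF i] by (simp add: perp_span)
      then show False using x[OF i] o' i by (auto simp: opposite_flags_def)
    qed
  next
    fix i j assume i: "i \<in> {1..n}" and j: "j \<in> {1..n}"
    have X: "x i \<in> part X n" "x j \<in> part X n" and Y: "y i \<in> part Y n" "y j \<in> part Y n"
      using x[OF i] x[OF j] y[OF i] y[OF j] flag_part(4)[OF F(1), of i n] flag_part(4)[OF F(1), of j n]
        flag_part(4)[OF F(2), of i n] flag_part(4)[OF F(2), of j n] i j by auto
    show "B (x i) (x j) = 0" by (rule singular_subspaceD(3)[OF flag_part(2)[OF F(1) le_refl] X])
    show "B (y i) (y j) = 0" by (rule singular_subspaceD(3)[OF flag_part(2)[OF F(2) le_refl] Y])
    assume "i \<noteq> j"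
    then consider "i < j" | "j < i" by linarith
    then show "B (x i) (y j) = 0"
    proof cases
      case 1 then show ?thesis using zero[of i j x X y] i j x y F by blast
    next
      case 2
      then have "B (y j) (x i) = 0" using zero[of j i y Y x] i j x y F by blast
      then show ?thesis using B_sym_0 by blast
    qed
  qed
  show ?thesis
  proof (intro exI conjI allI impI)
    show "hyperbolic_frame n x y" by (rule frame)
    fix i assume i: "i \<le> n"
    show "part X i = vec.span (x ` {1..i})" by (rule conjunct1[OF span[OF o x i]])
    show "part Y i = vec.span (y ` {1..i})" by (rule conjunct1[OF span[OF o' y i]])
  qed
qed

lemma span_scaled:
  assumes "\<And>i. i \<in> I \<Longrightarrow> \<exists>c. c \<noteq> 0 \<and> f i = c *s x i"
  shows "vec.span (f ` I) = vec.span (x ` I)"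
proof (rule antisym; rule vec.span_minimal[OF _ vec.subspace_span]; rule image_subsetI)
  fix i assume i: "i \<in> I"
  obtain c where c: "c \<noteq> 0" "f i = c *s x i" using assms[OF i] by blast
  have "x i \<in> vec.span (x ` I)" "f i \<in> vec.span (f ` I)" using i by (auto intro: vec.span_base)
  then show "f i \<in> vec.span (x ` I)" "x i \<in> vec.span (f ` I)"
    using c vec.span_scale[of "f i" "f ` I" "inverse c"] by (auto intro: vec.span_scale simp: vec.scale_scale)
qed

lemma frame_vectors:
  assumes p: "polar_frame \<Phi> n p"
  shows "\<exists>u. (\<forall>i\<in>frame_indices n. p i = vec.span {u i}) \<and> hyperbolic_frame n (\<lambda>i. u (int i)) (\<lambda>i. u (- int i))"
proof -
  have pt: "vec.subspace (p i)" "singular_subspace (p i)" "vec.dim (p i) = 1" if "i \<in> frame_indices n" for i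
    using p that totally_isotropic_iff[of "p i"] by (simp_all add: polar_frame_def polar_point_def polar_subspace_def)
  have ex: "\<exists>v. v \<noteq> 0 \<and> v \<in> p i \<and> p i = vec.span {v}" if i: "i \<in> frame_indices n" for i
  proof -
    have d0: "vec.dim {0 :: 'a ^ 'm} = 0" by (rule dim_eqI_card) (simp_all add: vec.subspace_single_0)
    have "\<not> p i \<subseteq> {0}"
    proof
      assume "p i \<subseteq> {0}"
      then have "vec.dim (p i) \<le> vec.dim {0 :: 'a ^ 'm}" by (rule vec.dim_subset)
      then show False using pt(3)[OF i] d0 by simp
    qed
    then obtain v where v: "v \<in> p i" "v \<notin> {0}" by blast
    have "vec.span (insert v {0}) = p i"
      by (rule span_insert_eqI) (use v pt[OF i] d0 in \<open>auto simp: vec.subspace_single_0 vec.subspace_0\<close>)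
    moreover have "vec.span (insert v {0}) = vec.span {v}" by (metis insert_commute vec.span_insert_0)
    ultimately show ?thesis using v by auto
  qed
  then obtain u where u: "\<And>i. i \<in> frame_indices n \<Longrightarrow> u i \<noteq> 0 \<and> u i \<in> p i \<and> p i = vec.span {u i}" by metis
  have N: "N (u i) = 0" if "i \<in> frame_indices n" for i
    using u[OF that] singular_subspaceD(2)[OF pt(2)[OF that]] by blast
  have Bu: "B (u i) (u j) = 0 \<longleftrightarrow> j \<noteq> - i" if i: "i \<in> frame_indices n" and j: "j \<in> frame_indices n" for i j
  proof -
    have col: "singular_subspace (vec.span (p i \<union> p j)) \<longleftrightarrow> j \<noteq> - i"
      using p i j totally_isotropic_iff[OF vec.subspace_span] by (simp add: polar_frame_def collinear_points_def)
    have mem: "u i \<in> vec.span (p i \<union> p j)" "u j \<in> vec.span (p i \<union> p j)"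
      using u[OF i] u[OF j] by (auto intro: vec.span_base)
    have "singular_subspace (vec.span (p i \<union> p j))" if h: "B (u i) (u j) = 0"
    proof -
      have "u j \<in> perp {u i}" using h B_sym_0 by (auto simp: perp_def)
      then have "u j \<in> perp (p i)" using u[OF i] by (simp add: perp_span)
      then have s: "singular_subspace (vec.span (insert (u j) (p i)))"
        by (rule singular_subspace_insert[OF pt(2)[OF i] _ N[OF j]])
      have "p j \<subseteq> vec.span (insert (u j) (p i))"
        using u[OF j] by (metis insertI1 empty_subsetI insert_subset vec.span_mono)
      then have "vec.span (p i \<union> p j) \<subseteq> vec.span (insert (u j) (p i))"
        by (intro vec.span_minimal vec.subspace_span) (auto intro: vec.span_base)
      then show ?thesis by (rule singular_subspace_subset[OF s vec.subspace_span])
    qed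
    then show ?thesis using col singular_subspaceD(3)[OF _ mem] by blast
  qed
  have fi: "int i \<in> frame_indices n" "- int i \<in> frame_indices n" if "i \<in> {1..n}" for i
    using that by (auto simp: frame_indices_def)
  have "hyperbolic_frame n (\<lambda>i. u (int i)) (\<lambda>i. u (- int i))"
    unfolding hyperbolic_frame_def using fi N Bu by auto
  then show ?thesis using u by blast
qed

text \<open>Let \<open>g\<close> carry the given frame to one adapted to \<open>X\<close> and
  \<open>Y\<close>, and let \<open>w\<close> reverse the given frame. Then \<open>g\<close> maps the
  standard flag to \<open>X\<close> and \<open>h = g \<circ> w\<close> maps it to \<open>Y\<close>;
  so \<open>inv h \<circ> g\<close> is the inverse of \<open>w\<close> and reverses the frame as
  well.\<close>

theorem opposite_flags_opposite:
  assumes p: "polar_frame \<Phi> n p" and o: "opposite_flags X Y"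
  shows "opposite \<Phi> n p X Y"
proof -
  have F: "X \<in> flags" "Y \<in> flags" using o by (simp_all add: opposite_flags_def)
  obtain u where u: "\<forall>i\<in>frame_indices n. p i = vec.span {u i}"
    and fu: "hyperbolic_frame n (\<lambda>i. u (int i)) (\<lambda>i. u (- int i))" using frame_vectors[OF p] by blast
  obtain x y where fxy: "hyperbolic_frame n x y"
    and xy: "\<And>i. i \<le> n \<Longrightarrow> part X i = vec.span (x ` {1..i}) \<and> part Y i = vec.span (y ` {1..i})"
    using opposite_flags_frame[OF o] by blast
  obtain g where g: "isometric g" and gx: "\<forall>i\<in>{1..n}. (\<exists>c. c \<noteq> 0 \<and> g (u (int i)) = c *s x i) \<and> (\<exists>c. c \<noteq> 0 \<and> g (u (- int i)) = c *s y i)"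
    using witt_frames[OF fu fxy] by blast
  obtain w where w: "isometric w" and wu: "\<forall>i\<in>{1..n}. (\<exists>c. c \<noteq> 0 \<and> w (u (int i)) = c *s u (- int i)) \<and>
      (\<exists>c. c \<noteq> 0 \<and> w (u (- int i)) = c *s u (int i))"
    using witt_frames[OF fu hyperbolic_frame_sym[OF fu]] by blast
  define h where "h = (\<lambda>z. g (w z))"
  have h: "isometric h" unfolding h_def by (rule isometric_comp[OF g w])
  have hu: "\<exists>c. c \<noteq> 0 \<and> h (u (int i)) = c *s y i" if i: "i \<in> {1..n}" for i
  proof -
    obtain c c' where "c \<noteq> 0" "w (u (int i)) = c *s u (- int i)" "c' \<noteq> 0" "g (u (- int i)) = c' *s y i"
      using wu gx i by blast
    then have "c * c' \<noteq> 0" "h (u (int i)) = (c * c') *s y i"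
      by (simp_all add: h_def isometricD(2)[OF g] vec.scale_scale)
    then show ?thesis by blast
  qed
  have std: "standard_flag n p = (\<lambda>i. vec.span ((\<lambda>j. u (int j)) ` {1..i})) ` {1..n}"
    unfolding standard_flag_def
  proof (rule image_cong[OF refl])
    fix i assume i: "i \<in> {1..n}"
    have pj: "p (int j) = vec.span {u (int j)}" if "j \<in> {1..i}" for j
      using u that i by (auto simp: frame_indices_def)
    show "vec.span (\<Union>j\<in>{1..i}. p (int j)) = vec.span ((\<lambda>j. u (int j)) ` {1..i})"
    proof (rule antisym; rule vec.span_minimal[OF _ vec.subspace_span])
      show "(\<Union>j\<in>{1..i}. p (int j)) \<subseteq> vec.span ((\<lambda>j. u (int j)) ` {1..i})"
      proof (rule UN_least)
        fix j assume j: "j \<in> {1..i}"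
        show "p (int j) \<subseteq> vec.span ((\<lambda>j. u (int j)) ` {1..i})"
          unfolding pj[OF j] using j by (intro vec.span_mono) auto
      qed
      show "(\<lambda>j. u (int j)) ` {1..i} \<subseteq> vec.span (\<Union>j\<in>{1..i}. p (int j))"
      proof (rule image_subsetI)
        fix j assume j: "j \<in> {1..i}"
        have "u (int j) \<in> p (int j)" unfolding pj[OF j] by (simp add: vec.span_base)
        then show "u (int j) \<in> vec.span (\<Union>j\<in>{1..i}. p (int j))" using j by (intro vec.span_base) blast
      qed
    qed
  qed
  have img: "projectivity f ` standard_flag n p = Z"
    if f: "isometric f" and Z: "Z \<in> flags" and fu: "\<And>i. i \<in> {1..n} \<Longrightarrow> \<exists>c. c \<noteq> 0 \<and> f (u (int i)) = c *s z i"
      and zz: "\<And>i. i \<le> n \<Longrightarrow> part Z i = vec.span (z ` {1..i})" for f Z z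
  proof -
    have "projectivity f (vec.span ((\<lambda>j. u (int j)) ` {1..i})) = part Z i" if i: "i \<in> {1..n}" for i
    proof -
      have "projectivity f (vec.span ((\<lambda>j. u (int j)) ` {1..i})) = vec.span (f ` (\<lambda>j. u (int j)) ` {1..i})"
        by (simp add: projectivity_def vec.subspace_span span_image_isometric[OF f])
      also have "\<dots> = vec.span ((\<lambda>j. f (u (int j))) ` {1..i})" by (simp only: image_image)
      also have "\<dots> = vec.span (z ` {1..i})" using fu i by (intro span_scaled) auto
      finally show ?thesis using zz i by simp
    qed
    then have "projectivity f ` standard_flag n p = part Z ` {1..n}"
      unfolding std image_image by (intro image_cong) auto
    then show ?thesis using flag_part(1)[OF Z] by simp
  qed
  have X: "X = projectivity g ` standard_flag n p" 
    by (rule img[OF g F(1), of x, symmetric]) (use gx xy in auto)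
  have Y: "Y = projectivity h ` standard_flag n p" 
    by (rule img[OF h F(2), of y, symmetric, OF hu]) (use xy in auto)
  \<comment> \<open>Opposition leaves the choice of the element inducing the longest Weyl element
    free; taking \<open>inv h \<circ> g\<close> itself makes the two double cosets literally
    equal.\<close>
  define v where "v = (\<lambda>z. inv h (g z))"
  have v: "isometric v" unfolding v_def by (rule isometric_comp[OF isometric_inv[OF h] g])
  have inv: "inv (projectivity h) \<circ> projectivity g = projectivity v"
    unfolding inv_projectivity[OF h] v_def by (rule projectivity_comp[symmetric, OF isometric_inv[OF h] g])
  have vw: "v (w z) = z" for z
    using isometric_bij[OF h] unfolding v_def h_def[symmetric] by (metis h_def bij_def inv_f_f)
  have "induces_w0 n p (projectivity v)"
    unfolding induces_w0_def
  proof
    fix i assume i: "i \<in> frame_indices n"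
    then have mi: "- i \<in> frame_indices n" by (auto simp: frame_indices_def)
    have "\<exists>c. c \<noteq> 0 \<and> w (u (- i)) = c *s u i"
    proof (cases "i > 0")
      case True
      then have "nat i \<in> {1..n}" "i = int (nat i)" using i by (auto simp: frame_indices_def)
      then show ?thesis using wu by metis
    next
      case False
      then have "nat (- i) \<in> {1..n}" "i = - int (nat (- i))" using i by (auto simp: frame_indices_def)
      then show ?thesis using wu by (metis minus_minus)
    qed
    then obtain c where c: "c \<noteq> 0" "w (u (- i)) = c *s u i" by blast
    have "c *s v (u i) = u (- i)" using vw[of "u (- i)"] c by (simp add: isometricD(2)[OF v])
    then have "v (u i) = inverse c *s u (- i)" using c by (metis vec.scale_scale left_inverse vec.scale_one)
    then have "\<exists>c. c \<noteq> 0 \<and> v (u i) = c *s u (- i)" using c by (intro exI[of _ "inverse c"]) simp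
    then have "vec.span ((\<lambda>i. v (u i)) ` {i}) = vec.span ((\<lambda>i. u (- i)) ` {i})"
      by (intro span_scaled) simp
    moreover have "projectivity v (p i) = vec.span (v ` {u i})"
      using u i by (simp add: projectivity_def vec.subspace_span span_image_isometric[OF v, of "{u i}", simplified])
    ultimately show "projectivity v (p i) = p (- i)" using u mi by simp
  qed
  then show ?thesis
    unfolding opposite_def Let_def
    using X Y inv projectivity_in_polar_group[OF g] projectivity_in_polar_group[OF h] projectivity_in_polar_group[OF v]
    by (intro bexI[of _ "projectivity g"] bexI[of _ "projectivity h"] bexI[of _ "projectivity v"]) simp_all
qed

end

section \<open>The bounds\<close>

text \<open>The mixed term \<open>a * k\<close> is the source of the product
  \<open>k * (n - k)\<close> in the exponent of the bound.\<close>

lemma choose_2_add: "(a + k) choose 2 = (a choose 2) + (k choose 2) + a * k" for a k :: nat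
  by (induction a) (simp_all add: numeral_2_eq_2)

lemma prod_split_factor:
  fixes f :: "nat \<Rightarrow> real"
  assumes "finite A" "a \<in> A" "f a \<noteq> 0"
  shows "prod f A * c / f a = prod f (A - {a}) * c"
  using assms by (simp add: prod.remove[of A a])

context polar_space_form begin

lemma card_flags_eq:
  fixes e :: real
  assumes e: "real (\<rho> * CARD('a) ^ d) = real CARD('a) powr e"
  shows "real (card flags) = (\<Prod>i=1..n. real CARD('a) powr (real n + e - real i) + 1) * (\<Prod>k=1..n. q_number (real CARD('a)) k)"
proof -
  let ?q = "real CARD('a)"
  have q: "?q > 1" using two_le_card_field[where 'a = 'a] by simp
  have "real (card flags) = (\<Prod>i<n. real (num_covers (Suc i)))" by (simp add: card_flags)
  also have "\<dots> = (\<Prod>i<n. q_number ?q (Suc i) * (?q powr (real i + e) + 1))"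
  proof (intro prod.cong refl)
    fix i
    have "?q powr (real i + e) = ?q ^ i * ?q powr e" using q by (simp add: powr_add powr_realpow)
    then show "real (num_covers (Suc i)) = q_number ?q (Suc i) * (?q powr (real i + e) + 1)"
      unfolding num_covers_eq e q_number_def by simp
  qed
  also have "\<dots> = (\<Prod>i<n. ?q powr (real i + e) + 1) * (\<Prod>i<n. q_number ?q (Suc i))"
    by (simp add: prod.distrib mult.commute)
  also have "(\<Prod>i<n. ?q powr (real i + e) + 1) = (\<Prod>i=1..n. ?q powr (real n + e - real i) + 1)"
    by (rule prod.reindex_bij_witness[of _ "\<lambda>i. n - i" "\<lambda>i. n - i"]) (auto simp: of_nat_diff algebra_simps)
  also have "(\<Prod>i<n. q_number ?q (Suc i)) = (\<Prod>k=1..n. q_number ?q k)"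
    by (rule prod.reindex_bij_witness[of _ "\<lambda>i. i - 1" Suc]) auto
  finally show ?thesis .
qed

theorem EKR_bound:
  fixes e m :: real
  assumes n: "1 \<le> n" and e: "real (\<rho> * CARD('a) ^ d) = real CARD('a) powr e"
    and p: "polar_frame \<Phi> n p" and C: "EKR_set \<Phi> n p C"
    and m: "\<And>k. k \<le> n \<Longrightarrow> odd k \<Longrightarrow> m \<le> real k * (real n - real k + e)"
  shows "real (card C) \<le> (\<Prod>i=1..n. real CARD('a) powr (real n + e - real i) + 1) *
    (\<Prod>k=1..n. q_number (real CARD('a)) k) / (1 + real CARD('a) powr m)"
proof -
  define q where "q = real CARD('a)"
  define Q where "Q = real (\<rho> * CARD('a) ^ d)"
  have q: "q > 1" using two_le_card_field[where 'a = 'a] by (simp add: q_def)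
  have Q: "Q = q powr e" using e by (simp add: q_def Q_def)
  have "real (\<rho> * CARD('a) ^ d) > 0" unfolding e using q by (simp add: q_def)
  then have rho: "\<rho> > 0" by (cases \<rho>) auto
  define D where "D = q ^ (2 * (n choose 2)) * Q ^ n"
  \<comment> \<open>The row sum divided by \<open>q powr m\<close>, so that
    \<open>D + c = c * (1 + q powr m)\<close> turns the ratio bound into the quotient of the
    theorem.\<close>
  define c where "c = D / q powr m"
  have Qp: "Q ^ j = q powr (e * real j)" for j using q by (simp add: Q powr_powr[symmetric] powr_realpow)
  have D: "D = q powr (2 * real (n choose 2) + e * real n)"
    unfolding D_def Qp using q by (simp add: powr_add powr_realpow[symmetric])
  have pos: "D > 0" "c > 0" using q by (simp_all add: D c_def)
  have bd: "q ^ ((n choose 2) + ((n - k) choose 2) + (k choose 2)) * Q ^ (n - k) \<le> c" if k: "k \<le> n" "odd k" for k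
  proof -
    have "n choose 2 = ((n - k) choose 2) + (k choose 2) + (n - k) * k" using choose_2_add[of "n - k" k] k by simp
    then have nk: "real (n choose 2) = real ((n - k) choose 2) + real (k choose 2) + (real n - real k) * real k"
      using k by (simp add: of_nat_diff)
    have "q ^ ((n choose 2) + ((n - k) choose 2) + (k choose 2)) * Q ^ (n - k)
        = q powr (real ((n choose 2) + ((n - k) choose 2) + (k choose 2)) + e * real (n - k))"
      unfolding Qp powr_add using q by (simp add: powr_realpow del: of_nat_add)
    also have "\<dots> \<le> q powr (2 * real (n choose 2) + e * real n - m)"
    proof (rule powr_mono)
      have "m \<le> (real n - real k) * real k + e * real k" using m[OF k] by (simp add: algebra_simps)
      then show "real ((n choose 2) + ((n - k) choose 2) + (k choose 2)) + e * real (n - k)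
          \<le> 2 * real (n choose 2) + e * real n - m"
        using k nk by (simp add: of_nat_diff algebra_simps)
    qed (use q in simp)
    also have "\<dots> = c" by (simp add: c_def D powr_diff)
    finally show ?thesis .
  qed
  have CF: "C \<subseteq> flags" using C maximal_flag_in_flags by (auto simp: EKR_set_def)
  have ekr: "\<not> opposite_flags X Y" if "X \<in> C" "Y \<in> C" for X Y
  proof
    assume o: "opposite_flags X Y"
    \<comment> \<open>\<open>EKR_set\<close> speaks of distinct flags; a flag is not opposite to
      itself, because its generator is orthogonal to itself.\<close>
    have "X \<noteq> Y"
    proof
      assume "X = Y"
      then have "perp (part X n) \<inter> part X n = {0}" and F: "X \<in> flags" using o n by (simp_all add: opposite_flags_def)
      then have "part X n = {0}" using singular_subspaceD(4)[OF flag_part(2)[OF F le_refl]] by blast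
      then have "vec.dim (part X n) = 0" by (simp add: dim_eqI_card[of _ 0] vec.subspace_single_0)
      then show False using flag_part(3)[OF F le_refl] n by simp
    qed
    then have "\<not> opposite \<Phi> n p X Y" using C that by (auto simp: EKR_set_def pairwise_def)
    then show False using opposite_flags_opposite[OF p o] by contradiction
  qed
  have "real (card C) * (D + c) \<le> c * real (card flags)"
    unfolding D_def q_def Q_def
    by (rule hoffman_bound[OF n rho CF ekr]) (use pos bd in \<open>simp_all add: q_def Q_def\<close>)
  also have "D + c = c * (1 + q powr m)" using q by (simp add: c_def field_simps)
  finally have "c * (real (card C) * (1 + q powr m)) \<le> c * real (card flags)" by (simp add: mult_ac)
  then have "real (card C) * (1 + q powr m) \<le> real (card flags)" using pos by simp
  moreover have "1 + q powr m > 0" by (simp add: add_pos_nonneg)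
  ultimately have "real (card C) \<le> real (card flags) / (1 + q powr m)" by (simp add: pos_le_divide_eq)
  then show ?thesis unfolding card_flags_eq[OF e] q_def .
qed

end

section \<open>The classical polar spaces as instances\<close>

lemma polar_space_formI:
  fixes B :: "'a::{field,finite} ^ 'm::finite \<Rightarrow> 'a ^ 'm \<Rightarrow> 'a"
  assumes pg: "polar_geometry B \<sigma> \<epsilon> N \<tau> \<rho>" and rank: "polar_rank \<Phi> = n" and dim: "CARD('m) = 2 * n + d"
    and ti: "\<And>U. vec.subspace U \<Longrightarrow> totally_isotropic \<Phi> U \<longleftrightarrow> (\<forall>x\<in>U. N x = 0) \<and> (\<forall>x\<in>U. \<forall>y\<in>U. B x y = 0)"
    and pres: "\<And>g. (\<And>x y. B (g x) (g y) = B x y) \<Longrightarrow> (\<And>x. N (g x) = N x) \<Longrightarrow> preserves_form \<Phi> g"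
  shows "polar_space_form B \<sigma> \<epsilon> N \<tau> \<rho> n d \<Phi>"
proof -
  interpret polar_geometry B \<sigma> \<epsilon> N \<tau> \<rho> by (rule pg)
  have ti': "totally_isotropic \<Phi> U \<longleftrightarrow> singular_subspace U" if "vec.subspace U" for U
    using ti[OF that] that by (auto simp: singular_subspace_def perp_def)
  let ?S = "{U. vec.subspace U \<and> totally_isotropic \<Phi> U}"
  have S: "U \<in> ?S \<longleftrightarrow> singular_subspace U" for U using ti' singular_subspaceD(1) by blast
  have "n = Max (vec.dim ` ?S)" using rank by (simp add: polar_rank_def)
  moreover have "vec.dim ` ?S \<noteq> {}" using S singular_subspace_0 by blast
  ultimately have "n \<in> vec.dim ` ?S" and le: "\<And>k. k \<in> vec.dim ` ?S \<Longrightarrow> k \<le> n" by simp_all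
  moreover have Seq: "?S = {U. singular_subspace U}" using S by blast
  ultimately have ex: "\<exists>M. singular_subspace M \<and> vec.dim M = n" and le': "\<And>U. singular_subspace U \<Longrightarrow> vec.dim U \<le> n"
    unfolding Seq by auto
  show ?thesis
  proof unfold_locales
    show "\<exists>M. singular_subspace M \<and> vec.dim M = n" by (rule ex)
    show "singular_subspace U \<Longrightarrow> vec.dim U \<le> n" for U by (rule le')
    show "CARD('m) = 2 * n + d" by (rule dim)
    show "vec.subspace U \<Longrightarrow> totally_isotropic \<Phi> U \<longleftrightarrow> singular_subspace U" for U by (rule ti')
    show "isometric g \<Longrightarrow> preserves_form \<Phi> g" for g using pres isometricD(3,4) by blast
  qed
qed

lemma polar_space_form_quadratic:
  fixes Q :: "'a::{field,finite} ^ 'm::finite \<Rightarrow> 'a"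
  assumes "quadratic_form Q" "nonsingular Q" "CARD('m) = 2 * n + d" "polar_rank (Quadratic Q) = n"
  shows "polar_space_form (polar_form Q) (\<lambda>a. a) 1 Q (\<lambda>a. a) 1 n d (Quadratic Q)"
proof (rule polar_space_formI[OF polar_geometry_quadratic[OF assms(1,2)] assms(4,3)])
  fix U :: "('a ^ 'm) set" assume U: "vec.subspace U"
  then have "polar_form Q x y = 0" if "\<forall>x\<in>U. Q x = 0" "x \<in> U" "y \<in> U" for x y
    using that vec.subspace_add[OF U that(2,3)] by (simp add: polar_form_def)
  then show "totally_isotropic (Quadratic Q) U \<longleftrightarrow> (\<forall>x\<in>U. Q x = 0) \<and> (\<forall>x\<in>U. \<forall>y\<in>U. polar_form Q x y = 0)"
    by auto
qed simp

lemma polar_space_form_alternating: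
  fixes f :: "'a::{field,finite} ^ 'm::finite \<Rightarrow> 'a ^ 'm \<Rightarrow> 'a"
  assumes "alternating_form f" "nondegenerate f" "CARD('m) = 2 * n + d" "polar_rank (Alternating f) = n"
  shows "polar_space_form f (\<lambda>a. a) (-1) (\<lambda>_. 0) (\<lambda>_. 0) CARD('a) n d (Alternating f)"
  by (rule polar_space_formI[OF polar_geometry_alternating[OF assms(1,2)] assms(4,3)]) simp_all

lemma polar_space_form_hermitian:
  fixes f :: "'a::{field,finite} ^ 'm::finite \<Rightarrow> 'a ^ 'm \<Rightarrow> 'a"
  assumes "hermitian_form f" "nondegenerate f" "CARD('m) = 2 * n + d" "polar_rank (Hermitian f) = n"
  shows "\<exists>r. r ^ 2 = CARD('a) \<and>
    polar_space_form f (\<lambda>a. a ^ r) 1 (\<lambda>x. f x x) (\<lambda>a. a + a ^ r) r n d (Hermitian f)"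
proof -
  obtain r where r: "r ^ 2 = CARD('a)" "polar_geometry f (\<lambda>a. a ^ r) 1 (\<lambda>x. f x x) (\<lambda>a. a + a ^ r) r"
    using polar_geometry_hermitian[OF assms(1,2)] by blast
  have "polar_space_form f (\<lambda>a. a ^ r) 1 (\<lambda>x. f x x) (\<lambda>a. a + a ^ r) r n d (Hermitian f)"
    by (rule polar_space_formI[OF r(2) assms(4,3)]) auto
  then show ?thesis using r(1) by blast
qed

text \<open>The form determines \<open>\<rho>\<close>, which is \<open>1\<close>, \<open>r\<close>
  or \<open>q\<close> with \<open>r * r = q\<close>, and the dimension determines \<open>d\<close>.
  In the six cases \<open>\<rho> * q ^ d\<close> is \<open>1\<close>, \<open>r\<close>,
  \<open>q\<close>, \<open>q\<close>, \<open>r * q\<close> and \<open>q ^ 2\<close>.\<close>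

lemma classical_polar_space_form:
  fixes \<Phi> :: "('a::{field,finite}, 'a ^ 'm::finite) form"
  assumes "classical_polar_space \<Phi> n e"
  shows "\<exists>B \<sigma> \<epsilon> N \<tau> \<rho> d. polar_space_form B \<sigma> \<epsilon> N \<tau> \<rho> n d \<Phi> \<and> real (\<rho> * CARD('a) ^ d) = real CARD('a) powr e"
proof -
  let ?q = "real CARD('a)"
  have q: "?q > 1" using two_le_card_field[where 'a = 'a] by simp
  have half: "real r = ?q powr (1/2)" if "r ^ 2 = CARD('a)" for r
    using that q by (simp add: powr_half_sqrt flip: that)
  show ?thesis
    using assms
  proof cases
    case (hyperbolic_quadric Q)
    then have "polar_space_form (polar_form Q) (\<lambda>a. a) 1 Q (\<lambda>a. a) 1 n 0 \<Phi>"
      using polar_space_form_quadratic[of Q n 0] by simp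
    moreover have "real (1 * CARD('a) ^ 0) = ?q powr e" using hyperbolic_quadric q by simp
    ultimately show ?thesis by blast
  next
    case (hermitian_even f)
    then obtain r where r: "r ^ 2 = CARD('a)"
      "polar_space_form f (\<lambda>a. a ^ r) 1 (\<lambda>x. f x x) (\<lambda>a. a + a ^ r) r n 0 \<Phi>"
      using polar_space_form_hermitian[of f n 0] by auto
    moreover have "real (r * CARD('a) ^ 0) = ?q powr e"
    proof -
      have "e = 1/2" using hermitian_even by simp
      show ?thesis unfolding \<open>e = 1/2\<close> half[OF r(1), symmetric] by simp
    qed
    ultimately show ?thesis by blast
  next
    case (symplectic f)
    then have "polar_space_form f (\<lambda>a. a) (-1) (\<lambda>_. 0) (\<lambda>_. 0) CARD('a) n 0 \<Phi>"
      using polar_space_form_alternating[of f n 0] by simp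
    moreover have "real (CARD('a) * CARD('a) ^ 0) = ?q powr e" using symplectic q by simp
    ultimately show ?thesis by blast
  next
    case (parabolic_quadric Q)
    then have "polar_space_form (polar_form Q) (\<lambda>a. a) 1 Q (\<lambda>a. a) 1 n 1 \<Phi>"
      using polar_space_form_quadratic[of Q n 1] by simp
    moreover have "real (1 * CARD('a) ^ 1) = ?q powr e" using parabolic_quadric q by simp
    ultimately show ?thesis by blast
  next
    case (hermitian_odd f)
    then obtain r where r: "r ^ 2 = CARD('a)"
      "polar_space_form f (\<lambda>a. a ^ r) 1 (\<lambda>x. f x x) (\<lambda>a. a + a ^ r) r n 1 \<Phi>"
      using polar_space_form_hermitian[of f n 1] by auto
    moreover have "real (r * CARD('a) ^ 1) = ?q powr e"
    proof -
      have e: "e = 1/2 + 1" using hermitian_odd by simp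
      have "?q powr e = ?q powr (1/2 + 1)" unfolding e ..
      also have "\<dots> = real r * ?q" unfolding powr_add half[OF r(1)] using q by simp
      finally show ?thesis by simp
    qed
    ultimately show ?thesis by blast
  next
    case (elliptic_quadric Q)
    then have "polar_space_form (polar_form Q) (\<lambda>a. a) 1 Q (\<lambda>a. a) 1 n 2 \<Phi>"
      using polar_space_form_quadratic[of Q n 2] by simp
    moreover have "real (1 * CARD('a) ^ 2) = ?q powr e" using elliptic_quadric q by simp
    ultimately show ?thesis by blast
  qed
qed

theorem theorem3p11:
  fixes \<Phi> :: "('a::{field,finite}, 'a ^ 'm::finite) form"
    and n :: nat and e q :: real
    and p :: "int \<Rightarrow> ('a ^ 'm) set"
    and C :: "('a ^ 'm) set set set"
  assumes "n \<ge> 3"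
    and "q = real CARD('a)"
    and "classical_polar_space \<Phi> n e"
    and "polar_frame \<Phi> n p"
    and "EKR_set \<Phi> n p C"
  shows
    "(e \<ge> 1 \<or> even n \<longrightarrow>
        real (card C)
          \<le> (\<Prod>i=1..n. q powr (real n + e - real i) + 1) * (\<Prod>k=1..n. q_number q k)
              / (1 + q powr (real n + e - 1))
        \<and> (\<Prod>i=1..n. q powr (real n + e - real i) + 1) * (\<Prod>k=1..n. q_number q k)
              / (1 + q powr (real n + e - 1))
          = (\<Prod>i=2..n. q powr (real n + e - real i) + 1) * (\<Prod>k=1..n. q_number q k))
     \<and> (e = 1/2 \<and> odd n \<longrightarrow>
        real (card C)
          \<le> (\<Prod>i=1..n. q powr (real n + 1/2 - real i) + 1) * (\<Prod>k=1..n. q_number q k)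
              / (1 + q powr (real n / 2))
        \<and> (\<Prod>i=1..n. q powr (real n + 1/2 - real i) + 1) * (\<Prod>k=1..n. q_number q k)
              / (1 + q powr (real n / 2))
          = (\<Prod>i\<in>{i\<in>{1..n}. real i \<noteq> (real n + 1) / 2}. q powr (real n + 1/2 - real i) + 1)
              * (\<Prod>k=1..n. q_number q k))
     \<and> (e = 0 \<and> odd n \<longrightarrow>
        real (card C)
          \<le> (\<Prod>i=1..n. q ^ (n - i) + 1) * (\<Prod>k=1..n. q_number q k) / 2
        \<and> (\<Prod>i=1..n. q ^ (n - i) + 1) * (\<Prod>k=1..n. q_number q k) / 2
          = (\<Prod>i=1..n-1. q ^ (n - i) + 1) * (\<Prod>k=1..n. q_number q k))"
proof -
  have q: "q > 1" using two_le_card_field[where 'a = 'a] assms(2) by simp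
  have e: "e \<ge> 0" using assms(3) by cases auto
  obtain B \<sigma> \<epsilon> N \<tau> \<rho> d where F: "polar_space_form B \<sigma> \<epsilon> N \<tau> \<rho> n d \<Phi>"
    and rho: "real (\<rho> * CARD('a) ^ d) = real CARD('a) powr e"
    using classical_polar_space_form[OF assms(3)] by blast
  have bound: "real (card C) \<le> (\<Prod>i=1..n. q powr (real n + e - real i) + 1) * (\<Prod>k=1..n. q_number q k) / (1 + q powr m)"
    if "\<And>k. k \<le> n \<Longrightarrow> odd k \<Longrightarrow> m \<le> real k * (real n - real k + e)" for m
    unfolding assms(2) using polar_space_form.EKR_bound[OF F _ rho assms(4,5) that] assms(1) by simp
  have nz: "q powr x + 1 \<noteq> 0" for x using add_pos_pos[of "q powr x" 1] q by simp
  show ?thesis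
  proof (intro conjI impI; (elim conjE)?)
    assume h: "e \<ge> 1 \<or> even n"
    show "real (card C) \<le> (\<Prod>i=1..n. q powr (real n + e - real i) + 1) * (\<Prod>k=1..n. q_number q k)
        / (1 + q powr (real n + e - 1))"
    proof (rule bound)
      fix k :: nat assume k: "k \<le> n" "odd k"
      \<comment> \<open>This could fail only for \<open>k = n\<close> with \<open>e < 1\<close>, and
        then \<open>n\<close> would be odd.\<close>
      have "real n + e - real k - 1 \<ge> 0"
      proof (cases "e \<ge> 1")
        case True then show ?thesis using k by simp
      next
        case False
        then have "k \<noteq> n" using h k by auto
        then have "real k + 1 \<le> real n" using k by linarith
        then show ?thesis using e by simp
      qed
      moreover have "real k - 1 \<ge> 0" using k(2) by (cases k) auto
      \<comment> \<open>The product equals \<open>k * (n - k + e) - (n + e - 1)\<close>, so the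
        minimum is taken at \<open>k = 1\<close>.\<close>
      ultimately have "0 \<le> (real k - 1) * (real n + e - real k - 1)" by simp
      then show "real n + e - 1 \<le> real k * (real n - real k + e)" by (simp add: algebra_simps)
    qed
    have "{2..n} = {1..n} - {1}" by auto
    then show "(\<Prod>i=1..n. q powr (real n + e - real i) + 1) * (\<Prod>k=1..n. q_number q k) / (1 + q powr (real n + e - 1))
        = (\<Prod>i=2..n. q powr (real n + e - real i) + 1) * (\<Prod>k=1..n. q_number q k)"
      using prod_split_factor[of "{1..n}" 1 "\<lambda>i. q powr (real n + e - real i) + 1"] nz assms(1)
      by (simp add: add.commute)
  next
    assume h: "e = 1/2" "odd n"
    show "real (card C) \<le> (\<Prod>i=1..n. q powr (real n + 1/2 - real i) + 1) * (\<Prod>k=1..n. q_number q k)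
        / (1 + q powr (real n / 2))"
      unfolding h(1)[symmetric]
    proof (rule bound)
      fix k :: nat assume k: "k \<le> n" "odd k"
      have "real k - 1/2 \<ge> 0" using k(2) by (cases k) auto
      \<comment> \<open>A factorisation of \<open>k * (n - k + 1/2) - n / 2\<close>, which vanishes
        at \<open>k = n\<close>; as \<open>n\<close> is odd, the minimum is taken there.\<close>
      then have "0 \<le> (real n - real k) * (real k - 1/2)" using k(1) by simp
      also have "\<dots> = real k * (real n - real k + e) - real n / 2" unfolding h(1) by (simp add: field_simps)
      finally show "real n / 2 \<le> real k * (real n - real k + e)" by simp
    qed
    \<comment> \<open>The factor equal to the denominator has the index \<open>(n + 1) / 2\<close>,
      an integer because \<open>n\<close> is odd.\<close>
    obtain j where j: "n = 2 * j + 1" using h(2) by (rule oddE)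
    then have "{i \<in> {1..n}. real i \<noteq> (real n + 1) / 2} = {1..n} - {j + 1}" by auto
    moreover have "real n + 1/2 - real (j + 1) = real n / 2" using j by simp
    ultimately show "(\<Prod>i=1..n. q powr (real n + 1/2 - real i) + 1) * (\<Prod>k=1..n. q_number q k) / (1 + q powr (real n / 2))
        = (\<Prod>i\<in>{i\<in>{1..n}. real i \<noteq> (real n + 1) / 2}. q powr (real n + 1/2 - real i) + 1) * (\<Prod>k=1..n. q_number q k)"
      using prod_split_factor[of "{1..n}" "j + 1" "\<lambda>i. q powr (real n + 1/2 - real i) + 1"] nz j
      by (simp only: add.commute[of 1]) simp
  next
    assume h: "e = 0" "odd n"
    have pw: "(\<Prod>i=1..n. q powr (real n + e - real i) + 1) = (\<Prod>i=1..n. q ^ (n - i) + 1)"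
      using q h(1) by (intro prod.cong) (auto simp: powr_realpow[symmetric] of_nat_diff)
    \<comment> \<open>For \<open>e = 0\<close> the exponent at \<open>k = n\<close> is
      \<open>0\<close>, so the denominator is \<open>1 + 1\<close>, which is also the factor of
      index \<open>n\<close>.\<close>
    have "real (card C) \<le> (\<Prod>i=1..n. q powr (real n + e - real i) + 1) * (\<Prod>k=1..n. q_number q k) / (1 + q powr 0)"
      by (rule bound) (simp add: h(1))
    then show "real (card C) \<le> (\<Prod>i=1..n. q ^ (n - i) + 1) * (\<Prod>k=1..n. q_number q k) / 2"
      unfolding pw using q by simp
    have "{1..n - 1} = {1..n} - {n}" by auto
    then show "(\<Prod>i=1..n. q ^ (n - i) + 1) * (\<Prod>k=1..n. q_number q k) / 2
        = (\<Prod>i=1..n-1. q ^ (n - i) + 1) * (\<Prod>k=1..n. q_number q k)"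
      using prod_split_factor[of "{1..n}" n "\<lambda>i. q ^ (n - i) + 1" "\<Prod>k=1..n. q_number q k"] assms(1) by simp
  qed
qed

end
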